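(* Let $G=(V,E)$ be a DAG with $n=|V|$ and $m=|E|$, let $M\ge 1$ be the number of identical machines and $\rho>1$ an integer communication delay. The algorithm ScheduleGeneralGraph (described in the context), run with $\gamma = 1/\sqrt{\ln \rho}$, produces, with high probability, a feasible schedule (with duplication) of length at most $O\!\left(\frac{\ln\rho}{\ln\ln\rho}\cdot(\mathsf{OPT}+\rho)\right)$ and runs in time $O\!\left(n\ln M + \frac{m\ln^3 n\,\ln\rho}{\ln\ln\rho}\right)$, with high probability, where $\mathsf{OPT}$ is the minimum makespan.
   Context: Problem: each vertex of the DAG $G=(V,E)$ is a unit-time job; an edge $(u,v)$ means $v$ depends on $u$. There are $M$ identical machines, time is slotted, and duplication is allowed (a job may be run on several machines). A schedule is a set of triples (machine, job, start time), each machine running at most one job per time slot, every job run at least once, such that a copy of $v$ may start on machine $\mu$ at time $t$ only if for every predecessor $u$ of $v$ some copy of $u$ completed on $\mu$ by time $t$ or on some other machine by time $t-\rho$. The makespan is the completion time of the last job; $\mathsf{OPT}$ is the minimum makespan. "With high probability" means with probability at least $1-n^{-c}$ for any desired constant $c\ge1$ (constants in the algorithm chosen accordingly). Notation: for a subgraph $H$ and vertex $v$, $A_H(v)$ is the set of vertices of $H$ having a directed path to $v$ in $H$, together with $v$; $A_H(S)=\bigcup_{v\in S}A_H(v)$; $E_H(v)$, $E_H(S)$ are the edge sets of the subgraphs of $H$ induced by $A_H(v)$, $A_H(S)$. Estimates $\hat a_H(v)$, $\hat e_H(v)$ are mergeable count-distinct (Bar-Yossef et al.) sketch estimates of $|A_H(v)|$,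 $|E_H(v)|$ with relative error $1/3$, computed for all vertices by propagating sketches in topological order. FindBatch$(H,\gamma)$: compute $\hat e_H(v)$ for all $v$; put $v$ in bucket $K_i=\{v: 2^i\le \hat e_H(v)<2^{i+1}\}$ (vertices with no ancestor edges go in the smallest bucket), $i=1,\dots,k$, $k=O(\log\rho)$; $B\leftarrow\emptyset$. While some bucket is nonempty: for $i=k$ down to $1$: set $s=0$; while $s<N=\Theta(\log n)$ and $K_i\ne\emptyset$: sample $v$ uniformly from $K_i$ and remove it from $K_i$; compute exactly (by DFS) $A_H(v)$, $E_H(v)$; if $|A_H(v)\setminus A_H(B)|>\gamma|A_H(v)|$ and $|E_H(v)\setminus E_H(B)|>\gamma|E_H(v)|$ then add $v$ to $B$ (``fresh'') and set $s=0$, else (``stale'') set $s\leftarrow s+1$. Then Prune: with $H'=H\setminus A_H(B)$, compute estimates in $H$ and in $H'$ and remove from its bucket every remaining $v$ with $\hat a_{H'}(v)/\hat a_H(v)\le 2\gamma$ or $\hat e_{H'}(v)/\hat e_H(v)\le 2\gamma$. Return $B$. ScheduleSmallSubgraph$(H,\gamma)$: while $H$ nonempty: $B\leftarrow$FindBatch$(H,\gamma)$; for each $v\in B$ treat $A_H(v)$ (duplicated across different $v$) as a single job of length $|A_H(v)|$ executed in topological order on one machine, assigning these jobs greedily (Graham list scheduling) to the currently least loaded machine, after the current end of the schedule; then insert an idle delay of $\rho$ time units on all machines; remove $A_H(B)$ and incident edges from $H$. ScheduleGeneralGraph$(G)$: while $G$ nonempty: build $V_H$ by processing vertices from the sources of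 the current $G$ via a queue: a dequeued $v$ is added to $V_H$ (marked) if its estimate $\hat a_G(v)\le \frac43\rho$, and then each successor all of whose predecessors are marked is enqueued; let $H$ be the subgraph induced by $V_H$, append it to a list and delete $V_H$ from $G$. Finally call ScheduleSmallSubgraph on each $H$ in the order produced, concatenating the schedules.
   Formalization: Proved for ρ at least an absolute constant (at ρ=2, γ>1 and ln ln ρ<0); m in the running time is read as max(n,m), as the bound is 0 for m=0, M=1; the edge tests of "fresh" and Prune are skipped for vertices without ancestor edges, which would otherwise never be scheduled. *)

theory Defs
  imports "HOL-Probability.Probability"
begin

section \<open>Schedules with duplication\<close>

text \<open>
  A graph is given by a vertex set \<open>V\<close> and an edge set \<open>E \<subseteq> V \<times> V\<close>. Machines are \<open>0, \<dots>, M - 1\<close>.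
  A triple \<open>(\<mu>, v, t)\<close> is a copy of job \<open>v\<close> occupying the time slot \<open>[t, t + 1)\<close> of machine \<open>\<mu>\<close>.
\<close>

type_synonym 'a schedule = "(nat \<times> 'a \<times> nat) set"

definition feasible ::
  "'a set \<Rightarrow> ('a \<times> 'a) set \<Rightarrow> nat \<Rightarrow> nat \<Rightarrow> 'a schedule \<Rightarrow> bool" where
  "feasible V E M \<rho> S \<longleftrightarrow>
     finite S \<and>
     (\<forall>(\<mu>, v, t) \<in> S. \<mu> < M \<and> v \<in> V) \<and>
     (\<forall>\<mu> v w t. (\<mu>, v, t) \<in> S \<longrightarrow> (\<mu>, w, t) \<in> S \<longrightarrow> v = w) \<and>
     (\<forall>v \<in> V. \<exists>\<mu> t. (\<mu>, v, t) \<in> S) \<and>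
     (\<forall>(\<mu>, v, t) \<in> S. \<forall>u. (u, v) \<in> E \<longrightarrow>
        (\<exists>t'. (\<mu>, u, t') \<in> S \<and> t' + 1 \<le> t) \<or>
        (\<exists>\<mu>' t'. \<mu>' \<noteq> \<mu> \<and> (\<mu>', u, t') \<in> S \<and> t' + 1 + \<rho> \<le> t))"

definition makespan :: "'a schedule \<Rightarrow> nat" where
  "makespan S = (if S = {} then 0 else Max ((\<lambda>(\<mu>, v, t). t + 1) ` S))"

definition OPT :: "'a set \<Rightarrow> ('a \<times> 'a) set \<Rightarrow> nat \<Rightarrow> nat \<Rightarrow> nat" where
  "OPT V E M \<rho> = (LEAST T. \<exists>S. feasible V E M \<rho> S \<and> makespan S = T)"


section \<open>Graph operations\<close>

definition induced :: "('a \<times> 'a) set \<Rightarrow> 'a set \<Rightarrow> ('a \<times> 'a) set" where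
  "induced E S = E \<inter> S \<times> S"

definition preds :: "('a \<times> 'a) set \<Rightarrow> 'a \<Rightarrow> 'a set" where
  "preds E v = {u. (u, v) \<in> E}"

definition succs :: "('a \<times> 'a) set \<Rightarrow> 'a \<Rightarrow> 'a set" where
  "succs E v = {w. (v, w) \<in> E}"

definition anc :: "('a \<times> 'a) set \<Rightarrow> 'a \<Rightarrow> 'a set" where
  "anc E v = {u. (u, v) \<in> E\<^sup>*}"

definition ancs :: "('a \<times> 'a) set \<Rightarrow> 'a set \<Rightarrow> 'a set" where
  "ancs E S = (\<Union>v\<in>S. anc E v)"

definition anc_edges :: "('a \<times> 'a) set \<Rightarrow> 'a \<Rightarrow> ('a \<times> 'a) set" where
  "anc_edges E v = induced E (anc E v)"

definition ancs_edges :: "('a \<times> 'a) set \<Rightarrow> 'a set \<Rightarrow> ('a \<times> 'a) set" where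
  "ancs_edges E S = induced E (ancs E S)"

text \<open>Some fixed enumeration, and some fixed topological order; which one is irrelevant.\<close>

definition list_of :: "'a set \<Rightarrow> 'a list" where
  "list_of S = (SOME xs. distinct xs \<and> set xs = S)"

definition topo_order :: "'a set \<Rightarrow> ('a \<times> 'a) set \<Rightarrow> 'a list" where
  "topo_order V E = (SOME xs. distinct xs \<and> set xs = V \<and>
     (\<forall>i < length xs. \<forall>j < length xs. (xs ! i, xs ! j) \<in> E \<longrightarrow> i < j))"


section \<open>Randomised programs with running time\<close>

text \<open>
  Programs are sub-probability distributions; missing mass is the probability of not terminating.
  Every program returns, or threads through its loop state, the number \<open>\<tau>\<close> of steps made on a
  unit-cost RAM with words of \<open>O(log)\<close> of the input size, up to constant factors. Loop control and
  constant-time operations cost one step per iteration. The costs of the textbook subroutines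
  (depth-first search, topological sorting, merging of ordered lists, building of induced
  subgraphs, binary heaps) are charged explicitly where they are called.
\<close>

partial_function (spmf) while_spmf ::
  "('s \<Rightarrow> bool) \<Rightarrow> ('s \<Rightarrow> 's spmf) \<Rightarrow> 's \<Rightarrow> 's spmf" where
  "while_spmf guard body s =
     (if guard s then bind_spmf (body s) (while_spmf guard body) else return_spmf s)"


section \<open>Mergeable count-distinct sketches\<close>

text \<open>
  First algorithm of Bar-Yossef, Jayram, Kumar, Sivakumar and Trevisan (2002): hash the elements of
  a universe of size \<open>s\<close> to \<open>{1..s\<^sup>3}\<close> and keep the \<open>\<lceil>96/\<epsilon>\<^sup>2\<rceil>\<close> smallest distinct hash values, here
  with \<open>\<epsilon> = 1/3\<close>. If \<open>x\<close> is the largest one kept, then \<open>864 \<cdot> s\<^sup>3 / x\<close> estimates the number of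
  distinct elements; a sketch that is not full is counted exactly. The error probability is
  reduced by taking the median of \<open>L\<close> independent copies. The sketch of a union is obtained by
  merging and truncating the sketches. The hash functions are tables of independent uniform
  values, in particular pairwise independent.
\<close>

definition sketch_size :: nat where
  "sketch_size = 864"

definition truncate :: "nat set \<Rightarrow> nat set" where
  "truncate X = {x \<in> X. card {y \<in> X. y < x} < sketch_size}"

definition sketch_value :: "nat \<Rightarrow> nat set \<Rightarrow> real" where
  "sketch_value R X =
     (if card X < sketch_size then real (card X) else real sketch_size * real R / real (Max X))"

definition median :: "real list \<Rightarrow> real" where
  "median xs = sort xs ! (length xs div 2)"

definition hash_range :: "nat \<Rightarrow> nat" where
  "hash_range s = s ^ 3"

definition hash_table :: "'b set \<Rightarrow> ('b \<Rightarrow> nat) pmf" where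
  "hash_table U = Pi_pmf U 0 (\<lambda>_. pmf_of_set {1..hash_range (card U)})"

text \<open>One copy of the sketches of all \<open>A\<^sub>H(v)\<close>, respectively all \<open>E\<^sub>H(v)\<close>, for \<open>H = (V, E)\<close>.\<close>

definition vertex_sketches ::
  "('a \<Rightarrow> nat) \<Rightarrow> 'a set \<Rightarrow> ('a \<times> 'a) set \<Rightarrow> 'a \<Rightarrow> nat set" where
  "vertex_sketches h V E =
     fold (\<lambda>v \<sigma>. \<sigma>(v := truncate (insert (h v) (\<Union>u\<in>preds E v. \<sigma> u))))
       (topo_order V E) (\<lambda>_. {})"

definition edge_sketches ::
  "('a \<times> 'a \<Rightarrow> nat) \<Rightarrow> 'a set \<Rightarrow> ('a \<times> 'a) set \<Rightarrow> 'a \<Rightarrow> nat set" where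
  "edge_sketches g V E =
     fold (\<lambda>v \<sigma>. \<sigma>(v := truncate (\<Union>u\<in>preds E v. insert (g (u, v)) (\<sigma> u))))
       (topo_order V E) (\<lambda>_. {})"

text \<open>The functions \<open>\<hat>a\<^sub>H\<close> and \<open>\<hat>e\<^sub>H\<close>; both are \<open>0\<close> outside \<open>V\<close>.\<close>

definition estimates ::
  "nat \<Rightarrow> 'a set \<Rightarrow> ('a \<times> 'a) set \<Rightarrow> (('a \<Rightarrow> real) \<times> ('a \<Rightarrow> real)) spmf" where
  "estimates L V E = spmf_of_pmf (do {
     hs \<leftarrow> replicate_pmf L (hash_table V);
     gs \<leftarrow> replicate_pmf L (hash_table E);
     return_pmf
       (\<lambda>v. median (map (\<lambda>h. sketch_value (hash_range (card V)) (vertex_sketches h V E v)) hs),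
        \<lambda>v. median (map (\<lambda>g. sketch_value (hash_range (card E)) (edge_sketches g V E v)) gs))
   })"

text \<open>
  Time for the sketches of a part of a graph with \<open>s\<close> vertices and edges in total.
  Per copy, every vertex and every edge causes at most one insertion and two merges, each of at most
  \<open>sketch_size\<close> steps, besides drawing hash values, traversing the graph and reading off
  estimates (with linear-time selection of the medians).
\<close>

definition sketch_time :: "nat \<Rightarrow> nat \<Rightarrow> nat" where
  "sketch_time L s = 4 * sketch_size * L * s"


section \<open>FindBatch\<close>

text \<open>The smallest bucket has index 1 and also takes the estimates below \<open>2\<close>.\<close>

definition bucket :: "real \<Rightarrow> nat" where
  "bucket x = (if x < 2 then 1 else nat \<lfloor>log 2 x\<rfloor>)"

text \<open>
  The condition on edges is vacuous for a vertex without ancestor edges; the strict inequality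
  could not hold for it and the vertex would never be scheduled.
\<close>

definition fresh :: "real \<Rightarrow> ('a \<times> 'a) set \<Rightarrow> 'a set \<Rightarrow> 'a \<Rightarrow> bool" where
  "fresh \<gamma> E B v \<longleftrightarrow>
     real (card (anc E v - ancs E B)) > \<gamma> * real (card (anc E v)) \<and>
     (anc_edges E v \<noteq> {} \<longrightarrow>
        real (card (anc_edges E v - ancs_edges E B)) > \<gamma> * real (card (anc_edges E v)))"

text \<open>
  State of FindBatch: the batch (in order of insertion), the buckets, the elapsed time.
\<close>

type_synonym 'a batch_state = "'a list \<times> (nat \<Rightarrow> 'a set) \<times> nat"

definition drain_bucket ::
  "nat \<Rightarrow> real \<Rightarrow> ('a \<times> 'a) set \<Rightarrow> nat \<Rightarrow> 'a batch_state \<Rightarrow> 'a batch_state spmf" where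
  "drain_bucket N \<gamma> E i st = (case st of (B, K, \<tau>) \<Rightarrow>
     map_spmf snd (while_spmf
       (\<lambda>(s, B, K, \<tau>). s < N \<and> K i \<noteq> {})
       (\<lambda>(s, B, K, \<tau>). do {
          v \<leftarrow> spmf_of_set (K i);
          let K' = K(i := K i - {v});
          let \<tau>' = \<tau> + 1 + card (anc E v) + card (anc_edges E v);
          return_spmf
            (if fresh \<gamma> E (set B) v then (0, B @ [v], K', \<tau>') else (s + 1, B, K', \<tau>'))
        })
       (0::nat, B, K, \<tau> + 1)))"

primrec sweep_buckets ::
  "nat \<Rightarrow> real \<Rightarrow> ('a \<times> 'a) set \<Rightarrow> nat \<Rightarrow> 'a batch_state \<Rightarrow> 'a batch_state spmf" where
  "sweep_buckets N \<gamma> E 0 st = return_spmf st"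
| "sweep_buckets N \<gamma> E (Suc i) st =
     bind_spmf (drain_bucket N \<gamma> E (Suc i) st) (sweep_buckets N \<gamma> E i)"

text \<open>
  \<open>e v = 0\<close> holds exactly if \<open>v\<close> has no ancestor edges; the condition on edges is vacuous then, as
  in \<open>fresh\<close>. A vertex outside \<open>H'\<close> has \<open>a' v = 0\<close> and is removed.
\<close>

definition prune ::
  "nat \<Rightarrow> real \<Rightarrow> 'a set \<Rightarrow> ('a \<times> 'a) set \<Rightarrow> 'a batch_state \<Rightarrow> 'a batch_state spmf" where
  "prune L \<gamma> V E st = (case st of (B, K, \<tau>) \<Rightarrow> do {
     let V' = V - ancs E (set B);
     let E' = induced E V';
     (a, e) \<leftarrow> estimates L V E;
     (a', e') \<leftarrow> estimates L V' E';
     return_spmf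
       (B,
        \<lambda>i. {v \<in> K i. \<not> (a' v / a v \<le> 2 * \<gamma> \<or> e v \<noteq> 0 \<and> e' v / e v \<le> 2 * \<gamma>)},
        \<tau> + sketch_time L (card V + card E) + sketch_time L (card V' + card E')
          + card V + card E)
   })"

definition find_batch ::
  "nat \<Rightarrow> nat \<Rightarrow> real \<Rightarrow> 'a set \<Rightarrow> ('a \<times> 'a) set \<Rightarrow> ('a list \<times> nat) spmf" where
  "find_batch N L \<gamma> V E = do {
     (a, e) \<leftarrow> estimates L V E;
     let k = Max ((\<lambda>v. bucket (e v)) ` V);
     (B, K, \<tau>) \<leftarrow> while_spmf
       (\<lambda>(B, K, \<tau>). \<exists>i \<in> {1..k}. K i \<noteq> {})
       (\<lambda>st. bind_spmf (sweep_buckets N \<gamma> E k st) (prune L \<gamma> V E))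
       ([], \<lambda>i. {v \<in> V. bucket (e v) = i}, sketch_time L (card V + card E) + card V);
     return_spmf (B, \<tau>)
   }"


section \<open>ScheduleSmallSubgraph\<close>

text \<open>
  Graham list scheduling of a batch from time \<open>T\<close> on. \<open>load \<mu>\<close> is the total length of the jobs of this
  batch assigned to \<open>\<mu>\<close> so far. The machines with their loads are kept in a binary heap. The
  result is the new schedule, the completion time of the batch, and the running time.
\<close>

definition place_job ::
  "nat \<Rightarrow> nat \<Rightarrow> ('a \<times> 'a) set \<Rightarrow> 'a \<Rightarrow>
     (nat \<Rightarrow> nat) \<times> 'a schedule \<times> nat \<Rightarrow> (nat \<Rightarrow> nat) \<times> 'a schedule \<times> nat" where
  "place_job M T E v st = (case st of (load, S, \<tau>) \<Rightarrow>
     let \<mu> = arg_min_on load {..<M};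
         xs = topo_order (anc E v) (anc_edges E v)
     in (load(\<mu> := load \<mu> + length xs),
         S \<union> {(\<mu>, xs ! j, T + load \<mu> + j) | j. j < length xs},
         \<tau> + 1 + nat \<lceil>log 2 (real M)\<rceil> + card (anc E v) + card (anc_edges E v)))"

definition place_batch ::
  "nat \<Rightarrow> nat \<Rightarrow> ('a \<times> 'a) set \<Rightarrow> 'a list \<Rightarrow> 'a schedule \<Rightarrow> 'a schedule \<times> nat \<times> nat" where
  "place_batch M T E B S =
     (case fold (place_job M T E) B (\<lambda>_. 0, S, 0) of (load, S', \<tau>) \<Rightarrow>
        (S', T + Max (load ` {..<M}), \<tau>))"

text \<open>
  \<open>T\<close> is the time from which on all machines are available; the delay \<open>\<rho>\<close> after every batch, also after
  the last one, is included.
\<close>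

definition schedule_small_subgraph ::
  "nat \<Rightarrow> nat \<Rightarrow> real \<Rightarrow> nat \<Rightarrow> nat \<Rightarrow> 'a set \<times> ('a \<times> 'a) set \<Rightarrow>
     nat \<times> 'a schedule \<times> nat \<Rightarrow> (nat \<times> 'a schedule \<times> nat) spmf" where
  "schedule_small_subgraph N L \<gamma> M \<rho> H st =
     map_spmf snd (while_spmf
       (\<lambda>((V, E), T, S, \<tau>). V \<noteq> {})
       (\<lambda>((V, E), T, S, \<tau>). do {
          (B, \<tau>\<^sub>B) \<leftarrow> find_batch N L \<gamma> V E;
          let (S', T', \<tau>\<^sub>P) = place_batch M T E B S;
          let V' = V - ancs E (set B);
          return_spmf
            ((V', induced E V'), T' + \<rho>, S', \<tau> + \<tau>\<^sub>B + \<tau>\<^sub>P + 1 + card V + card E)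
        })
       (H, st))"


section \<open>ScheduleGeneralGraph\<close>

text \<open>
  Construction of \<open>V\<^sub>H\<close>. State: queue, marked vertices, the \<open>L\<close> sketches of \<open>A\<^sub>G(v)\<close> of every dequeued
  \<open>v\<close>, elapsed time. A vertex is enqueued only once all its predecessors are marked, so
  its sketches are obtained from theirs. The hash values of a vertex are drawn when it is dequeued.
\<close>

definition grow_small_subgraph ::
  "nat \<Rightarrow> nat \<Rightarrow> 'a set \<Rightarrow> ('a \<times> 'a) set \<Rightarrow> ('a set \<times> nat) spmf" where
  "grow_small_subgraph L \<rho> V E = do {
     let R = hash_range (card V);
     (Q, X, \<sigma>, \<tau>) \<leftarrow> while_spmf
       (\<lambda>(Q, X, \<sigma>, \<tau>). Q \<noteq> [])
       (\<lambda>(Q, X, \<sigma>, \<tau>). do {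
          let v = hd Q;
          hs \<leftarrow> spmf_of_pmf (replicate_pmf L (pmf_of_set {1..R}));
          let ss = map (\<lambda>j. truncate (insert (hs ! j) (\<Union>u\<in>preds E v. \<sigma> u ! j))) [0..<L];
          let \<tau>' = \<tau> + 1 + sketch_time L (1 + card (preds E v));
          return_spmf
            (if median (map (sketch_value R) ss) \<le> 4 / 3 * real \<rho>
             then (tl Q @ list_of {w \<in> succs E v. preds E w \<subseteq> insert v X},
                   insert v X, \<sigma>(v := ss), \<tau>' + card (succs E v))
             else (tl Q, X, \<sigma>(v := ss), \<tau>'))
        })
       (list_of {v \<in> V. preds E v = {}}, {}, (\<lambda>_. []), 0);
     return_spmf (X, \<tau>)
   }"

text \<open>
  Deleting \<open>V\<^sub>H\<close> and building \<open>H\<close> takes time proportional to \<open>V\<^sub>H\<close> and its incident edges. In-degrees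
  and the list of sources of the current graph are computed once and updated by the deletions.
\<close>

definition partition_graph ::
  "nat \<Rightarrow> nat \<Rightarrow> 'a set \<Rightarrow> ('a \<times> 'a) set \<Rightarrow> (('a set \<times> ('a \<times> 'a) set) list \<times> nat) spmf" where
  "partition_graph L \<rho> V E = map_spmf snd (while_spmf
     (\<lambda>((V, E), Hs, \<tau>). V \<noteq> {})
     (\<lambda>((V, E), Hs, \<tau>). do {
        (X, \<tau>\<^sub>X) \<leftarrow> grow_small_subgraph L \<rho> V E;
        return_spmf
          ((V - X, induced E (V - X)), Hs @ [(X, induced E X)],
           \<tau> + \<tau>\<^sub>X + 1 + card X + card {(u, v) \<in> E. u \<in> X \<or> v \<in> X})
      })
     ((V, E), [], card V + card E))"

primrec schedule_all ::
  "nat \<Rightarrow> nat \<Rightarrow> real \<Rightarrow> nat \<Rightarrow> nat \<Rightarrow> ('a set \<times> ('a \<times> 'a) set) list \<Rightarrow>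
     nat \<times> 'a schedule \<times> nat \<Rightarrow> (nat \<times> 'a schedule \<times> nat) spmf" where
  "schedule_all N L \<gamma> M \<rho> [] st = return_spmf st"
| "schedule_all N L \<gamma> M \<rho> (H # Hs) st =
     bind_spmf (schedule_small_subgraph N L \<gamma> M \<rho> H st) (schedule_all N L \<gamma> M \<rho> Hs)"

definition schedule_general_graph ::
  "nat \<Rightarrow> nat \<Rightarrow> real \<Rightarrow> nat \<Rightarrow> nat \<Rightarrow> 'a set \<Rightarrow> ('a \<times> 'a) set \<Rightarrow> ('a schedule \<times> nat) spmf" where
  "schedule_general_graph N L \<gamma> M \<rho> V E = do {
     (Hs, \<tau>\<^sub>H) \<leftarrow> partition_graph L \<rho> V E;
     (T, S, \<tau>) \<leftarrow> schedule_all N L \<gamma> M \<rho> Hs (0, {}, \<tau>\<^sub>H);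
     return_spmf (S, \<tau>)
   }"

text \<open>
  \<open>N\<close> (number of consecutive stale samples) and \<open>L\<close> (number of sketch copies) are \<open>\<Theta>(ln n)\<close>; this
  gives them for the constant factor \<open>\<kappa>\<close>.
\<close>

definition log_many :: "real \<Rightarrow> nat \<Rightarrow> nat" where
  "log_many \<kappa> n = max 1 (nat \<lceil>\<kappa> * ln (real n)\<rceil>)"

text \<open>
  Conventions for the asymptotic bounds. With \<open>\<gamma> = 1 / sqrt (ln \<rho>)\<close> they are meant for sufficiently large
  \<open>\<rho>\<close>: for \<open>\<rho> = 2\<close> we have \<open>\<gamma> > 1\<close>, no vertex is ever fresh, and \<open>ln (ln \<rho>) < 0\<close>; pruning is sound only if
  \<open>4 * \<gamma> < 1\<close>. There is no such restriction on the other parameters. In the running time, \<open>m\<close> is read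
  as \<open>max n m\<close>, since the bound would be \<open>0\<close> for an edgeless graph on a single machine.
\<close>

end

theory Submission
  imports Defs
begin

text \<open>
  A job started less than \<open>\<rho>\<close> after the earliest start of all jobs of the current graph cannot use
  results of other machines, so its whole cone of ancestors runs on its own machine. Hence a job
  with more than \<open>\<rho>\<close> ancestors is delayed by \<open>\<rho>\<close>, and the number of small subgraphs is at most
  \<open>OPT / \<rho> + 1\<close>. In a small subgraph all cones have at most \<open>2 \<rho>\<close> vertices. When FindBatch stops, every
  remaining vertex has lost all but a fraction \<open>4 \<gamma>\<close> of its ancestors or of its ancestor edges, so
  that \<open>O(ln \<rho> / ln (1 / \<gamma>)) = O(ln \<rho> / ln (ln \<rho>))\<close> batches suffice, each costing a delay of \<open>\<rho>\<close> and at most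
  \<open>2 \<rho>\<close> of load imbalance. Each job of a batch brings in a fraction \<open>\<gamma>\<close> of new vertices and edges, so
  duplication increases work and running time only by the factor
  \<open>1 / \<gamma> = sqrt (ln \<rho>) = O(ln \<rho> / ln (ln \<rho>))\<close>.

  \<open>N\<close> consecutive stale samples are unlikely while half of a bucket is fresh, and pruning removes the
  stale vertices; so the buckets are halved by each sweep, and \<open>O(ln n)\<close> sweeps suffice. All accuracy
  requirements concern polynomially many estimates, each failing with probability at most
  \<open>(11/16) ^ L\<close>, hence a union bound.
\<close>

section \<open>Events of high probability\<close>

text \<open>No termination proof occurs: \<open>whp\<close> bounds the success mass from below, so
  mass missing from a program counts as failure. Relative error 1/3 puts a ratio of two estimates
  within a factor (4/3) / (2/3) = 2 of the true ratio. Pruning at \<open>2 * \<gamma>\<close> thus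
  removes every ratio at most \<gamma> and only ratios at most \<open>4 * \<gamma>\<close>; this is
  the origin of the 4 in the shrinking factor. What complicates counting the batches is that a
  vertex may lose ancestors in one batch and ancestor edges in the next, so neither quantity alone
  decreases geometrically. Both are tracked by exponents whose sum is the number of batches, and the
  sizes of the cones bound the two powers of \<open>1 / (4 * \<gamma>)\<close> separately. The
  partition into small subgraphs poses another problem: hash values are drawn one vertex at a time,
  and the estimates decide which vertices come next, so that the set of estimates needed is itself
  random. A union bound applies only after the loop has been compared with a complete table of hash
  values. In the other phases new hash functions are drawn for a graph that is already
  fixed.\<close>

definition whp :: "real \<Rightarrow> 'a spmf \<Rightarrow> ('a \<Rightarrow> bool) \<Rightarrow> bool" where
  "whp \<delta> p Q \<longleftrightarrow> measure (measure_spmf p) {x. Q x} \<ge> 1 - \<delta>"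

lemma whp_return: "Q x \<Longrightarrow> \<delta> \<ge> 0 \<Longrightarrow> whp \<delta> (return_spmf x) Q"
  by (simp add: whp_def measure_spmf_return_spmf measure_return)

lemma whp_ge_1: "\<delta> \<ge> 1 \<Longrightarrow> whp \<delta> p Q"
  by (simp add: whp_def order_trans[OF _ measure_nonneg])

lemma whp_mono:
  assumes "whp \<delta> p Q" "\<delta> \<le> \<delta>'" "\<And>x. x \<in> set_spmf p \<Longrightarrow> Q x \<Longrightarrow> Q' x"
  shows "whp \<delta>' p Q'"
proof -
  have "measure (measure_spmf p) {x. Q x} \<le> measure (measure_spmf p) {x. Q' x}"
    by (rule finite_measure.finite_measure_mono_AE) (use assms(3) in auto)
  then show ?thesis using assms(1,2) by (simp add: whp_def)
qed

lemma measure_bind_spmf: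
  "measure (measure_spmf (p \<bind> f)) A = (\<integral>x. measure (measure_spmf (f x)) A \<partial>measure_spmf p)"
proof -
  have "emeasure (measure_spmf (p \<bind> f)) A = (\<integral>\<^sup>+x. emeasure (measure_spmf (f x)) A \<partial>measure_spmf p)"
    unfolding measure_spmf_bind
    by (subst emeasure_bind[where N="count_space UNIV"])
      (auto simp: space_measure_spmf intro!: nn_integral_cong)
  also have "\<dots> = (\<integral>\<^sup>+x. ennreal (measure (measure_spmf (f x)) A) \<partial>measure_spmf p)"
    by (intro nn_integral_cong) (simp add: measure_spmf.emeasure_eq_measure)
  also have "\<dots> = ennreal (\<integral>x. measure (measure_spmf (f x)) A \<partial>measure_spmf p)"
    by (intro nn_integral_eq_integral measure_spmf.integrable_const_bound[where B=1])
      (auto intro: measure_spmf.subprob_measure_le_1)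
  finally show ?thesis
    by (simp add: measure_def integral_nonneg_AE)
qed

lemma integrable_measure_spmf_le_1:
  "integrable (measure_spmf p) (\<lambda>x. measure (measure_spmf (f x)) A)"
proof -
  show ?thesis
    by (intro measure_spmf.integrable_const_bound[where B=1]) (auto intro: measure_spmf.subprob_measure_le_1)
qed

text \<open>Union bound for sequential composition. The second premise may assume
  \<open>Q x\<close>, which is how an invariant that holds with high probability is handed on to the
  rest of a program.\<close>

lemma whp_bind:
  assumes "whp \<delta>1 p Q" "\<And>x. x \<in> set_spmf p \<Longrightarrow> Q x \<Longrightarrow> whp \<delta>2 (f x) R" "\<delta>2 \<ge> 0"
  shows "whp (\<delta>1 + \<delta>2) (p \<bind> f) R"
proof (cases "\<delta>2 \<le> 1")
  case True
  let ?Q = "{x. Q x}"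
  have "1 - (\<delta>1 + \<delta>2) \<le> measure (measure_spmf p) ?Q * (1 - \<delta>2)"
  proof -
    have "measure (measure_spmf p) ?Q * \<delta>2 \<le> 1 * \<delta>2"
      using assms(3) by (intro mult_right_mono measure_spmf.subprob_measure_le_1)
    then show ?thesis using assms(1) by (simp add: whp_def algebra_simps)
  qed
  also have "\<dots> = (\<integral>x. indicator ?Q x * (1 - \<delta>2) \<partial>measure_spmf p)" by simp
  also have "\<dots> \<le> (\<integral>x. measure (measure_spmf (f x)) {x. R x} \<partial>measure_spmf p)"
  proof (rule integral_mono_AE)
    show "integrable (measure_spmf p) (\<lambda>x. indicator ?Q x * (1 - \<delta>2))"
      by (intro integrable_mult_left integrable_real_indicator) (simp_all add: measure_spmf.emeasure_eq_measure)
    show "AE x in measure_spmf p. indicator ?Q x * (1 - \<delta>2) \<le> measure (measure_spmf (f x)) {x. R x}"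
      using assms(2) by (auto simp: whp_def indicator_def)
  qed (rule integrable_measure_spmf_le_1)
  finally show ?thesis by (simp add: whp_def measure_bind_spmf)
next
  case False
  show ?thesis
  proof (cases "\<delta>1 \<ge> 0")
    case True
    then show ?thesis using False by (intro whp_ge_1) simp
  next
    case F: False
    have "measure (measure_spmf p) {x. Q x} \<le> 1" by (simp add: measure_spmf.subprob_measure_le_1)
    then show ?thesis using F assms(1) by (simp add: whp_def)
  qed
qed

lemma whp_map: "whp \<delta> p (\<lambda>x. Q (f x)) \<Longrightarrow> whp \<delta> (map_spmf f p) Q"
  by (simp add: whp_def measure_map_spmf vimage_def)

lemma whp_spmf_of_pmf:
  "whp \<delta> (spmf_of_pmf p) Q \<longleftrightarrow> measure_pmf.prob p {x. \<not> Q x} \<le> \<delta>"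
proof -
  have "measure_pmf.prob p {x. \<not> Q x} = 1 - measure_pmf.prob p {x. Q x}"
    by (subst measure_pmf.prob_compl[symmetric]) (auto intro: arg_cong[where f="measure_pmf.prob p"])
  then show ?thesis by (auto simp: whp_def)
qed

text \<open>The index of the invariant counts iterations. Since \<open>I j s\<close> together with
  the guard has to imply \<open>j < J\<close>, every good run stops after at most \<open>J\<close>
  iterations, and the failure probabilities of at most \<open>J\<close> bodies add up.\<close>

lemma whp_while_count:
  assumes "I 0 s"
    and "\<And>j s. I j s \<Longrightarrow> guard s \<Longrightarrow> j < J \<and> whp \<delta> (body s) (I (Suc j))"
    and "\<delta> \<ge> 0"
  shows "whp (real J * \<delta>) (while_spmf guard body s) (\<lambda>s'. \<exists>j \<le> J. I j s' \<and> \<not> guard s')"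
proof -
  have "whp (real (J - j) * \<delta>) (while_spmf guard body s) (\<lambda>s'. \<exists>j \<le> J. I j s' \<and> \<not> guard s')"
    if "I j s" "j \<le> J" for j s
    using that
  proof (induction "J - j" arbitrary: j s rule: less_induct)
    case less
    show ?case
    proof (cases "guard s")
      case False
      then show ?thesis
        using less.prems assms(3) by (subst while_spmf.simps) (auto intro!: whp_return)
    next
      case True
      with assms(2)[OF less.prems(1)] have j: "j < J" and b: "whp \<delta> (body s) (I (Suc j))" by auto
      have eq: "real (J - j) * \<delta> = \<delta> + real (J - Suc j) * \<delta>"
        using j by (simp add: Suc_diff_Suc algebra_simps of_nat_diff)
      show ?thesis
        unfolding eq using True j assms(3)
        by (subst while_spmf.simps, simp only: if_True, intro whp_bind[OF b] less.hyps) auto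
    qed
  qed
  from this[OF assms(1)] show ?thesis by simp
qed

text \<open>Averaging over a uniform sample whose continuation fails with probability \<alpha> on a
  favourable part \<open>F\<close> and \<beta> elsewhere; the last premise is the average,
  multiplied by \<open>card S\<close>. It serves to balance fresh against stale samples.\<close>

lemma whp_sample:
  fixes \<delta> \<alpha> \<beta> :: real
  assumes S: "finite S" "S \<noteq> {}" and F: "F \<subseteq> S"
    and f1: "\<And>x. x \<in> F \<Longrightarrow> whp \<alpha> (f x) R"
    and f2: "\<And>x. x \<in> S - F \<Longrightarrow> whp \<beta> (f x) R"
    and le: "\<alpha> * card F + \<beta> * card (S - F) \<le> \<delta> * card S"
  shows "whp \<delta> (spmf_of_set S \<bind> f) R"
proof -
  have "card S > 0" using S by (simp add: card_gt_0_iff)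
  have fin: "finite F" using F S finite_subset by blast
  have "real (card S) * (1 - \<delta>) \<le> real (card F) * (1 - \<alpha>) + real (card (S - F)) * (1 - \<beta>)"
  proof -
    have "real (card (S - F)) = real (card S) - real (card F)"
      using F S fin by (simp add: card_Diff_subset of_nat_diff card_mono)
    then show ?thesis using le by (simp add: algebra_simps)
  qed
  also have "\<dots> \<le> (\<Sum>x\<in>F. measure (measure_spmf (f x)) {x. R x}) + (\<Sum>x\<in>S - F. measure (measure_spmf (f x)) {x. R x})"
    using f1 f2 by (intro add_mono sum_bounded_below) (auto simp: whp_def)
  also have "\<dots> = (\<Sum>x\<in>S. measure (measure_spmf (f x)) {x. R x})"
    using sum.subset_diff[OF F S(1), of "\<lambda>x. measure (measure_spmf (f x)) {x. R x}"] by simp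
  finally show ?thesis
    using \<open>card S > 0\<close> by (simp add: whp_def measure_bind_spmf integral_spmf_of_set field_simps)
qed

section \<open>Sketches of ancestor sets\<close>

text \<open>Relative error 1/3. For \<open>k = 0\<close> it forces \<open>x = 0\<close>, so vertices
  without ancestor edges and vertices outside the graph are recognised exactly.\<close>

definition approx :: "real \<Rightarrow> nat \<Rightarrow> bool" where
  "approx x k \<longleftrightarrow> 2/3 * real k \<le> x \<and> x \<le> 4/3 * real k"

section \<open>Truncated sets of hash values and their unions\<close>

lemma truncate_subset: "truncate X \<subseteq> X"
  by (auto simp: truncate_def)

text \<open>The least dropped element \<open>m\<close> has all smaller elements of \<open>X\<close>
  kept, and it was dropped because there are at least \<open>sketch_size\<close> of them. They also
  lie below any other dropped \<open>x\<close>.\<close>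

lemma below_nontruncated:
  assumes "finite X" "x \<in> X - truncate X"
  shows "card {y \<in> truncate X. y < x} \<ge> sketch_size"
proof -
  define m where "m = (LEAST x. x \<in> X - truncate X)"
  have m: "m \<in> X - truncate X" "m \<le> x"
    using assms(2) unfolding m_def by (rule LeastI, rule Least_le)
  have "y \<in> truncate X" if "y \<in> X" "y < m" for y
    using that not_less_Least[of y "\<lambda>x. x \<in> X - truncate X"] by (auto simp: m_def)
  then have "{y \<in> X. y < m} \<subseteq> {y \<in> truncate X. y < x}" using m by auto
  then have "card {y \<in> X. y < m} \<le> card {y \<in> truncate X. y < x}"
    using assms(1) finite_subset[OF truncate_subset] by (intro card_mono) auto
  moreover have "card {y \<in> X. y < m} \<ge> sketch_size" using m by (auto simp: truncate_def)
  ultimately show ?thesis by simp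
qed

text \<open>Mergeability: an element dropped from \<open>X\<close> has \<open>sketch_size\<close>
  kept elements below it, and these alone exclude it and everything above it from the sketch of the
  union. Dropping early therefore changes nothing.\<close>

lemma truncate_Un:
  assumes "finite X" "finite Y"
  shows "truncate (truncate X \<union> Y) = truncate (X \<union> Y)"
proof (intro set_eqI iffI)
  have fin: "finite (truncate X)" using assms(1) truncate_subset finite_subset by blast
  fix x assume x: "x \<in> truncate (truncate X \<union> Y)"
  show "x \<in> truncate (X \<union> Y)"
  proof (cases "\<exists>y \<in> X - truncate X. y < x")
    case True
    then obtain y where y: "y \<in> X - truncate X" "y < x" by auto
    have "sketch_size \<le> card {z \<in> truncate X. z < y}" by (rule below_nontruncated[OF assms(1) y(1)])
    also have "\<dots> \<le> card {z \<in> truncate X \<union> Y. z < x}"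
      using y(2) fin assms(2) by (intro card_mono) auto
    finally show ?thesis using x by (simp add: truncate_def)
  next
    case False
    then have "{y \<in> X \<union> Y. y < x} = {y \<in> truncate X \<union> Y. y < x}"
      using truncate_subset by blast
    then show ?thesis using x truncate_subset by (auto simp: truncate_def)
  qed
next
  fix x assume x: "x \<in> truncate (X \<union> Y)"
  have fin: "finite (truncate X)" using assms(1) truncate_subset finite_subset by blast
  have "card {y \<in> truncate X \<union> Y. y < x} \<le> card {y \<in> X \<union> Y. y < x}"
    using assms truncate_subset by (intro card_mono) auto
  moreover have "card {y \<in> X. y < x} \<le> card {y \<in> X \<union> Y. y < x}"
    using assms by (intro card_mono) auto
  ultimately show "x \<in> truncate (truncate X \<union> Y)"
    using x by (auto simp: truncate_def)
qed

text \<open>\<open>Y\<close> collects the hash values inserted at the current vertex, which have not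
  passed through any sketch yet.\<close>

lemma truncate_UN:
  assumes "finite P" "\<And>u. u \<in> P \<Longrightarrow> finite (f u)" "finite Y"
  shows "truncate ((\<Union>u\<in>P. truncate (f u)) \<union> Y) = truncate ((\<Union>u\<in>P. f u) \<union> Y)"
  using assms
proof (induction P arbitrary: Y rule: finite_induct)
  case (insert u P)
  have fin: "finite (truncate (f v))" if "v \<in> insert u P" for v
    using insert.prems(1)[OF that] truncate_subset finite_subset by blast
  have "truncate ((\<Union>v\<in>insert u P. truncate (f v)) \<union> Y)
      = truncate (truncate (f u) \<union> ((\<Union>v\<in>P. truncate (f v)) \<union> Y))"
    by (simp add: Un_assoc)
  also have "\<dots> = truncate (f u \<union> ((\<Union>v\<in>P. truncate (f v)) \<union> Y))"
    using insert fin by (intro truncate_Un) auto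
  also have "\<dots> = truncate ((\<Union>v\<in>P. truncate (f v)) \<union> (f u \<union> Y))"
    by (simp add: Un_left_commute)
  also have "\<dots> = truncate ((\<Union>v\<in>P. f v) \<union> (f u \<union> Y))"
    using insert.prems by (intro insert.IH) auto
  finally show ?case by (simp add: Un_left_commute Un_assoc)
qed simp

text \<open>A dropped element would have \<open>sketch_size\<close> kept elements below it. Hence a
  sketch that is not full has lost nothing, and counting it is exact up to collisions.\<close>

lemma truncate_small:
  assumes "finite X" "card (truncate X) < sketch_size"
  shows "truncate X = X"
proof (rule ccontr)
  assume "truncate X \<noteq> X"
  then obtain x where x: "x \<in> X - truncate X" using truncate_subset[of X] by blast
  have "card {y \<in> truncate X. y < x} \<le> card (truncate X)"
    using assms(1) finite_subset[OF truncate_subset] by (intro card_mono) auto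
  then show False using below_nontruncated[OF assms(1) x] assms(2) by simp
qed

text \<open>The maximum of a full sketch is the element of rank \<open>sketch_size\<close> in
  \<open>X\<close>; the two counts express this rank without sorting.\<close>

lemma truncate_Max:
  assumes "finite X" "card (truncate X) \<ge> sketch_size"
  shows "Max (truncate X) \<in> X" "card {y \<in> X. y < Max (truncate X)} < sketch_size"
    "card {y \<in> X. y \<le> Max (truncate X)} \<ge> sketch_size"
proof -
  have fin: "finite (truncate X)" using assms(1) truncate_subset finite_subset by blast
  have "truncate X \<noteq> {}" using assms(2) by (auto simp: sketch_size_def)
  then have M: "Max (truncate X) \<in> truncate X" using fin by (rule Max_in[rotated])
  then show "Max (truncate X) \<in> X" "card {y \<in> X. y < Max (truncate X)} < sketch_size"
    by (auto simp: truncate_def)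
  have "truncate X \<subseteq> {y \<in> X. y \<le> Max (truncate X)}" using fin truncate_subset by auto
  then have "card (truncate X) \<le> card {y \<in> X. y \<le> Max (truncate X)}"
    using assms(1) by (intro card_mono) auto
  then show "card {y \<in> X. y \<le> Max (truncate X)} \<ge> sketch_size" using assms(2) by simp
qed

section \<open>Recursion along a topological order\<close>

lemma topological_order_exists:
  assumes "finite V" "acyclic E" "finite E"
  shows "\<exists>xs. distinct xs \<and> set xs = V \<and>
    (\<forall>i < length xs. \<forall>j < length xs. (xs ! i, xs ! j) \<in> E \<longrightarrow> i < j)"
  using assms(1)
proof (induction "card V" arbitrary: V)
  case 0
  then show ?case by auto
next
  case (Suc n)
  have "wf (E\<inverse>)" using assms by (simp add: finite_acyclic_wf_converse)
  moreover have "V \<noteq> {}" using Suc by auto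
  ultimately obtain v where v: "v \<in> V" "\<And>w. (v, w) \<in> E \<Longrightarrow> w \<notin> V"
    unfolding wf_eq_minimal by (metis converse_iff ex_in_conv)
  have "card (V - {v}) = n" using Suc v by simp
  then obtain xs where xs: "distinct xs" "set xs = V - {v}"
    "\<And>i j. i < length xs \<Longrightarrow> j < length xs \<Longrightarrow> (xs ! i, xs ! j) \<in> E \<Longrightarrow> i < j"
    using Suc(1)[of "V - {v}"] Suc(3) by auto
  have sV: "set (xs @ [v]) = V" using xs(2) v(1) by (simp add: insert_absorb)
  have "i < j" if "i < length (xs @ [v])" "j < length (xs @ [v])" "((xs @ [v]) ! i, (xs @ [v]) ! j) \<in> E" for i j
  proof (cases "i < length xs")
    case True
    show ?thesis
    proof (cases "j < length xs")
      case j: True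
      have "(xs ! i, xs ! j) \<in> E" using that(3) True j by (simp only: nth_append_left)
      then show ?thesis by (rule xs(3)[OF True j])
    qed (use True that in simp)
  next
    case False
    then have e: "(v, (xs @ [v]) ! j) \<in> E" using that by (simp add: nth_append)
    have "(xs @ [v]) ! j \<in> V" using nth_mem[OF that(2)] unfolding sV .
    with v(2)[OF e] show ?thesis by (rule notE)
  qed
  then show ?case using xs(1,2) sV by (intro exI[of _ "xs @ [v]"]) (simp only: distinct_append, simp)
qed

lemma topo_order:
  assumes "finite V" "acyclic E" "finite E"
  shows "distinct (topo_order V E)" "set (topo_order V E) = V"
    "\<And>i j. i < length (topo_order V E) \<Longrightarrow> j < length (topo_order V E) \<Longrightarrow>
       (topo_order V E ! i, topo_order V E ! j) \<in> E \<Longrightarrow> i < j"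
  using someI_ex[OF topological_order_exists[OF assms]] unfolding topo_order_def[symmetric] by blast+

text \<open>\<open>F\<close> is the intended final assignment. If \<open>G\<close> yields the right
  value at a vertex as soon as its predecessors have theirs, then updating in an order that respects
  the edges yields \<open>F\<close> everywhere.\<close>

lemma fold_topological:
  assumes "distinct xs" "\<And>i. i < length xs \<Longrightarrow> preds E (xs ! i) \<subseteq> set (take i xs)"
    and "\<And>v \<sigma>. v \<in> set xs \<Longrightarrow> (\<And>u. u \<in> preds E v \<Longrightarrow> \<sigma> u = F u) \<Longrightarrow> G v \<sigma> = F v"
  shows "fold (\<lambda>v \<sigma>. \<sigma>(v := G v \<sigma>)) xs (\<lambda>_. d) = (\<lambda>w. if w \<in> set xs then F w else d)"
  using assms
proof (induction xs rule: rev_induct)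
  case (snoc v xs)
  have IH: "fold (\<lambda>v \<sigma>. \<sigma>(v := G v \<sigma>)) xs (\<lambda>_. d) = (\<lambda>w. if w \<in> set xs then F w else d)"
  proof (rule snoc.IH)
    show "preds E (xs ! i) \<subseteq> set (take i xs)" if "i < length xs" for i
      using snoc.prems(2)[of i] that by (simp add: nth_append)
  qed (use snoc.prems in auto)
  have "preds E v \<subseteq> set xs" using snoc.prems(2)[of "length xs"] by simp
  then have "G v (\<lambda>w. if w \<in> set xs then F w else d) = F v"
    by (intro snoc.prems(3)) auto
  then show ?case by (simp only: fold_append IH fold_simps comp_apply) auto
qed simp

lemma fold_topo_order:
  assumes "finite V" "acyclic E" "E \<subseteq> V \<times> V"
    and "\<And>v \<sigma>. v \<in> V \<Longrightarrow> (\<And>u. u \<in> preds E v \<Longrightarrow> \<sigma> u = F u) \<Longrightarrow> G v \<sigma> = F v"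
  shows "fold (\<lambda>v \<sigma>. \<sigma>(v := G v \<sigma>)) (topo_order V E) (\<lambda>_. d) = (\<lambda>w. if w \<in> V then F w else d)"
proof -
  have finE: "finite E" using assms(1,3) finite_subset by blast
  note t = topo_order[OF assms(1,2) finE]
  have "preds E (topo_order V E ! i) \<subseteq> set (take i (topo_order V E))" if i: "i < length (topo_order V E)" for i
  proof
    fix u assume u: "u \<in> preds E (topo_order V E ! i)"
    then have "u \<in> V" using assms(3) by (auto simp: preds_def)
    then obtain j where j: "j < length (topo_order V E)" "topo_order V E ! j = u"
      using t(2) by (metis in_set_conv_nth)
    then have "j < i" using t(3)[OF j(1) i] u by (auto simp: preds_def)
    then show "u \<in> set (take i (topo_order V E))" using j i by (auto simp: in_set_conv_nth)
  qed
  from fold_topological[OF t(1) this, of F G d] show ?thesis using assms(4) t(2) by simp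
qed

section \<open>Ancestor sets and the sketches propagated along them\<close>

lemma anc_rec: "anc E v = insert v (\<Union>u\<in>preds E v. anc E u)"
proof (intro set_eqI iffI)
  fix u assume "u \<in> anc E v"
  then have "(u, v) \<in> E\<^sup>*" by (simp add: anc_def)
  then show "u \<in> insert v (\<Union>u\<in>preds E v. anc E u)"
    by (cases rule: rtranclE) (auto simp: anc_def preds_def)
qed (auto simp: anc_def preds_def)

lemma self_in_anc [simp]: "v \<in> anc E v" by (simp add: anc_def)

lemma anc_trans: "u \<in> anc E w \<Longrightarrow> w \<in> anc E v \<Longrightarrow> u \<in> anc E v"
  by (auto simp: anc_def)

lemma anc_subset: "E \<subseteq> V \<times> V \<Longrightarrow> v \<in> V \<Longrightarrow> anc E v \<subseteq> V"
proof
  fix u assume "E \<subseteq> V \<times> V" "v \<in> V" "u \<in> anc E v"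
  then have "(u, v) \<in> E\<^sup>*" by (simp add: anc_def)
  then show "u \<in> V"
    using \<open>E \<subseteq> V \<times> V\<close> \<open>v \<in> V\<close> by (cases rule: converse_rtranclE) auto
qed

lemma finite_anc [simp]:
  assumes "finite E"
  shows "finite (anc E v)"
proof -
  have "anc E v \<subseteq> insert v (fst ` E)"
  proof
    fix u assume "u \<in> anc E v"
    then have "(u, v) \<in> E\<^sup>*" by (simp add: anc_def)
    then show "u \<in> insert v (fst ` E)"
      by (cases rule: converse_rtranclE) (auto intro: rev_image_eqI)
  qed
  then show ?thesis using assms finite_subset by blast
qed

lemma finite_anc_edges [simp]: "finite E \<Longrightarrow> finite (anc_edges E v)"
  by (simp add: anc_edges_def induced_def)

lemma anc_edges_rec:
  assumes "acyclic E"
  shows "anc_edges E v = (\<Union>u\<in>preds E v. insert (u, v) (anc_edges E u))"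
proof (intro set_eqI iffI; clarify)
  fix x y assume xy: "(x, y) \<in> anc_edges E v"
  then have e: "(x, y) \<in> E" "y \<in> anc E v" by (auto simp: anc_edges_def induced_def)
  show "(x, y) \<in> (\<Union>u\<in>preds E v. insert (u, v) (anc_edges E u))"
  proof (cases "y = v")
    case False
    then obtain u where u: "u \<in> preds E v" "y \<in> anc E u" using e(2) anc_rec[of E v] by auto
    have "x \<in> anc E u" using u(2) e(1) by (auto simp: anc_def)
    then show ?thesis using u e by (auto simp: anc_edges_def induced_def)
  qed (use e in \<open>auto simp: preds_def\<close>)
next
  fix x y u assume u: "u \<in> preds E v" and xy: "(x, y) \<in> insert (u, v) (anc_edges E u)"
  have "u \<in> anc E v" using u by (auto simp: preds_def anc_def)
  then show "(x, y) \<in> anc_edges E v"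
    using u xy by (auto simp: anc_edges_def induced_def preds_def intro: anc_trans)
qed

lemma finite_preds [simp]: "finite E \<Longrightarrow> finite (preds E v)"
  by (rule finite_subset[of _ "fst ` E"]) (auto simp: preds_def intro: rev_image_eqI)

lemma truncate_anc:
  assumes "finite E"
  shows "truncate (insert (h v) (\<Union>u\<in>preds E v. truncate (h ` anc E u))) = truncate (h ` anc E v)"
proof -
  have "truncate (insert (h v) (\<Union>u\<in>preds E v. truncate (h ` anc E u)))
      = truncate ((\<Union>u\<in>preds E v. truncate (h ` anc E u)) \<union> {h v})" by simp
  also have "\<dots> = truncate ((\<Union>u\<in>preds E v. h ` anc E u) \<union> {h v})"
    using assms by (intro truncate_UN) auto
  also have "(\<Union>u\<in>preds E v. h ` anc E u) \<union> {h v} = h ` anc E v"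
    using anc_rec[of E v] by auto
  finally show ?thesis .
qed

lemma vertex_sketches_eq:
  assumes "finite V" "acyclic E" "E \<subseteq> V \<times> V"
  shows "vertex_sketches h V E = (\<lambda>v. if v \<in> V then truncate (h ` anc E v) else {})"
  unfolding vertex_sketches_def
proof (rule fold_topo_order[OF assms])
  fix v \<sigma> assume \<sigma>: "\<And>u. u \<in> preds E v \<Longrightarrow> \<sigma> u = truncate (h ` anc E u)"
  have "finite E" using assms(1,3) finite_subset by blast
  then show "truncate (insert (h v) (\<Union>u\<in>preds E v. \<sigma> u)) = truncate (h ` anc E v)"
    using truncate_anc[of E h v] \<sigma> by simp
qed

lemma edge_sketches_eq:
  assumes "finite V" "acyclic E" "E \<subseteq> V \<times> V"
  shows "edge_sketches g V E = (\<lambda>v. if v \<in> V then truncate (g ` anc_edges E v) else {})"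
  unfolding edge_sketches_def
proof (rule fold_topo_order[OF assms])
  fix v \<sigma> assume \<sigma>: "\<And>u. u \<in> preds E v \<Longrightarrow> \<sigma> u = truncate (g ` anc_edges E u)"
  have finE: "finite E" using assms(1,3) finite_subset by blast
  have "truncate (\<Union>u\<in>preds E v. insert (g (u, v)) (\<sigma> u))
      = truncate ((\<Union>u\<in>preds E v. truncate (g ` anc_edges E u)) \<union> (\<lambda>u. g (u, v)) ` preds E v)"
    using \<sigma> by (intro arg_cong[where f=truncate]) auto
  also have "\<dots> = truncate ((\<Union>u\<in>preds E v. g ` anc_edges E u) \<union> (\<lambda>u. g (u, v)) ` preds E v)"
    using finE by (intro truncate_UN) auto
  also have "(\<Union>u\<in>preds E v. g ` anc_edges E u) \<union> (\<lambda>u. g (u, v)) ` preds E v = g ` anc_edges E v"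
    using anc_edges_rec[OF assms(2), of v] by auto
  finally show "truncate (\<Union>u\<in>preds E v. insert (g (u, v)) (\<sigma> u)) = truncate (g ` anc_edges E v)" .
qed

lemma card_filter_image_le:
  assumes "finite A"
  shows "card {y \<in> h ` A. P y} \<le> card {u \<in> A. P (h u)}"
proof -
  have "{y \<in> h ` A. P y} = h ` {u \<in> A. P (h u)}" by auto
  then show ?thesis using assms by (simp add: card_image_le)
qed

text \<open>Write F for \<open>card A\<close> and x for the maximum of a full sketch. The estimate
  864 R / x exceeds 4/3 F iff x F < 648 R, and it is below 2/3 F iff x F > 1296 R. As x has rank
  864, the former means that at least 864 elements hash below a threshold where about 648 are
  expected, the latter that fewer than 864 do where about 1296 are expected. In the latter case x
  \<le> R forces F \<ge> 1296. A sketch that is not full errs only by a collision.\<close>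

lemma bad_sketch_cases:
  assumes A: "finite A" and R: "R > 0" and h: "h ` A \<subseteq> {1..R}"
    and bad: "\<not> approx (sketch_value R (truncate (h ` A))) (card A)"
  shows "\<not> inj_on h A \<or> sketch_size \<le> card A \<and>
     (sketch_size \<le> card {u \<in> A. h u \<in> {y. real y * real (card A) \<le> 648 * real R}} \<or>
      1296 \<le> card A \<and> card {u \<in> A. h u \<in> {y. real y * real (card A) \<le> 1296 * real R}} < sketch_size)"
proof (rule ccontr)
  assume neg: "\<not> ?thesis"
  then have inj: "inj_on h A" by blast
  have cX: "card (h ` A) = card A" using inj by (rule card_image)
  have fX: "finite (h ` A)" using A by simp
  show False
  proof (cases "card (truncate (h ` A)) < sketch_size")
    case True
    then have "truncate (h ` A) = h ` A" using fX by (intro truncate_small)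
    then show False using bad True cX by (simp add: sketch_value_def approx_def)
  next
    case False
    define x where "x = Max (truncate (h ` A))"
    have x: "x \<in> h ` A" "card {y \<in> h ` A. y < x} < sketch_size" "card {y \<in> h ` A. y \<le> x} \<ge> sketch_size"
      using truncate_Max[OF fX] False unfolding x_def by auto
    have xR: "1 \<le> x" "x \<le> R" using x(1) h by auto
    have "card (truncate (h ` A)) \<le> card (h ` A)" using fX truncate_subset by (rule card_mono)
    then have F: "sketch_size \<le> card A" using False cX by simp
    have "sketch_size \<le> card {u \<in> A. h u \<le> x}"
      using x(3) card_filter_image_le[OF A, of h "\<lambda>y. y \<le> x"] by simp
    have n1: "real x * real (card A) > 648 * real R"
    proof (rule ccontr)
      assume le: "\<not> ?thesis"
      have "{u \<in> A. h u \<le> x} \<subseteq> {u \<in> A. h u \<in> {y. real y * real (card A) \<le> 648 * real R}}"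
      proof
        fix u assume u: "u \<in> {u \<in> A. h u \<le> x}"
        then have "real (h u) * card A \<le> real x * card A" by (intro mult_right_mono) auto
        then have "real (h u) * real (card A) \<le> 648 * real R" using le by linarith
        then show "u \<in> {u \<in> A. h u \<in> {y. real y * real (card A) \<le> 648 * real R}}" using u by simp
      qed
      then have "card {u \<in> A. h u \<le> x} \<le> card {u \<in> A. h u \<in> {y. real y * real (card A) \<le> 648 * real R}}"
        using A by (intro card_mono) auto
      then show False using neg F \<open>sketch_size \<le> card {u \<in> A. h u \<le> x}\<close> by simp
    qed
    have n2: "real x * real (card A) \<le> 1296 * real R"
    proof (rule ccontr)
      assume gt: "\<not> ?thesis"
      have "1296 \<le> card A"
      proof (rule ccontr)
        assume "\<not> ?thesis"
        then have "real x * card A \<le> real R * 1296" using xR by (intro mult_mono) auto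
        then show False using gt by simp
      qed
      have "{u \<in> A. h u \<in> {y. real y * real (card A) \<le> 1296 * real R}} \<subseteq> {u \<in> A. h u < x}"
      proof
        fix u assume u: "u \<in> {u \<in> A. h u \<in> {y. real y * real (card A) \<le> 1296 * real R}}"
        have "h u < x"
        proof (rule ccontr)
          assume "\<not> h u < x"
          then have "real (h u) * card A \<ge> real x * card A" by (intro mult_right_mono) auto
          moreover have "real (h u) * real (card A) \<le> 1296 * real R" using u by simp
          ultimately show False using gt by linarith
        qed
        then show "u \<in> {u \<in> A. h u < x}" using u by simp
      qed
      then have "card {u \<in> A. h u \<in> {y. real y * real (card A) \<le> 1296 * real R}} \<le> card {u \<in> A. h u < x}"
        using A by (intro card_mono) auto
      also have "\<dots> = card {y \<in> h ` A. y < x}"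
      proof -
        have "{y \<in> h ` A. y < x} = h ` {u \<in> A. h u < x}" by auto
        moreover have "inj_on h {u \<in> A. h u < x}" using inj by (rule inj_on_subset) auto
        ultimately show ?thesis by (simp add: card_image)
      qed
      finally show False using neg F x(2) \<open>1296 \<le> card A\<close> by simp
    qed
    have "sketch_value R (truncate (h ` A)) = 864 * real R / real x"
      using False by (simp add: sketch_value_def x_def sketch_size_def)
    moreover have "2/3 * real (card A) \<le> 864 * real R / real x"
      using n2 xR by (simp add: field_simps)
    moreover have "864 * real R / real x \<le> 4/3 * real (card A)"
      using n1 xR by (simp add: field_simps)
    ultimately show False using bad by (simp add: approx_def)
  qed
qed

section \<open>Accuracy of the sketches\<close>

lemma prob_Markov:
  assumes "integrable (measure_pmf p) f" "\<And>x. f x \<ge> 0" "c > 0"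
  shows "measure_pmf.prob p {x. c \<le> f x} \<le> measure_pmf.expectation p f / c"
proof -
  have "c * measure_pmf.prob p {x. c \<le> f x} = measure_pmf.expectation p (\<lambda>x. c * indicator {x. c \<le> f x} x)"
    by simp
  also have "\<dots> \<le> measure_pmf.expectation p f"
    using assms by (intro integral_mono integrable_mult_right integrable_real_indicator)
      (auto simp: indicator_def measure_pmf.emeasure_eq_measure)
  finally show ?thesis using assms(3) by (simp add: field_simps)
qed

text \<open>The count is a sum of independent indicators, so
  \<open>z ^ card {u \<in> A. h u \<in> T}\<close> is a product over \<open>U\<close> with factor 1
  outside \<open>A\<close>, and its expectation factorises.\<close>

lemma count_mgf:
  fixes z :: real
  assumes U: "finite U" "A \<subseteq> U" and z: "z > 0"
  shows "integrable (measure_pmf (Pi_pmf U d (\<lambda>_. p))) (\<lambda>h. z ^ card {u \<in> A. h u \<in> T})"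
    and "measure_pmf.expectation (Pi_pmf U d (\<lambda>_. p)) (\<lambda>h. z ^ card {u \<in> A. h u \<in> T})
      = (1 + measure_pmf.prob p T * (z - 1)) ^ card A"
proof -
  define f where "f = (\<lambda>u y. if u \<in> A then 1 + (z - 1) * indicator T y else (1::real))"
  have fA: "finite A" using U finite_subset by blast
  have eq: "z ^ card {u \<in> A. h u \<in> T} = (\<Prod>u\<in>U. f u (h u))" for h
  proof -
    have "(\<Prod>u\<in>U. f u (h u)) = (\<Prod>u\<in>{u \<in> A. h u \<in> T}. z)"
      using U by (intro prod.mono_neutral_cong_right) (auto simp: f_def indicator_def)
    then show ?thesis by simp
  qed
  have int: "integrable (measure_pmf p) (f u)" for u
    unfolding f_def by (cases "u \<in> A") (auto simp: measure_pmf.emeasure_eq_measure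
        intro!: Bochner_Integration.integrable_add integrable_mult_right integrable_real_indicator)
  show "integrable (measure_pmf (Pi_pmf U d (\<lambda>_. p))) (\<lambda>h. z ^ card {u \<in> A. h u \<in> T})"
    unfolding eq using U int by (intro integrable_prod_Pi_pmf) auto
  have "measure_pmf.expectation (Pi_pmf U d (\<lambda>_. p)) (\<lambda>h. z ^ card {u \<in> A. h u \<in> T})
      = (\<Prod>u\<in>U. measure_pmf.expectation p (f u))"
    unfolding eq using U int z by (intro expectation_prod_Pi_pmf) (auto simp: f_def indicator_def)
  also have "\<dots> = (\<Prod>u\<in>A. 1 + measure_pmf.prob p T * (z - 1))"
  proof (rule prod.mono_neutral_cong_right)
    show "\<forall>i\<in>U - A. measure_pmf.expectation p (f i) = 1" by (simp add: f_def)
    fix u assume "u \<in> A"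
    then show "measure_pmf.expectation p (f u) = 1 + measure_pmf.prob p T * (z - 1)"
      by (simp add: f_def measure_pmf.emeasure_eq_measure)
  qed (use U in auto)
  finally show "measure_pmf.expectation (Pi_pmf U d (\<lambda>_. p)) (\<lambda>h. z ^ card {u \<in> A. h u \<in> T})
      = (1 + measure_pmf.prob p T * (z - 1)) ^ card A"
    by simp
qed

text \<open>Comparing powers of \<open>z\<close> instead of counts covers both tails: for
  \<open>z > 1\<close> the event contains all counts at least \<open>k\<close>, for
  \<open>z < 1\<close> all counts at most \<open>k\<close>. The bound is Markov's inequality
  combined with 1 + x \<le> exp x.\<close>

lemma chernoff:
  fixes z :: real
  assumes U: "finite U" "A \<subseteq> U" and z: "z > 0"
  shows "measure_pmf.prob (Pi_pmf U d (\<lambda>_. p)) {h. z ^ k \<le> z ^ card {u \<in> A. h u \<in> T}}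
    \<le> exp (card A * measure_pmf.prob p T * (z - 1)) / z ^ k"
proof -
  let ?q = "measure_pmf.prob p T"
  have "measure_pmf.prob (Pi_pmf U d (\<lambda>_. p)) {h. z ^ k \<le> z ^ card {u \<in> A. h u \<in> T}}
      \<le> (1 + ?q * (z - 1)) ^ card A / z ^ k"
    using prob_Markov[OF count_mgf(1)[OF U z, of d p T], of "z ^ k"] z
    unfolding count_mgf(2)[OF U z, of d p T] by simp
  also have "(1 + ?q * (z - 1)) ^ card A \<le> exp (?q * (z - 1)) ^ card A"
  proof (rule power_mono)
    have "?q * z + (1 - ?q) \<ge> 0" using z by (intro add_nonneg_nonneg mult_nonneg_nonneg) auto
    then show "0 \<le> 1 + ?q * (z - 1)" by (simp add: algebra_simps)
  qed simp
  also have "\<dots> = exp (card A * ?q * (z - 1))" by (simp add: exp_of_nat_mult[symmetric] mult.assoc)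
  finally show ?thesis using z by (simp add: divide_right_mono)
qed

text \<open>Here z = 864 / 648 = 4/3, the optimal base, and the exponent is 648 * (4/3 - 1) = 216.
  Since 864 = 4 * 216, the quotient is a 216th power of e / (4/3)^4, which is below 1377/1600; 32 of
  these factors already give 1/64.\<close>

lemma exp_Chernoff_upper: "exp 216 / (4/3) ^ 864 \<le> (1/64 :: real)"
proof -
  have "exp (216::real) = exp 1 ^ 216" by (simp add: exp_of_nat_mult[symmetric])
  also have "\<dots> \<le> (272/100) ^ 216" using e_less_272 by (intro power_mono) auto
  finally have "exp 216 / (4/3) ^ 864 \<le> (272/100) ^ 216 / ((4/3) ^ 864 :: real)"
    by (intro divide_right_mono) auto
  moreover have "(272/100) ^ 216 / (4/3) ^ 864 = (1377/1600 :: real) ^ 216"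
  proof -
    have "(4/3 :: real) ^ 864 = ((4/3) ^ 4) ^ 216" by (simp only: power_mult[symmetric]) simp
    moreover have "272/100 / ((4/3) ^ 4) = (1377/1600 :: real)" by (simp add: power_divide)
    ultimately show ?thesis by (simp only: power_divide[symmetric])
  qed
  moreover have "(1377/1600 :: real) ^ 216 \<le> (1377/1600) ^ 32" by (rule power_decreasing) simp_all
  moreover have "(1377/1600 :: real) ^ 32 \<le> 1/64" by (simp add: power_divide)
  ultimately show ?thesis by linarith
qed

text \<open>Here z = 864 / 1296 = 2/3, and 1295 * (2/3 - 1) is below -431. Since 864 = 2 * 431 + 2,
  each factor exp (-1) is paired with (3/2)^2, giving at most 9/4 * 2/5 = 9/10; the two remaining
  powers of 2/3 contribute the initial 9/4.\<close>

lemma exp_Chernoff_lower: "exp (- 431) / (2/3) ^ 864 \<le> (1/64 :: real)"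
proof -
  have e: "exp (- 1) \<le> (2/5 :: real)"
    using exp_lower_Taylor_quadratic[of "1::real"] by (simp add: exp_minus field_simps)
  have "exp (- real n) / (2/3) ^ (2 * n + 2) \<le> (9/10) ^ n * (9/4 :: real)" for n
  proof (induction n)
    case (Suc n)
    have "exp (- real (Suc n)) / (2/3) ^ (2 * Suc n + 2)
        = exp (- real n) / (2/3) ^ (2 * n + 2) * (9/4 * exp (- 1) :: real)"
      by (simp add: exp_diff exp_minus field_simps)
    also have "\<dots> \<le> (9/10) ^ n * (9/4) * (9/4 * (2/5))"
      using e by (intro mult_mono Suc mult_left_mono) auto
    finally show ?case by simp
  qed (simp add: power2_eq_square)
  from this[of 431] have "exp (- 431) / (2/3) ^ 864 \<le> (9/10) ^ 431 * (9/4 :: real)" by simp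
  moreover have "(9/10) ^ 431 \<le> (9/10 :: real) ^ 60" by (rule power_decreasing) simp_all
  moreover have "(9/10) ^ 60 * (9/4) \<le> (1/64 :: real)" by (simp add: power_divide)
  ultimately show ?thesis by linarith
qed

section \<open>Uniform hash values: thresholds and collisions\<close>

lemma prob_uniform_le:
  assumes "R > 0" "F > 0"
  shows "real F * measure_pmf.prob (pmf_of_set {1..R}) {y. real y * real F \<le> real k * real R} \<le> real k"
proof -
  define q where "q = nat \<lfloor>real k * R / F\<rfloor>"
  have "{1..R} \<inter> {y. real y * real F \<le> real k * real R} \<subseteq> {1..q}"
    using assms by (auto simp: q_def field_simps le_nat_floor)
  then have "card ({1..R} \<inter> {y. real y * real F \<le> real k * real R}) \<le> card {1..q}"
    by (intro card_mono) auto
  then have "real (card ({1..R} \<inter> {y. real y * real F \<le> real k * real R})) \<le> real k * R / F"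
    by (simp add: q_def) (smt (verit) of_nat_floor of_nat_0_le_iff divide_nonneg_nonneg mult_nonneg_nonneg of_nat_mono)
  then show ?thesis
    using assms by (subst measure_pmf_of_set) (auto simp: field_simps)
qed

text \<open>Rounding the threshold \<open>k * R / F\<close> down loses less than one hash value; as
  \<open>F \<le> R\<close>, this costs at most 1 in the expected count. This is why 1295 and not
  1296 enters the lower tail.\<close>

lemma prob_uniform_ge:
  assumes "F > 0" "F \<le> R" "k \<le> F"
  shows "real F * measure_pmf.prob (pmf_of_set {1..R}) {y. real y * real F \<le> real k * real R} \<ge> real k - 1"
proof -
  define q where "q = nat \<lfloor>real k * R / F\<rfloor>"
  have q: "real q \<le> real k * R / F" "real k * R / F < real q + 1" unfolding q_def by (auto simp: of_nat_floor)
  have "{1..q} \<subseteq> {1..R} \<inter> {y. real y * real F \<le> real k * real R}"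
  proof
    fix y assume y: "y \<in> {1..q}"
    then have "real y \<le> real k * R / F" using q(1) by (auto intro: order_trans[OF _ q(1)])
    then have le: "real y * real F \<le> real k * real R" using assms by (simp add: field_simps)
    also have "\<dots> \<le> real F * real R" using assms by (intro mult_right_mono) auto
    finally have "real y \<le> real R" using assms by (simp add: mult.commute)
    then show "y \<in> {1..R} \<inter> {y. real y * real F \<le> real k * real R}" using y le by auto
  qed
  then have "card {1..q} \<le> card ({1..R} \<inter> {y. real y * real F \<le> real k * real R})"
    by (intro card_mono) auto
  then have "real (card ({1..R} \<inter> {y. real y * real F \<le> real k * real R})) \<ge> real k * R / F - 1"
    using q(2) by simp
  then have "real F * real (card ({1..R} \<inter> {y. real y * real F \<le> real k * real R})) \<ge> real F * (real k * R / F - 1)"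
    by (intro mult_left_mono) auto
  moreover have "real F * (real k * R / F - 1) \<ge> (real k - 1) * R"
    using assms by (simp add: field_simps)
  ultimately have "real F * real (card ({1..R} \<inter> {y. real y * real F \<le> real k * real R})) \<ge> (real k - 1) * R"
    by linarith
  then show ?thesis
    using assms by (subst measure_pmf_of_set) (auto simp: pos_le_divide_eq)
qed

text \<open>The event is split by the common value \<open>x\<close> into product events, to which
  independence applies: \<open>R\<close> values, each with probability
  \<open>1 / R ^ 2\<close>.\<close>

lemma prob_collision_pair:
  assumes U: "finite U" "u \<in> U" "v \<in> U" "u \<noteq> v" and R: "R > 0"
  shows "measure_pmf.prob (Pi_pmf U d (\<lambda>_. pmf_of_set {1..R})) {h. h u = h v} \<le> 1 / real R"
proof -
  let ?p = "Pi_pmf U d (\<lambda>_. pmf_of_set {1..R})"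
  define B where "B = (\<lambda>x w. if w \<in> {u, v} then {x} else (UNIV :: nat set))"
  have "measure_pmf.prob ?p {h. h u = h v} \<le> measure_pmf.prob ?p (\<Union>x\<in>{1..R}. Pi U (B x))"
  proof (rule measure_pmf.finite_measure_mono_AE)
    have "h \<in> (\<Union>x\<in>{1..R}. Pi U (B x))" if h: "h \<in> set_pmf ?p" "h u = h v" for h
    proof -
      have "h u \<in> {1..R}"
        using h U R by (auto simp: set_Pi_pmf PiE_dflt_def set_pmf_of_set dest!: bspec[where x=u])
      moreover have "h \<in> Pi U (B (h u))" using h(2) by (auto simp: B_def)
      ultimately show ?thesis by blast
    qed
    then show "AE x in measure_pmf ?p. x \<in> {h. h u = h v} \<longrightarrow> x \<in> (\<Union>x\<in>{1..R}. Pi U (B x))"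
      by (auto simp: AE_measure_pmf_iff)
  qed auto
  also have "\<dots> \<le> (\<Sum>x\<in>{1..R}. measure_pmf.prob ?p (Pi U (B x)))"
    by (rule measure_pmf.finite_measure_subadditive_finite) auto
  also have "\<dots> = (\<Sum>x\<in>{1..R}. 1 / real R * (1 / real R))"
  proof (rule sum.cong)
    fix x assume x: "x \<in> {1..R}"
    have "measure_pmf.prob ?p (Pi U (B x)) = (\<Prod>w\<in>U. measure_pmf.prob (pmf_of_set {1..R}) (B x w))"
      using U by (intro measure_Pi_pmf_Pi)
    also have "\<dots> = (\<Prod>w\<in>{u, v}. 1 / real R)"
    proof (rule prod.mono_neutral_cong_right)
      fix w assume "w \<in> {u, v}"
      moreover have "{1..R} \<inter> {x} = {x}" using x by auto
      ultimately show "measure_pmf.prob (pmf_of_set {1..R}) (B x w) = 1 / real R"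
        using R x by (auto simp: B_def measure_pmf_of_set measure_pmf_single)
    qed (use U in \<open>auto simp: B_def\<close>)
    finally show "measure_pmf.prob ?p (Pi U (B x)) = 1 / real R * (1 / real R)" using U(4) by simp
  qed simp
  also have "\<dots> = 1 / real R" using R by simp
  finally show ?thesis .
qed

text \<open>The birthday bound. It is kept in the sharp form F (F - 1) / (2 R), because with two
  elements and eight hash values the bound 1/8 is met with equality.\<close>

lemma prob_collision:
  assumes U: "finite U" "A \<subseteq> U" and R: "R > 0"
  shows "measure_pmf.prob (Pi_pmf U d (\<lambda>_. pmf_of_set {1..R})) {h. \<not> inj_on h A}
    \<le> real (card A) * (real (card A) - 1) / (2 * real R)"
proof -
  let ?p = "Pi_pmf U d (\<lambda>_. pmf_of_set {1..R})"
  have "finite A" using U finite_subset by blast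
  then show ?thesis using U(2)
  proof (induction A rule: finite_induct)
    case (insert u A)
    have "{h. \<not> inj_on h (insert u A)} \<subseteq> {h. \<not> inj_on h A} \<union> (\<Union>v\<in>A. {h. h u = h v})"
      by auto
    then have "measure_pmf.prob ?p {h. \<not> inj_on h (insert u A)}
        \<le> measure_pmf.prob ?p ({h. \<not> inj_on h A} \<union> (\<Union>v\<in>A. {h. h u = h v}))"
      by (rule measure_pmf.finite_measure_mono) simp
    also have "\<dots> \<le> measure_pmf.prob ?p {h. \<not> inj_on h A} + measure_pmf.prob ?p (\<Union>v\<in>A. {h. h u = h v})"
      by (rule measure_Un_le) auto
    also have "measure_pmf.prob ?p (\<Union>v\<in>A. {h. h u = h v}) \<le> (\<Sum>v\<in>A. measure_pmf.prob ?p {h. h u = h v})"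
      by (rule measure_pmf.finite_measure_subadditive_finite) (use insert in auto)
    also have "\<dots> \<le> (\<Sum>v\<in>A. 1 / real R)"
      using insert U R by (intro sum_mono prob_collision_pair) auto
    also have "measure_pmf.prob ?p {h. \<not> inj_on h A} \<le> real (card A) * (real (card A) - 1) / (2 * real R)"
      using insert by auto
    finally show ?case using insert R by (simp add: field_simps)
  qed simp
qed

text \<open>Below \<open>sketch_size\<close> elements only collisions matter, and with
  \<open>R = s ^ 3\<close> they have probability at most (s - 1) / (2 s^2) \<le> 1/8. Otherwise s
  \<ge> 864, and collisions and the two tails contribute at most 1/64 each.\<close>

lemma prob_bad_sketch:
  fixes U :: "'b set"
  assumes U: "finite U" "A \<subseteq> U"
  shows "measure_pmf.prob (hash_table U)
      {h. \<not> approx (sketch_value (hash_range (card U)) (truncate (h ` A))) (card A)} \<le> 1/8"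
proof (cases "A = {}")
  case True
  then show ?thesis by (simp add: truncate_def sketch_value_def approx_def sketch_size_def)
next
  case False
  define s where "s = card U"
  define R where "R = hash_range s"
  let ?p = "Pi_pmf U 0 (\<lambda>_. pmf_of_set {1..R})"
  let ?F = "card A"
  have fA: "finite A" using U finite_subset by blast
  have F: "0 < ?F" "?F \<le> s" using False fA U by (auto simp: s_def card_gt_0_iff intro: card_mono)
  then have s: "s > 0" by simp
  have R: "R > 0" "s \<le> R" using s by (auto simp: R_def hash_range_def intro: self_le_power)
  define N where "N = {h :: 'b \<Rightarrow> nat. \<not> inj_on h A}"
  define P where "P = {h :: 'b \<Rightarrow> nat. sketch_size \<le> ?F \<and> sketch_size \<le> card {u \<in> A. h u \<in> {y. real y * real ?F \<le> 648 * real R}}}"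
  define Q where "Q = {h :: 'b \<Rightarrow> nat. 1296 \<le> ?F \<and> card {u \<in> A. h u \<in> {y. real y * real ?F \<le> 1296 * real R}} < sketch_size}"
  have "measure_pmf.prob ?p {h. \<not> approx (sketch_value R (truncate (h ` A))) ?F}
      \<le> measure_pmf.prob ?p (N \<union> P \<union> Q)"
  proof (rule measure_pmf.finite_measure_mono_AE)
    have "h \<in> N \<union> P \<union> Q"
      if h: "h \<in> set_pmf ?p" "\<not> approx (sketch_value R (truncate (h ` A))) ?F" for h
    proof -
      have "h ` A \<subseteq> {1..R}"
        using h(1) U R by (auto simp: set_Pi_pmf PiE_dflt_def set_pmf_of_set subset_iff)
      from bad_sketch_cases[OF fA R(1) this h(2)] show ?thesis by (auto simp: N_def P_def Q_def)
    qed
    then show "AE h in ?p. h \<in> {h. \<not> approx (sketch_value R (truncate (h ` A))) ?F} \<longrightarrow> h \<in> N \<union> P \<union> Q"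
      by (auto simp: AE_measure_pmf_iff)
  qed simp
  also have "\<dots> \<le> measure_pmf.prob ?p N + measure_pmf.prob ?p P + measure_pmf.prob ?p Q"
    by (intro order_trans[OF measure_Un_le] add_right_mono
        measure_Un_le) auto
  also have "\<dots> \<le> 1/8"
  proof -
    have "measure_pmf.prob ?p N \<le> real ?F * (real ?F - 1) / (2 * real R)"
      unfolding N_def using U R(1) by (rule prob_collision)
    also have "\<dots> \<le> real s * (real s - 1) / (2 * real R)"
      using F R by (intro divide_right_mono mult_mono) auto
    also have "\<dots> = (real s - 1) / (2 * real s ^ 2)"
      using s by (simp add: R_def hash_range_def field_simps power2_eq_square power3_eq_cube)
    finally have N: "measure_pmf.prob ?p N \<le> (real s - 1) / (2 * real s ^ 2)" .
    show ?thesis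
    proof (cases "?F < sketch_size")
      case True
      then have "P = {}" "Q = {}" by (auto simp: P_def Q_def sketch_size_def)
      \<comment> \<open>The left-hand side is maximal at \<open>s = 2\<close>, hence the square of
        \<open>s - 2\<close>.\<close>
      moreover have "(real s - 1) / (2 * real s ^ 2) \<le> 1/8"
      proof -
        have "0 \<le> (real s - 2)^2" by simp
        then show ?thesis using s by (simp add: field_simps power2_eq_square)
      qed
      ultimately show ?thesis using N by (simp only: measure_empty)
    next
      case False
      then have s864: "s \<ge> 864" using F by (simp add: sketch_size_def)
      have "(real s - 1) / (2 * real s ^ 2) \<le> real s / (2 * real s ^ 2)" by (intro divide_right_mono) auto
      also have "\<dots> \<le> 1 / (2 * real s)" using s by (simp add: field_simps power2_eq_square)
      also have "\<dots> \<le> 1/64" using s864 by (simp add: field_simps)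
      finally have N: "measure_pmf.prob ?p N \<le> 1/64" using N by linarith
      have P: "measure_pmf.prob ?p P \<le> 1/64"
      proof -
        let ?T = "{y. real y * real ?F \<le> 648 * real R}"
        have q: "real ?F * measure_pmf.prob (pmf_of_set {1..R}) ?T \<le> 648"
          using prob_uniform_le[OF R(1) F(1), of 648] by simp
        have "P \<subseteq> {h. (4/3::real) ^ 864 \<le> (4/3) ^ card {u \<in> A. h u \<in> ?T}}"
          by (auto simp: P_def sketch_size_def intro: power_increasing)
        then have "measure_pmf.prob ?p P \<le> measure_pmf.prob ?p {h. (4/3::real) ^ 864 \<le> (4/3) ^ card {u \<in> A. h u \<in> ?T}}"
          by (rule measure_pmf.finite_measure_mono) simp
        also have "\<dots> \<le> exp (real ?F * measure_pmf.prob (pmf_of_set {1..R}) ?T * (4/3 - 1)) / (4/3) ^ 864"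
          using U by (intro chernoff) auto
        also have "\<dots> \<le> exp 216 / (4/3) ^ 864" using q by (intro divide_right_mono) auto
        finally show ?thesis using exp_Chernoff_upper by linarith
      qed
      have Q: "measure_pmf.prob ?p Q \<le> 1/64"
      proof (cases "1296 \<le> ?F")
        case True
        let ?T = "{y. real y * real ?F \<le> 1296 * real R}"
        have q: "real ?F * measure_pmf.prob (pmf_of_set {1..R}) ?T \<ge> 1295"
          using prob_uniform_ge[of ?F R 1296] F R True by simp
        have "Q \<subseteq> {h. (2/3::real) ^ 864 \<le> (2/3) ^ card {u \<in> A. h u \<in> ?T}}"
          by (auto simp: Q_def sketch_size_def intro!: power_decreasing)
        then have "measure_pmf.prob ?p Q \<le> measure_pmf.prob ?p {h. (2/3::real) ^ 864 \<le> (2/3) ^ card {u \<in> A. h u \<in> ?T}}"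
          by (rule measure_pmf.finite_measure_mono) simp
        also have "\<dots> \<le> exp (real ?F * measure_pmf.prob (pmf_of_set {1..R}) ?T * (2/3 - 1)) / (2/3) ^ 864"
          using U by (intro chernoff) auto
        also have "\<dots> \<le> exp (- 431) / (2/3) ^ 864" using q by (intro divide_right_mono) auto
        finally show ?thesis using exp_Chernoff_lower by linarith
      qed (simp add: Q_def)
      show ?thesis using N P Q by simp
    qed
  qed
  finally show ?thesis by (simp add: hash_table_def R_def s_def)
qed

section \<open>Medians of independent copies\<close>

lemma median_large:
  assumes "xs \<noteq> []" "P (median xs)" "\<And>x y. P x \<Longrightarrow> x \<le> y \<Longrightarrow> P y"
  shows "length xs \<le> 2 * length (filter P xs)"
proof -
  let ?ys = "sort xs" and ?m = "length xs div 2"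
  have "length (filter P xs) = length (filter P ?ys)"
    by (metis mset_filter mset_sort size_mset)
  also have "\<dots> = card {i. i < length ?ys \<and> P (?ys ! i)}" by (rule length_filter_conv_card)
  also have "\<dots> \<ge> card {?m..<length xs}"
  proof (rule card_mono)
    show "{?m..<length xs} \<subseteq> {i. i < length ?ys \<and> P (?ys ! i)}"
    proof
      fix i assume i: "i \<in> {?m..<length xs}"
      then have "?ys ! ?m \<le> ?ys ! i" by (intro sorted_nth_mono) auto
      then show "i \<in> {i. i < length ?ys \<and> P (?ys ! i)}"
        using assms(2,3) i by (auto simp: median_def)
    qed
  qed simp
  finally show ?thesis by simp
qed

lemma median_small:
  assumes "xs \<noteq> []" "P (median xs)" "\<And>x y. P x \<Longrightarrow> y \<le> x \<Longrightarrow> P y"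
  shows "length xs \<le> 2 * length (filter P xs)"
proof -
  let ?ys = "sort xs" and ?m = "length xs div 2"
  have m: "?m < length xs" using assms(1) by (cases xs) auto
  have "length (filter P xs) = length (filter P ?ys)"
    by (metis mset_filter mset_sort size_mset)
  also have "\<dots> = card {i. i < length ?ys \<and> P (?ys ! i)}" by (rule length_filter_conv_card)
  also have "\<dots> \<ge> card {..?m}"
  proof (rule card_mono)
    show "{..?m} \<subseteq> {i. i < length ?ys \<and> P (?ys ! i)}"
    proof
      fix i assume i: "i \<in> {..?m}"
      then have "?ys ! i \<le> ?ys ! ?m" using m by (intro sorted_nth_mono) auto
      then show "i \<in> {i. i < length ?ys \<and> P (?ys ! i)}"
        using assms(2,3) i m by (auto simp: median_def)
    qed
  qed simp
  finally show ?thesis by simp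
qed

text \<open>An inaccurate median is either too large or too small. Both conditions are monotone, so
  at least half of the entries, those on the same side of the median, violate the same
  bound.\<close>

lemma median_bad:
  assumes "\<not> approx (median xs) k"
  shows "length xs \<le> 2 * length (filter (\<lambda>x. \<not> approx x k) xs)"
proof (cases "xs = []")
  case False
  have mono: "length (filter P xs) \<le> length (filter (\<lambda>x. \<not> approx x k) xs)"
    if "\<And>x. P x \<Longrightarrow> \<not> approx x k" for P
    using that by (induction xs) auto
  from assms consider "median xs > 4/3 * real k" | "median xs < 2/3 * real k"
    by (force simp: approx_def)
  then show ?thesis
  proof cases
    case 1
    have "length xs \<le> 2 * length (filter (\<lambda>x. x > 4/3 * real k) xs)"
      using False 1 by (rule median_large) auto
    also have "\<dots> \<le> 2 * length (filter (\<lambda>x. \<not> approx x k) xs)"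
      using mono[of "\<lambda>x. x > 4/3 * real k"] by (simp add: approx_def)
    finally show ?thesis .
  next
    case 2
    have "length xs \<le> 2 * length (filter (\<lambda>x. x < 2/3 * real k) xs)"
      using False 2 by (rule median_small) auto
    also have "\<dots> \<le> 2 * length (filter (\<lambda>x. \<not> approx x k) xs)"
      using mono[of "\<lambda>x. x < 2/3 * real k"] by (simp add: approx_def)
    finally show ?thesis .
  qed
qed simp

text \<open>Markov's inequality for 4 to the number of bad entries: each copy contributes a factor
  of mean at most 1 + 3/8 = 11/8, and a bad half makes the product at least 2^L. The quotient of
  11/8 by 2 is 11/16. Nonnegative integrals in \<open>ennreal\<close> spare the integrability
  conditions.\<close>

lemma prob_majority_bad:
  assumes "measure_pmf.prob p {x. bad x} \<le> 1/8"
  shows "measure_pmf.prob (replicate_pmf L p) {xs. L \<le> 2 * length (filter bad xs)} \<le> (11/16) ^ L"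
proof -
  let ?g = "\<lambda>x. if bad x then 4 else (1 :: ennreal)"
  have g: "nn_integral p ?g \<le> ennreal (11/8)"
  proof -
    have "nn_integral p ?g = nn_integral p (\<lambda>x. 1 + 3 * indicator {x. bad x} x)"
      by (intro nn_integral_cong) (auto simp: indicator_def)
    also have "\<dots> = 1 + 3 * emeasure p {x. bad x}"
      by (subst nn_integral_add) (auto simp: nn_integral_cmult)
    also have "\<dots> = ennreal (1 + 3 * measure_pmf.prob p {x. bad x})"
      by (simp add: measure_pmf.emeasure_eq_measure ennreal_mult' ennreal_plus)
    also have "\<dots> \<le> ennreal (11/8)" using assms by (intro ennreal_leI) simp
    finally show ?thesis .
  qed
  have pow: "nn_integral (replicate_pmf L p) (\<lambda>xs. 4 ^ length (filter bad xs)) \<le> ennreal ((11/8) ^ L)"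
  proof (induction L)
    case (Suc L)
    have "nn_integral (replicate_pmf (Suc L) p) (\<lambda>xs. 4 ^ length (filter bad xs))
        = (\<integral>\<^sup>+x. \<integral>\<^sup>+xs. ?g x * 4 ^ length (filter bad xs) \<partial>replicate_pmf L p \<partial>p)"
      by (auto intro!: nn_integral_cong)
    also have "\<dots> = nn_integral p ?g * nn_integral (replicate_pmf L p) (\<lambda>xs. 4 ^ length (filter bad xs))"
      by (simp add: nn_integral_cmult nn_integral_multc)
    also have "\<dots> \<le> ennreal (11/8) * ennreal ((11/8) ^ L)" by (intro mult_mono g Suc) auto
    finally show ?case by (simp add: ennreal_mult'[symmetric])
  qed simp
  let ?B = "{xs. L \<le> 2 * length (filter bad xs)}"
  have "ennreal (2 ^ L * measure_pmf.prob (replicate_pmf L p) ?B) = (\<integral>\<^sup>+xs. ennreal (2 ^ L) * indicator ?B xs \<partial>replicate_pmf L p)"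
    by (simp add: nn_integral_cmult_indicator measure_pmf.emeasure_eq_measure ennreal_mult')
  also have "\<dots> \<le> nn_integral (replicate_pmf L p) (\<lambda>xs. 4 ^ length (filter bad xs))"
  proof (rule nn_integral_mono)
    fix xs :: "'a list"
    have "ennreal (2 ^ L) \<le> 4 ^ length (filter bad xs)" if "L \<le> 2 * length (filter bad xs)"
    proof -
      have "(2::real) ^ L \<le> 2 ^ (2 * length (filter bad xs))" using that by (rule power_increasing) simp
      also have "\<dots> = 4 ^ length (filter bad xs)" by (simp add: power_mult)
      finally have "ennreal (2 ^ L) \<le> ennreal (4 ^ length (filter bad xs))" by (rule ennreal_leI)
      also have "\<dots> = 4 ^ length (filter bad xs)" by (simp add: ennreal_power[symmetric])
      finally show ?thesis .
    qed
    then show "ennreal (2 ^ L) * indicator ?B xs \<le> 4 ^ length (filter bad xs)"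
      by (auto simp: indicator_def)
  qed
  also note pow
  finally have "2 ^ L * measure_pmf.prob (replicate_pmf L p) ?B \<le> (11/8) ^ L"
    by (subst (asm) ennreal_le_iff) auto
  then have "measure_pmf.prob (replicate_pmf L p) ?B \<le> (11/8) ^ L / 2 ^ L" by (simp add: field_simps)
  also have "\<dots> = (11/16) ^ L" by (simp only: power_divide[symmetric]) simp
  finally show ?thesis .
qed

lemma length_replicate_pmf: "xs \<in> set_pmf (replicate_pmf L p) \<Longrightarrow> length xs = L"
  by (simp add: set_replicate_pmf)

lemma prob_bad_median:
  assumes U: "finite U" "A \<subseteq> U"
  shows "measure_pmf.prob (replicate_pmf L (hash_table U))
     {hs. \<not> approx (median (map (\<lambda>h. sketch_value (hash_range (card U)) (truncate (h ` A))) hs)) (card A)}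
     \<le> (11/16) ^ L"
proof -
  let ?bad = "\<lambda>h. \<not> approx (sketch_value (hash_range (card U)) (truncate (h ` A))) (card A)"
  have "measure_pmf.prob (replicate_pmf L (hash_table U))
     {hs. \<not> approx (median (map (\<lambda>h. sketch_value (hash_range (card U)) (truncate (h ` A))) hs)) (card A)}
    \<le> measure_pmf.prob (replicate_pmf L (hash_table U)) {hs. L \<le> 2 * length (filter ?bad hs)}"
  proof (rule measure_pmf.finite_measure_mono_AE)
    show "AE hs in replicate_pmf L (hash_table U). hs \<in>
        {hs. \<not> approx (median (map (\<lambda>h. sketch_value (hash_range (card U)) (truncate (h ` A))) hs)) (card A)}
        \<longrightarrow> hs \<in> {hs. L \<le> 2 * length (filter ?bad hs)}"
    proof (simp only: AE_measure_pmf_iff, intro ballI impI)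
      fix hs assume hs: "hs \<in> set_pmf (replicate_pmf L (hash_table U))"
        and b: "hs \<in> {hs. \<not> approx (median (map (\<lambda>h. sketch_value (hash_range (card U)) (truncate (h ` A))) hs)) (card A)}"
      show "hs \<in> {hs. L \<le> 2 * length (filter ?bad hs)}"
        using median_bad[OF b[simplified]] length_replicate_pmf[OF hs]
        by (simp add: filter_map comp_def)
    qed
  qed simp
  also have "\<dots> \<le> (11/16) ^ L"
    by (intro prob_majority_bad prob_bad_sketch U)
  finally show ?thesis .
qed

text \<open>Outside \<open>V\<close> the estimates have to be accurate for 0, that is, equal to 0.
  Pruning relies on this for vertices that have left the graph.\<close>

definition good_estimates :: "'a set \<Rightarrow> ('a \<times> 'a) set \<Rightarrow> ('a \<Rightarrow> real) \<times> ('a \<Rightarrow> real) \<Rightarrow> bool" where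
  "good_estimates V E ae \<longleftrightarrow>
     (\<forall>v. approx (fst ae v) (if v \<in> V then card (anc E v) else 0) \<and>
          approx (snd ae v) (if v \<in> V then card (anc_edges E v) else 0))"

lemma prob_UN_le:
  assumes "finite V" "\<And>v. v \<in> V \<Longrightarrow> measure_pmf.prob p {x. B v x} \<le> q"
  shows "measure_pmf.prob p {x. \<exists>v\<in>V. B v x} \<le> real (card V) * q"
proof -
  have "{x. \<exists>v\<in>V. B v x} = (\<Union>v\<in>V. {x. B v x})" by auto
  then have "measure_pmf.prob p {x. \<exists>v\<in>V. B v x} \<le> (\<Sum>v\<in>V. measure_pmf.prob p {x. B v x})"
    using assms(1) by (simp add: measure_pmf.finite_measure_subadditive_finite)
  also have "\<dots> \<le> real (card V) * q" using assms by (intro sum_bounded_above) auto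
  finally show ?thesis .
qed

lemma median_zeros: "xs \<noteq> [] \<Longrightarrow> (\<And>x. x \<in> set xs \<Longrightarrow> x = 0) \<Longrightarrow> median xs = 0"
  unfolding median_def
  by (metis nth_mem length_sort set_sort length_greater_0_conv div_less_dividend one_less_numeral_iff semiring_norm(76))

text \<open>One failure event for the ancestors and one for the ancestor edges of each vertex give
  the factor \<open>2 * card V\<close>.\<close>

lemma whp_estimates:
  assumes V: "finite V" "E \<subseteq> V \<times> V" "acyclic E" and L: "L \<ge> 1"
  shows "whp (2 * real (card V) * (11/16) ^ L) (estimates L V E) (good_estimates V E)"
proof -
  have finE: "finite E" using V finite_subset by blast
  let ?a = "\<lambda>A hs. median (map (\<lambda>h. sketch_value (hash_range (card V)) (truncate (h ` A))) hs)"
  let ?e = "\<lambda>A gs. median (map (\<lambda>g. sketch_value (hash_range (card E)) (truncate (g ` A))) gs)"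
  let ?A = "\<lambda>hs. \<forall>v\<in>V. approx (?a (anc E v) hs) (card (anc E v))"
  let ?E = "\<lambda>gs. \<forall>v\<in>V. approx (?e (anc_edges E v) gs) (card (anc_edges E v))"
  let ?f = "(\<lambda>hs gs. (\<lambda>v. median (map (\<lambda>h. sketch_value (hash_range (card V)) (vertex_sketches h V E v)) hs),
        \<lambda>v. median (map (\<lambda>g. sketch_value (hash_range (card E)) (edge_sketches g V E v)) gs)))"
  define q where "q = real (card V) * (11/16) ^ L"
  have a: "whp q (spmf_of_pmf (replicate_pmf L (hash_table V))) ?A"
    unfolding whp_spmf_of_pmf q_def
    using prob_UN_le[of V "replicate_pmf L (hash_table V)" "\<lambda>v hs. \<not> approx (?a (anc E v) hs) (card (anc E v))"]
      prob_bad_median[OF V(1), of "anc E v" L for v] anc_subset[OF V(2)] V(1) by simp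
  have e: "whp q (spmf_of_pmf (replicate_pmf L (hash_table E))) ?E"
    unfolding whp_spmf_of_pmf q_def
    using prob_UN_le[of V "replicate_pmf L (hash_table E)" "\<lambda>v gs. \<not> approx (?e (anc_edges E v) gs) (card (anc_edges E v))"]
      prob_bad_median[OF finE, of "anc_edges E v" L for v] V(1) by (simp add: anc_edges_def induced_def)
  have good: "good_estimates V E (?f hs gs)"
    if "?A hs" "?E gs" "length hs = L" "length gs = L" for hs gs
    unfolding good_estimates_def
  proof (intro allI)
    fix v
    have "hs \<noteq> []" "gs \<noteq> []" using that L by auto
    then have 0: "median (map (\<lambda>h. sketch_value R {}) hs) = 0" "median (map (\<lambda>h. sketch_value R {}) gs) = 0" for R
      by (auto intro!: median_zeros simp: sketch_value_def sketch_size_def)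
    show "approx (fst (?f hs gs) v) (if v \<in> V then card (anc E v) else 0) \<and>
        approx (snd (?f hs gs) v) (if v \<in> V then card (anc_edges E v) else 0)"
      using that V 0 by (cases "v \<in> V") (simp_all add: vertex_sketches_eq edge_sketches_eq approx_def)
  qed
  have "estimates L V E = spmf_of_pmf (replicate_pmf L (hash_table V)) \<bind> (\<lambda>hs.
      spmf_of_pmf (replicate_pmf L (hash_table E)) \<bind> (\<lambda>gs. return_spmf (?f hs gs)))"
    by (simp add: estimates_def spmf_of_pmf_bind)
  also have "whp (q + (q + 0)) \<dots> (good_estimates V E)"
  proof (intro whp_bind[OF a] whp_bind[OF e] whp_return)
    fix hs gs
    assume "hs \<in> set_spmf (spmf_of_pmf (replicate_pmf L (hash_table V)))"
      "gs \<in> set_spmf (spmf_of_pmf (replicate_pmf L (hash_table E)))" "?A hs" "?E gs"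
    then show "good_estimates V E (?f hs gs)"
      by (intro good) (auto simp: length_replicate_pmf)
  qed (auto simp: q_def)
  finally show ?thesis by (simp add: q_def mult.assoc)
qed

text \<open>Transposition of a table of independent values: a list of \<open>L\<close> values for
  every vertex amounts to \<open>L\<close> independent hash functions. It connects hash values drawn
  vertex by vertex with the copies of \<open>hash_table\<close>. The induction splits off the first
  value of every list.\<close>

lemma Pi_pmf_replicate:
  assumes "finite V"
  shows "map_pmf (\<lambda>T. map (\<lambda>j v. if v \<in> V then T v ! j else d) [0..<L]) (Pi_pmf V d' (\<lambda>_. replicate_pmf L p))
    = replicate_pmf L (Pi_pmf V d (\<lambda>_. p))"
proof (induction L arbitrary: d')
  case (Suc L)
  define d0 where "d0 = d'"
  let ?h = "\<lambda>L T. map (\<lambda>j v. if v \<in> V then T v ! j else d) [0..<L]"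
  have "Pi_pmf V d' (\<lambda>_. replicate_pmf (Suc L) p)
      = do {f \<leftarrow> Pi_pmf V d (\<lambda>_. p); T \<leftarrow> Pi_pmf V d' (\<lambda>_. replicate_pmf L p);
            return_pmf (\<lambda>v. if v \<in> V then f v # T v else d')}"
    using assms by (simp add: Pi_pmf_bind[where d'=d] Pi_pmf_bind[where d'=d'])
  also have "map_pmf (?h (Suc L)) \<dots>
      = do {f \<leftarrow> Pi_pmf V d (\<lambda>_. p); T \<leftarrow> Pi_pmf V d' (\<lambda>_. replicate_pmf L p); return_pmf (f # ?h L T)}"
    unfolding map_bind_pmf map_return_pmf
  proof (intro bind_pmf_cong refl arg_cong[where f=return_pmf])
    fix f T assume "f \<in> set_pmf (Pi_pmf V d (\<lambda>_. p))"
    then have f: "f v = d" if "v \<notin> V" for v using assms that by (auto simp: set_Pi_pmf PiE_dflt_def)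
    have "?h (Suc L) (\<lambda>v. if v \<in> V then f v # T v else d')
        = map (\<lambda>j v. if v \<in> V then (f v # T v) ! j else d) (0 # map Suc [0..<L])"
      by (simp only: upt_rec[of 0 "Suc L"] map_Suc_upt) (auto intro!: map_cong simp: fun_eq_iff)
    also have "\<dots> = f # ?h L T" using f by (auto simp: fun_eq_iff)
    finally show "?h (Suc L) (\<lambda>v. if v \<in> V then f v # T v else d') = f # ?h L T" .
  qed
  also have "\<dots> = do {f \<leftarrow> Pi_pmf V d (\<lambda>_. p); xs \<leftarrow> map_pmf (?h L) (Pi_pmf V d' (\<lambda>_. replicate_pmf L p)); return_pmf (f # xs)}"
    by (simp add: bind_map_pmf)
  also have "\<dots> = replicate_pmf (Suc L) (Pi_pmf V d (\<lambda>_. p))" by (simp add: Suc.IH)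
  finally show ?case .
qed simp

section \<open>Graphs after removal of a batch\<close>

lemma anc_induced_subset: "anc (induced E S) v \<subseteq> anc E v"
  unfolding anc_def induced_def by (auto intro: rtrancl_mono[THEN subsetD, rotated])

lemma anc_induced_in:
  assumes "v \<in> S"
  shows "anc (induced E S) v \<subseteq> S"
  using anc_subset[of "induced E S" S v] assms by (auto simp: induced_def)

text \<open>As \<open>A\<close> is closed under predecessors, a path ending outside \<open>A\<close>
  never meets \<open>A\<close>. Removing \<open>A\<close> thus does not break any path between
  remaining vertices, and ancestor sets just lose their part in \<open>A\<close>.\<close>

lemma anc_remove:
  assumes E: "E \<subseteq> V \<times> V" and closed: "\<And>x y. (x, y) \<in> E \<Longrightarrow> y \<in> A \<Longrightarrow> x \<in> A" and v: "v \<in> V - A"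
  shows "anc (induced E (V - A)) v = anc E v - A"
    and "anc_edges (induced E (V - A)) v = induced E (anc E v - A)"
proof -
  have sub: "anc (induced E (V - A)) v \<subseteq> anc E v - A"
    using anc_induced_subset[of E "V - A" v] anc_induced_in[OF v, of E] by auto
  have "(u, v) \<in> (induced E (V - A))\<^sup>*" if "(u, v) \<in> E\<^sup>*" "u \<notin> A" for u
    using that
  proof (induction rule: converse_rtrancl_induct)
    case (step y z)
    then have "z \<notin> A" using closed by blast
    then show ?case using step E
      by (intro converse_rtrancl_into_rtrancl[OF _ step.IH]) (auto simp: induced_def)
  qed simp
  then show eq: "anc (induced E (V - A)) v = anc E v - A"
    using sub by (auto simp: anc_def)
  show "anc_edges (induced E (V - A)) v = induced E (anc E v - A)"
    using anc_subset[OF E, of v] v unfolding anc_edges_def eq by (auto simp: induced_def)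
qed

lemma anc_closed:
  assumes closed: "\<And>x y. (x, y) \<in> E \<Longrightarrow> y \<in> X \<Longrightarrow> x \<in> X" and v: "v \<in> X"
  shows "anc E v \<subseteq> X" "anc (induced E X) v = anc E v"
proof -
  have path: "u \<in> X \<and> (u, v) \<in> (induced E X)\<^sup>*" if "(u, v) \<in> E\<^sup>*" for u
    using that
  proof (induction rule: converse_rtrancl_induct)
    case (step y z)
    then have "y \<in> X" using closed by blast
    then show ?case using step
      by (auto intro!: converse_rtrancl_into_rtrancl[of y z] simp: induced_def)
  qed (use v in simp)
  then show "anc E v \<subseteq> X" by (auto simp: anc_def)
  show "anc (induced E X) v = anc E v"
    using path anc_induced_subset[of E X v] by (auto simp: anc_def)
qed

lemma ancs_closed: "(x, y) \<in> E \<Longrightarrow> y \<in> ancs E B \<Longrightarrow> x \<in> ancs E B"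
  unfolding ancs_def anc_def by (auto intro: converse_rtrancl_into_rtrancl)

lemma ancs_mono: "B \<subseteq> B' \<Longrightarrow> ancs E B \<subseteq> ancs E B'"
  by (auto simp: ancs_def)

lemma ancs_subset: "E \<subseteq> V \<times> V \<Longrightarrow> B \<subseteq> V \<Longrightarrow> ancs E B \<subseteq> V"
  using anc_subset[of E V] by (auto simp: ancs_def)

lemma ancs_edges_mono: "B \<subseteq> B' \<Longrightarrow> ancs_edges E B \<subseteq> ancs_edges E B'"
  using ancs_mono[of B B' E] by (auto simp: ancs_edges_def induced_def)

lemma anc_edges_subset_ancs_edges: "v \<in> B \<Longrightarrow> anc_edges E v \<subseteq> ancs_edges E B"
  by (auto simp: ancs_edges_def anc_edges_def induced_def ancs_def)

lemma acyclic_induced: "acyclic E \<Longrightarrow> acyclic (induced E S)"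
  by (rule acyclic_subset) (auto simp: induced_def)

text \<open>Every ancestor other than \<open>v\<close> is the tail of an ancestor edge. Hence
  sorting vertices into buckets by edges alone controls the whole size of the cone.\<close>

lemma card_anc_le:
  assumes "finite E"
  shows "card (anc E v) \<le> card (anc_edges E v) + 1"
proof -
  have "anc E v \<subseteq> insert v (fst ` anc_edges E v)"
  proof
    fix u assume "u \<in> anc E v"
    then have uv: "(u, v) \<in> E\<^sup>*" by (simp add: anc_def)
    then show "u \<in> insert v (fst ` anc_edges E v)"
    proof (cases rule: converse_rtranclE)
      case (step y)
      then have "(u, y) \<in> anc_edges E v" using uv by (auto simp: anc_edges_def induced_def anc_def)
      then show ?thesis by (auto intro: rev_image_eqI)
    qed simp
  qed
  then have "card (anc E v) \<le> card (insert v (fst ` anc_edges E v))"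
    using assms by (intro card_mono) auto
  also have "\<dots> \<le> card (fst ` anc_edges E v) + 1" by (simp add: card_insert_le_m1 card_insert_if assms)
  also have "\<dots> \<le> card (anc_edges E v) + 1" using assms by (simp add: card_image_le)
  finally show ?thesis .
qed

definition cone_size :: "('a \<times> 'a) set \<Rightarrow> 'a \<Rightarrow> nat" where
  "cone_size E v = card (anc E v) + card (anc_edges E v)"

lemma cone_size_pos: "finite E \<Longrightarrow> cone_size E v \<ge> 1"
  using card_gt_0_iff[of "anc E v"] self_in_anc[of v E] by (fastforce simp: cone_size_def)

text \<open>The edges counted here have both ends outside \<open>ancs E B\<close>; these survive in
  the remaining graph. \<open>fresh\<close> discounts only edges with both ends inside, and it uses
  \<gamma> instead of \<open>4 * \<gamma>\<close>. So this is weaker than being stale, and it also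
  covers vertices removed on the evidence of estimates.\<close>

definition shrunk :: "real \<Rightarrow> ('a \<times> 'a) set \<Rightarrow> 'a set \<Rightarrow> 'a \<Rightarrow> bool" where
  "shrunk \<gamma> E B v \<longleftrightarrow>
     real (card (anc E v - ancs E B)) \<le> 4 * \<gamma> * real (card (anc E v)) \<or>
     anc_edges E v \<noteq> {} \<and>
       real (card (induced E (anc E v - ancs E B))) \<le> 4 * \<gamma> * real (card (anc_edges E v))"

lemma shrunk_mono:
  assumes "finite E" "B \<subseteq> B'" "shrunk \<gamma> E B v"
  shows "shrunk \<gamma> E B' v"
proof -
  have "card (anc E v - ancs E B') \<le> card (anc E v - ancs E B)"
    using assms ancs_mono[OF assms(2), of E] by (intro card_mono) auto
  moreover have "card (induced E (anc E v - ancs E B')) \<le> card (induced E (anc E v - ancs E B))"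
    using assms ancs_mono[OF assms(2), of E] by (intro card_mono) (auto simp: induced_def)
  ultimately show ?thesis using assms(3) unfolding shrunk_def by linarith
qed

lemma induced_Diff_subset: "induced E (anc E v - ancs E B) \<subseteq> anc_edges E v - ancs_edges E B"
  by (auto simp: induced_def anc_edges_def ancs_edges_def)

lemma stale_imp_shrunk:
  assumes "finite E" "\<gamma> \<ge> 0" "\<not> fresh \<gamma> E B v"
  shows "shrunk \<gamma> E B v"
proof -
  have "card (induced E (anc E v - ancs E B)) \<le> card (anc_edges E v - ancs_edges E B)"
    by (intro card_mono induced_Diff_subset finite_Diff finite_anc_edges assms)
  moreover have "\<gamma> * real k \<le> 4 * \<gamma> * real k" for k using assms(2) by (simp add: mult_right_mono)
  ultimately show ?thesis
    using assms(3) unfolding fresh_def shrunk_def by (smt (verit) of_nat_le_iff)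
qed

lemma member_shrunk:
  assumes "\<gamma> \<ge> 0" "v \<in> B"
  shows "shrunk \<gamma> E B v"
proof -
  have "anc E v - ancs E B = {}" using assms by (auto simp: ancs_def)
  then have "card (anc E v - ancs E B) = 0" by (simp only: card.empty)
  then show ?thesis using assms(1) by (simp add: shrunk_def)
qed

text \<open>Together with \<open>shrunk_mono\<close>: while the batch grows, vertices only change
  from fresh to stale and from not shrunk to shrunk. Facts about one bucket therefore survive the
  processing of the others.\<close>

lemma fresh_antimono:
  assumes "finite E" "B \<subseteq> B'" "fresh \<gamma> E B' v"
  shows "fresh \<gamma> E B v"
proof -
  have "card (anc E v - ancs E B') \<le> card (anc E v - ancs E B)"
    using assms ancs_mono[OF assms(2), of E] by (intro card_mono) auto
  moreover have "card (anc_edges E v - ancs_edges E B') \<le> card (anc_edges E v - ancs_edges E B)"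
    using assms ancs_edges_mono[OF assms(2), of E] by (intro card_mono) auto
  ultimately show ?thesis using assms(3) unfolding fresh_def by linarith
qed

text \<open>Freshness of an element refers to the batch at the time of its insertion, so the order
  of the list is part of the certificate.\<close>

inductive fresh_seq :: "'a set \<Rightarrow> real \<Rightarrow> ('a \<times> 'a) set \<Rightarrow> 'a list \<Rightarrow> bool" for V \<gamma> E where
  Nil: "fresh_seq V \<gamma> E []"
| snoc: "fresh_seq V \<gamma> E B \<Longrightarrow> v \<in> V \<Longrightarrow> fresh \<gamma> E (set B) v \<Longrightarrow> fresh_seq V \<gamma> E (B @ [v])"

lemma fresh_seq_subset: "fresh_seq V \<gamma> E B \<Longrightarrow> set B \<subseteq> V"
  by (induction rule: fresh_seq.induct) auto

lemma fresh_seq_distinct: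
  assumes "\<gamma> \<ge> 0"
  shows "fresh_seq V \<gamma> E B \<Longrightarrow> distinct B"
proof (induction rule: fresh_seq.induct)
  case (snoc B v)
  have "v \<notin> set B"
  proof
    assume "v \<in> set B"
    then have "anc E v - ancs E (set B) = {}" by (auto simp: ancs_def)
    then have "card (anc E v - ancs E (set B)) = 0" by (simp only: card.empty)
    moreover have "0 \<le> \<gamma> * real (card (anc E v))" using assms by simp
    ultimately show False using snoc by (simp add: fresh_def)
  qed
  then show ?case using snoc by simp
qed simp

text \<open>The parts by which successive cones enlarge the union are disjoint, and each is at least
  a fraction \<gamma> of its cone; so they can be added up.\<close>

lemma fresh_seq_cone_sizes:
  assumes E: "finite E"
  shows "fresh_seq V \<gamma> E B \<Longrightarrow>
    \<gamma> * real (\<Sum>v\<leftarrow>B. card (anc E v)) \<le> real (card (ancs E (set B))) \<and>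
    \<gamma> * real (\<Sum>v\<leftarrow>B. card (anc_edges E v)) \<le> real (card (ancs_edges E (set B)))"
proof (induction rule: fresh_seq.induct)
  case (snoc B v)
  let ?A = "ancs E (set B)" and ?F = "ancs_edges E (set B)"
  have finA: "finite ?A" using E by (auto simp: ancs_def)
  have finF: "finite ?F" using E by (auto simp: ancs_edges_def induced_def)
  have "ancs E (set (B @ [v])) = ?A \<union> (anc E v - ?A)" by (auto simp: ancs_def)
  then have 1: "card (ancs E (set (B @ [v]))) = card ?A + card (anc E v - ?A)"
    using E finA by (subst card_Un_disjoint[symmetric]) auto
  have "?F \<union> (anc_edges E v - ?F) \<subseteq> ancs_edges E (set (B @ [v]))"
    using ancs_edges_mono[of "set B" "set (B @ [v])" E] anc_edges_subset_ancs_edges[of v "set (B @ [v])" E]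
    by auto
  then have "card (?F \<union> (anc_edges E v - ?F)) \<le> card (ancs_edges E (set (B @ [v])))"
    using E by (intro card_mono) (auto simp: ancs_edges_def induced_def)
  then have 2: "card ?F + card (anc_edges E v - ?F) \<le> card (ancs_edges E (set (B @ [v])))"
    using E finF by (subst card_Un_disjoint[symmetric]) auto
  have "\<gamma> * real (card (anc_edges E v)) \<le> real (card (anc_edges E v - ?F))"
    using snoc.hyps(3) by (cases "anc_edges E v = {}") (auto simp: fresh_def)
  moreover have "\<gamma> * real (card (anc E v)) \<le> real (card (anc E v - ?A))"
    using snoc.hyps(3) by (auto simp: fresh_def)
  ultimately show ?case using snoc.IH 1 2 by (simp add: distrib_left)
qed simp

section \<open>FindBatch\<close>

text \<open>
  Time charged to a batch: a fresh vertex pays for itself and for the at most \<open>N\<close> stale vertices of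
  its bucket sampled just before it, whose cones are larger by at most a constant factor.
\<close>

definition fresh_charge :: "nat \<Rightarrow> ('a \<times> 'a) set \<Rightarrow> 'a list \<Rightarrow> nat" where
  "fresh_charge N E B = (\<Sum>v\<leftarrow>B. (1 + 14 * N) * (1 + cone_size E v))"

definition bucket_sized :: "('a \<times> 'a) set \<Rightarrow> nat \<Rightarrow> 'a set \<Rightarrow> bool" where
  "bucket_sized E i X \<longleftrightarrow> (\<forall>v\<in>X. 1 + cone_size E v \<le> 7 * 2 ^ i \<and> 2 ^ i \<le> 2 * cone_size E v)"

text \<open>The last conjunct is an amortised account: \<open>s * (7 * 2 ^ i)\<close> is the cost of
  the current run of stale samples, which no fresh vertex has paid for yet, and the additional 1 is
  the step for entering the loop.\<close>

definition drained ::
  "'a set \<Rightarrow> nat \<Rightarrow> real \<Rightarrow> ('a \<times> 'a) set \<Rightarrow> nat \<Rightarrow> 'a batch_state \<Rightarrow> nat \<times> 'a batch_state \<Rightarrow> bool" where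
  "drained V N \<gamma> E i st0 st = (case st0 of (B0, K0, \<tau>0) \<Rightarrow> case st of (s, B, K, \<tau>) \<Rightarrow>
     s \<le> N \<and> fresh_seq V \<gamma> E B \<and> set B0 \<subseteq> set B \<and> (\<forall>j. j \<noteq> i \<longrightarrow> K j = K0 j) \<and> K i \<subseteq> K0 i \<and>
     (\<forall>v \<in> K0 i - K i. shrunk \<gamma> E (set B) v) \<and>
     \<tau> + fresh_charge N E B0 \<le> \<tau>0 + 1 + fresh_charge N E B + s * (7 * 2 ^ i))"

lemma drained_step:
  assumes dr: "drained V N \<gamma> E i st0 (s, B, K, \<tau>)" and v: "v \<in> K i" and s: "s < N"
    and E: "finite E" and \<gamma>: "\<gamma> \<ge> 0" and K0: "bucket_sized E i (fst (snd st0) i)" "fst (snd st0) i \<subseteq> V"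
  shows "drained V N \<gamma> E i st0
    (if fresh \<gamma> E (set B) v
     then (0, B @ [v], K(i := K i - {v}), \<tau> + 1 + card (anc E v) + card (anc_edges E v))
     else (s + 1, B, K(i := K i - {v}), \<tau> + 1 + card (anc E v) + card (anc_edges E v)))"
proof -
  obtain B0 K0 \<tau>0 where st0: "st0 = (B0, K0, \<tau>0)" by (cases st0)
  have vV: "v \<in> V" "v \<in> K0 i" using dr v K0 by (auto simp: drained_def st0)
  have sz: "1 + cone_size E v \<le> 7 * 2 ^ i" "2 ^ i \<le> 2 * cone_size E v"
    using K0 vV by (auto simp: bucket_sized_def st0)
  show ?thesis
  proof (cases "fresh \<gamma> E (set B) v")
    case True
    \<comment> \<open>A stale sample costs at most \<open>7 * 2 ^ i\<close>, and
      \<open>2 ^ i\<close> is at most twice the cone of any vertex of the bucket. This is the 14 in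
      \<open>fresh_charge\<close>, with which the fresh \<open>v\<close> pays off the run before
      it.\<close>
    have "s * (7 * 2 ^ i) \<le> N * (7 * (2 * cone_size E v))"
      using sz(2) s by (intro mult_mono) auto
    then have t: "s * (7 * 2 ^ i) + 1 + cone_size E v \<le> (1 + 14 * N) * (1 + cone_size E v)"
      by (simp add: algebra_simps)
    have "shrunk \<gamma> E (set (B @ [v])) w" if "w \<in> K0 i - (K i - {v})" for w
    proof (cases "w = v")
      case False
      then have "shrunk \<gamma> E (set B) w" using that dr by (auto simp: drained_def st0)
      then show ?thesis by (rule shrunk_mono[OF E, rotated]) auto
    qed (auto intro: member_shrunk[OF \<gamma>])
    then show ?thesis
      using True dr t vV s by (auto simp: drained_def st0 fresh_charge_def cone_size_def intro!: fresh_seq.snoc)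
  next
    case False
    have "shrunk \<gamma> E (set B) v" using stale_imp_shrunk[OF E \<gamma> False] .
    then show ?thesis
      using False dr sz(1) s by (auto simp: drained_def st0 cone_size_def)
  qed
qed

definition drain_body where
  "drain_body \<gamma> E i = (\<lambda>(s::nat, B, K :: nat \<Rightarrow> 'a set, \<tau>::nat). do {
          v \<leftarrow> spmf_of_set (K i);
          let K' = K(i := K i - {v});
          let \<tau>' = \<tau> + 1 + card (anc E v) + card (anc_edges E v);
          return_spmf
            (if fresh \<gamma> E (set B) v then (0, B @ [v], K', \<tau>') else (s + 1, B, K', \<tau>'))
        })"

text \<open>
  As long as at least half of the original bucket is fresh, each sample is stale with probability at
  most 1/2, so that \<open>N\<close> consecutive stale samples are unlikely.
\<close>

lemma whp_drain_loop:
  fixes V :: "'a set"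
  assumes E: "finite E" and \<gamma>: "\<gamma> \<ge> 0" and K0: "bucket_sized E i (fst (snd st0) i)" "fst (snd st0) i \<subseteq> V"
    and fin: "finite V"
    and dr: "drained V N \<gamma> E i st0 st"
  shows "whp (case st of (s, B, K, \<tau>) \<Rightarrow>
       if 2 * card {v \<in> K i. fresh \<gamma> E (set B) v} \<le> card (fst (snd st0) i) then 0
       else (1/2) ^ (N - s) + real (card (K i)) * (1/2) ^ N)
    (while_spmf (\<lambda>(s, B, K, \<tau>). s < N \<and> K i \<noteq> {}) (drain_body \<gamma> E i) st)
    (\<lambda>(s, B, K, \<tau>). drained V N \<gamma> E i st0 (s, B, K, \<tau>) \<and>
       2 * card {v \<in> K i. fresh \<gamma> E (set B) v} \<le> card (fst (snd st0) i))"
  using dr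
proof (induction "card (fst (snd (snd st)) i)" arbitrary: st rule: less_induct)
  case less
  obtain s B K \<tau> where st: "st = (s, B, K, \<tau>)" by (cases st)
  let ?m = "card (fst (snd st0) i)"
  let ?F = "\<lambda>B K. {v \<in> K i. fresh \<gamma> E (set B) v}"
  \<comment> \<open>A potential for the failure probability: the current run of stale samples
    reaches length \<open>N\<close> with probability at most \<open>(1/2) ^ (N - s)\<close>, and
    every later run with probability at most \<open>(1/2) ^ N\<close>. Each later run starts after a
    fresh sample, so there are at most \<open>card (K i)\<close> of them. Once at most half of the
    original bucket is fresh, failure is impossible.\<close>
  define bnd where "bnd = (\<lambda>st :: nat \<times> 'a batch_state. case st of (s, B, K, \<tau>) \<Rightarrow> if 2 * card (?F B K) \<le> ?m then 0
       else (1/2) ^ (N - s) + real (card (K i)) * (1/2 :: real) ^ N)"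
  let ?G = "\<lambda>(s, B, K, \<tau>). s < N \<and> K i \<noteq> {}"
  let ?W = "while_spmf ?G (drain_body \<gamma> E i)"
  let ?R = "\<lambda>(s, B, K, \<tau>). drained V N \<gamma> E i st0 (s, B, K, \<tau>) \<and> 2 * card (?F B K) \<le> ?m"
  have dr: "drained V N \<gamma> E i st0 (s, B, K, \<tau>)" using less.prems st by simp
  then have Ksub: "K i \<subseteq> fst (snd st0) i" and sN: "s \<le> N" by (auto simp: drained_def split: prod.splits)
  have finK: "finite (K i)" using finite_subset[OF order_trans[OF Ksub K0(2)] fin] .
  have finK0: "finite (fst (snd st0) i)" using finite_subset[OF K0(2) fin] .
  have bnd_nonneg: "bnd st \<ge> 0" for st by (cases st) (auto simp: bnd_def)
  have "whp (bnd st) (?W st) ?R"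
  proof (cases "s < N \<and> K i \<noteq> {}")
    case False
    then have W: "?W st = return_spmf st" by (subst while_spmf.simps) (auto simp: st)
    show ?thesis
    proof (cases "2 * card (?F B K) \<le> ?m")
      case True
      then show ?thesis unfolding W using bnd_nonneg[of st] dr by (intro whp_return) (auto simp: st)
    next
      case F: False
      then have "K i \<noteq> {}" by (intro notI) simp
      \<comment> \<open>The loop has given up although too many vertices are fresh. The potential is
        then at least 1 and nothing is claimed.\<close>
      then have "s = N" using False sN by auto
      then have "bnd st \<ge> 1" using F by (simp add: bnd_def st)
      then show ?thesis by (rule whp_ge_1)
    qed
  next
    case True
    define next' where "next' = (\<lambda>v. let K' = K(i := K i - {v}); \<tau>' = \<tau> + 1 + card (anc E v) + card (anc_edges E v)
      in (if fresh \<gamma> E (set B) v then (0, B @ [v], K', \<tau>') else (s + 1, B, K', \<tau>')))"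
    have W: "?W st = spmf_of_set (K i) \<bind> (\<lambda>v. ?W (next' v))"
      using True by (subst while_spmf.simps) (simp add: st drain_body_def next'_def Let_def)
    have IH: "whp (bnd (next' v)) (?W (next' v)) ?R" if v: "v \<in> K i" for v
      unfolding bnd_def
    proof (rule less.hyps)
      show "card (fst (snd (snd (next' v))) i) < card (fst (snd (snd st)) i)"
        using v finK card_Diff1_less[OF finK v] by (simp add: next'_def Let_def st)
      show "drained V N \<gamma> E i st0 (next' v)"
        using drained_step[OF dr v conjunct1[OF True] E \<gamma> K0] by (simp only: next'_def Let_def)
    qed
    have Fmono: "card (?F (fst (snd (next' v))) (fst (snd (snd (next' v))))) \<le> card (?F B K)" for v
    proof (rule card_mono)
      show "?F (fst (snd (next' v))) (fst (snd (snd (next' v)))) \<subseteq> ?F B K"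
        using fresh_antimono[OF E, of "set B" "insert v (set B)" \<gamma>] by (auto simp: next'_def Let_def)
    qed (use finK in auto)
    show ?thesis
    proof (cases "2 * card (?F B K) \<le> ?m")
      case True
      have "bnd (next' v) = 0" for v
        using Fmono[of v] True by (auto simp: bnd_def split: prod.splits)
      then have "whp 0 (?W (next' v)) ?R" if "v \<in> K i" for v using IH[OF that] by simp
      then have "whp 0 (?W st) ?R"
        unfolding W using finK \<open>s < N \<and> K i \<noteq> {}\<close>
        by (intro whp_sample[where F="K i" and \<alpha>=0 and \<beta>=0]) auto
      then show ?thesis using bnd_nonneg[of st] by (auto elim: whp_mono)
    next
      case F: False
      let ?k = "card (K i)"
      have kpos: "?k > 0" using True finK by (simp add: card_gt_0_iff)
      define x y where "x = (1/2 :: real) ^ N" and "y = (1/2 :: real) ^ (N - s)"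
      have xy: "x \<ge> 0" "y \<ge> 0" by (auto simp: x_def y_def)
      have ck: "card (K i - {v}) = ?k - 1" if "v \<in> K i" for v using that finK by simp
      have 1: "whp (?k * x) (?W (next' v)) ?R" if v: "v \<in> ?F B K" for v
        by (rule whp_mono[OF IH])
          (use v xy kpos ck in \<open>auto simp: bnd_def next'_def Let_def x_def[symmetric] of_nat_diff algebra_simps\<close>)
      have 2: "whp (2 * y + (real ?k - 1) * x) (?W (next' v)) ?R" if v: "v \<in> K i - ?F B K" for v
      proof (rule whp_mono[OF IH])
        have "(1/2 :: real) ^ (N - Suc s) = 2 * y"
        proof -
          have "N - s = Suc (N - Suc s)" using Suc_diff_Suc[of s N] True by simp
          then show ?thesis by (simp add: y_def)
        qed
        then show "bnd (next' v) \<le> 2 * y + (real ?k - 1) * x"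
          using v xy kpos ck by (auto simp: bnd_def next'_def Let_def x_def[symmetric] of_nat_diff)
      qed (use v in auto)
      have "whp (y + ?k * x) (?W st) ?R"
        unfolding W
      proof (rule whp_sample[OF finK _ _ 1 2])
        have c: "real (card (K i - ?F B K)) = real ?k - real (card (?F B K))"
          using finK by (subst card_Diff_subset) (auto intro!: of_nat_diff card_mono)
        have k0: "?k \<le> ?m" using Ksub finK0 by (rule card_mono[rotated])
        \<comment> \<open>More than half of the original bucket is fresh, and all fresh vertices
          counted are still in the current, possibly smaller one; so the next sample is fresh with
          probability at least 1/2.\<close>
        have f: "real ?k \<le> 2 * real (card (?F B K))" using F k0 by linarith
        have fk: "real (card (?F B K)) \<le> real ?k" using finK by (simp add: card_mono)
        let ?f = "real (card (?F B K))"
        have "real ?k * x * ?f + (2 * y + (real ?k - 1) * x) * (real ?k - ?f)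
           = (2 * (real ?k - ?f)) * y + (real ?k * real ?k) * x - (real ?k - ?f) * x"
          by (simp add: algebra_simps)
        also have "\<dots> \<le> real ?k * y + (real ?k * real ?k) * x - 0"
          using xy f fk by (intro diff_mono add_mono mult_right_mono) auto
        finally show "real ?k * x * ?f + (2 * y + (real ?k - 1) * x) * real (card (K i - ?F B K))
            \<le> (y + real ?k * x) * real ?k"
          unfolding c by (simp add: algebra_simps)
      qed (use True in auto)
      then show ?thesis using F by (simp add: bnd_def st x_def y_def)
    qed
  qed
  then show ?case by (simp add: bnd_def)
qed

text \<open>\<open>I\<close> is the set of the drained buckets, \<open>c\<close> the time that is not charged to fresh vertices.\<close>

definition swept ::
  "'a set \<Rightarrow> nat \<Rightarrow> real \<Rightarrow> ('a \<times> 'a) set \<Rightarrow> nat set \<Rightarrow> nat \<Rightarrow> 'a batch_state \<Rightarrow> 'a batch_state \<Rightarrow> bool" where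
  "swept V N \<gamma> E I c st0 st = (case st0 of (B0, K0, \<tau>0) \<Rightarrow> case st of (B, K, \<tau>) \<Rightarrow>
     fresh_seq V \<gamma> E B \<and> set B0 \<subseteq> set B \<and> (\<forall>j. K j \<subseteq> K0 j) \<and>
     (\<forall>j. \<forall>v \<in> K0 j - K j. shrunk \<gamma> E (set B) v) \<and>
     (\<forall>j\<in>I. 2 * card {v \<in> K j. fresh \<gamma> E (set B) v} \<le> card (K0 j)) \<and>
     \<tau> + fresh_charge N E B0 \<le> \<tau>0 + c + fresh_charge N E B)"

lemma sweptD:
  assumes "swept V N \<gamma> E I c (B0, K0, \<tau>0) (B, K, \<tau>)"
  shows "fresh_seq V \<gamma> E B" "set B0 \<subseteq> set B" "\<And>j. K j \<subseteq> K0 j"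
    "\<And>j v. v \<in> K0 j \<Longrightarrow> v \<notin> K j \<Longrightarrow> shrunk \<gamma> E (set B) v"
    "\<And>j. j \<in> I \<Longrightarrow> 2 * card {v \<in> K j. fresh \<gamma> E (set B) v} \<le> card (K0 j)"
    "\<tau> + fresh_charge N E B0 \<le> \<tau>0 + c + fresh_charge N E B"
  using assms by (auto simp: swept_def)

text \<open>The halving of the buckets in \<open>I\<close> survives the second phase, as buckets
  only lose elements and freshness is only lost; shrunk vertices stay shrunk.\<close>

lemma swept_trans:
  assumes E: "finite E" and V: "finite V" "\<And>j. K0 j \<subseteq> V"
    and 1: "swept V N \<gamma> E I c (B0, K0, \<tau>0) (B1, K1, \<tau>1)"
    and 2: "swept V N \<gamma> E I' c' (B1, K1, \<tau>1) (B2, K2, \<tau>2)"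
  shows "swept V N \<gamma> E (I \<union> I') (c + c') (B0, K0, \<tau>0) (B2, K2, \<tau>2)"
proof -
  have fin0: "finite (K0 j)" for j by (rule finite_subset[OF V(2) V(1)])
  have fin1: "finite (K1 j)" for j by (rule finite_subset[OF sweptD(3)[OF 1] fin0])
  have "2 * card {v \<in> K2 j. fresh \<gamma> E (set B2) v} \<le> card (K0 j)" if "j \<in> I \<union> I'" for j
  proof (cases "j \<in> I'")
    case True
    then have "2 * card {v \<in> K2 j. fresh \<gamma> E (set B2) v} \<le> card (K1 j)" using sweptD(5)[OF 2] by simp
    also have "\<dots> \<le> card (K0 j)" using fin0 sweptD(3)[OF 1] by (rule card_mono)
    finally show ?thesis .
  next
    case False
    have "{v \<in> K2 j. fresh \<gamma> E (set B2) v} \<subseteq> {v \<in> K1 j. fresh \<gamma> E (set B1) v}"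
      using sweptD(3)[OF 2] fresh_antimono[OF E sweptD(2)[OF 2]] by auto
    then have "card {v \<in> K2 j. fresh \<gamma> E (set B2) v} \<le> card {v \<in> K1 j. fresh \<gamma> E (set B1) v}"
      using fin1 by (intro card_mono) auto
    also have "2 * \<dots> \<le> card (K0 j)" using sweptD(5)[OF 1] False that by simp
    finally show ?thesis by simp
  qed
  moreover have "shrunk \<gamma> E (set B2) v" if "v \<in> K0 j" "v \<notin> K2 j" for j v
  proof (cases "v \<in> K1 j")
    case True
    then show ?thesis using sweptD(4)[OF 2] that by blast
  next
    case False
    then show ?thesis using shrunk_mono[OF E sweptD(2)[OF 2] sweptD(4)[OF 1 that(1)]] by blast
  qed
  moreover have "K2 j \<subseteq> K0 j" for j using sweptD(3)[OF 1, of j] sweptD(3)[OF 2, of j] by simp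
  ultimately show ?thesis
    using sweptD(2,6)[OF 1] sweptD(1,2,6)[OF 2] by (auto simp: swept_def)
qed

lemma drain_bucket_altdef:
  "drain_bucket N \<gamma> E i (B, K, \<tau>) = map_spmf snd (while_spmf (\<lambda>(s, B, K, \<tau>). s < N \<and> K i \<noteq> {})
     (drain_body \<gamma> E i) (0, B, K, \<tau> + 1))"
  by (simp add: drain_bucket_def drain_body_def)

text \<open>The failure bound is the potential of the loop at \<open>s = 0\<close>. The final run of
  at most \<open>N\<close> stale samples is followed by no fresh vertex that could pay for it,
  whence the additive term \<open>N * (7 * 2 ^ i)\<close>.\<close>

lemma whp_drain_bucket:
  fixes V :: "'a set"
  assumes E: "finite E" and \<gamma>: "\<gamma> \<ge> 0" and V: "finite V" "\<And>j. K j \<subseteq> V" and sz: "bucket_sized E i (K i)"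
    and fr: "fresh_seq V \<gamma> E B"
  shows "whp ((real (card V) + 1) * (1/2) ^ N) (drain_bucket N \<gamma> E i (B, K, \<tau>))
     (swept V N \<gamma> E {i} (1 + N * (7 * 2 ^ i)) (B, K, \<tau>))"
proof -
  have dr: "drained V N \<gamma> E i (B, K, \<tau>) (0, B, K, \<tau> + 1)"
    using fr by (simp add: drained_def)
  have sz': "bucket_sized E i (fst (snd (B, K, \<tau>)) i)" "fst (snd (B, K, \<tau>)) i \<subseteq> V" using sz V by simp_all
  have cK: "card (K i) \<le> card V" using V(1) V(2) by (rule card_mono)
  show ?thesis
    unfolding drain_bucket_altdef
  proof (rule whp_map, rule whp_mono[OF whp_drain_loop[OF E \<gamma> sz' V(1) dr]], goal_cases)
    case 1
    show ?case using cK by (auto simp: algebra_simps mult_left_mono)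
  next
    case (2 x)
    obtain s' B' K' \<tau>' where x: "x = (s', B', K', \<tau>')" by (cases x)
    have h: "drained V N \<gamma> E i (B, K, \<tau>) (s', B', K', \<tau>')"
      "2 * card {v \<in> K' i. fresh \<gamma> E (set B') v} \<le> card (K i)" using 2(2) by (simp_all add: x)
    have "s' * (7 * 2 ^ i) \<le> N * (7 * 2 ^ i)" using h(1) by (intro mult_right_mono) (auto simp: drained_def)
    then have "\<tau>' + fresh_charge N E B \<le> \<tau> + (1 + N * (7 * 2 ^ i)) + fresh_charge N E B'"
      using h(1) unfolding drained_def prod.case by linarith
    moreover have "K' j \<subseteq> K j" for j using h(1) by (cases "j = i") (auto simp: drained_def)
    moreover have "shrunk \<gamma> E (set B') v" if "v \<in> K j - K' j" for j v
      using h(1) that by (cases "j = i") (auto simp: drained_def)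
    ultimately show ?case
      using h by (simp add: swept_def drained_def x)
  qed
qed

lemma bucket_sized_mono: "X \<subseteq> Y \<Longrightarrow> bucket_sized E i Y \<Longrightarrow> bucket_sized E i X"
  by (auto simp: bucket_sized_def)

text \<open>The costs not charged to fresh vertices form a geometric series: the sum of
  \<open>7 * N * 2 ^ i\<close> over the buckets is dominated by \<open>14 * N * 2 ^ k\<close>, so
  there is no extra factor for the number of buckets.\<close>

lemma whp_sweep_buckets:
  fixes V :: "'a set"
  assumes E: "finite E" and \<gamma>: "\<gamma> \<ge> 0" and V: "finite V"
  shows "(\<And>j. K j \<subseteq> V) \<Longrightarrow> (\<And>i. i \<in> {1..k} \<Longrightarrow> bucket_sized E i (K i)) \<Longrightarrow> fresh_seq V \<gamma> E B \<Longrightarrow>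
    whp (real k * ((real (card V) + 1) * (1/2) ^ N)) (sweep_buckets N \<gamma> E k (B, K, \<tau>))
     (swept V N \<gamma> E {1..k} (k + 14 * N * 2 ^ k) (B, K, \<tau>))"
proof (induction k arbitrary: B K \<tau>)
  case 0
  then show ?case by (auto intro!: whp_return simp: swept_def)
next
  case (Suc k)
  define q where "q = (real (card V) + 1) * (1/2) ^ N"
  have q: "q \<ge> 0" by (simp add: q_def)
  have "whp (q + real k * q) (drain_bucket N \<gamma> E (Suc k) (B, K, \<tau>) \<bind> sweep_buckets N \<gamma> E k)
     (swept V N \<gamma> E {1..Suc k} (Suc k + 14 * N * 2 ^ Suc k) (B, K, \<tau>))"
  proof (rule whp_bind)
    show "whp q (drain_bucket N \<gamma> E (Suc k) (B, K, \<tau>))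
       (swept V N \<gamma> E {Suc k} (1 + N * (7 * 2 ^ Suc k)) (B, K, \<tau>))"
      unfolding q_def using Suc.prems by (intro whp_drain_bucket[OF E \<gamma> V]) auto
    fix st1 assume s1: "swept V N \<gamma> E {Suc k} (1 + N * (7 * 2 ^ Suc k)) (B, K, \<tau>) st1"
    obtain B1 K1 \<tau>1 where st1: "st1 = (B1, K1, \<tau>1)" by (cases st1)
    note sw = s1[unfolded st1]
    have "whp (real k * q) (sweep_buckets N \<gamma> E k st1) (swept V N \<gamma> E {1..k} (k + 14 * N * 2 ^ k) st1)"
      unfolding st1 q_def
    proof (rule Suc.IH)
      show "K1 j \<subseteq> V" for j using sweptD(3)[OF sw, of j] Suc.prems(1)[of j] by simp
      show "bucket_sized E i (K1 i)" if "i \<in> {1..k}" for i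
        using bucket_sized_mono[OF sweptD(3)[OF sw, of i]] Suc.prems(2)[of i] that by simp
    qed (rule sweptD(1)[OF sw])
    then show "whp (real k * q) (sweep_buckets N \<gamma> E k st1)
        (swept V N \<gamma> E {1..Suc k} (Suc k + 14 * N * 2 ^ Suc k) (B, K, \<tau>))"
    proof (rule whp_mono)
      fix st2 assume s2: "swept V N \<gamma> E {1..k} (k + 14 * N * 2 ^ k) st1 st2"
      obtain B2 K2 \<tau>2 where st2: "st2 = (B2, K2, \<tau>2)" by (cases st2)
      have "swept V N \<gamma> E ({Suc k} \<union> {1..k}) (1 + N * (7 * 2 ^ Suc k) + (k + 14 * N * 2 ^ k)) (B, K, \<tau>) st2"
        unfolding st2 by (rule swept_trans[OF E V Suc.prems(1) sw s2[unfolded st1 st2]])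
      moreover have "{Suc k} \<union> {1..k} = {1..Suc k}" by auto
      ultimately show "swept V N \<gamma> E {1..Suc k} (Suc k + 14 * N * 2 ^ Suc k) (B, K, \<tau>) st2"
        by (simp add: algebra_simps)
    qed simp
  qed (use q in simp)
  then show ?case by (simp add: q_def algebra_simps)
qed

lemma approx_ratio:
  assumes "approx x k" "approx x' k'" "k > 0"
  shows "real k' \<le> \<gamma> * real k \<Longrightarrow> x' / x \<le> 2 * \<gamma>"
    and "x' / x \<le> 2 * \<gamma> \<Longrightarrow> real k' \<le> 4 * \<gamma> * real k"
proof -
  have x: "x > 0" "2/3 * real k \<le> x" "x \<le> 4/3 * real k" using assms(1,3) by (auto simp: approx_def)
  have x': "2/3 * real k' \<le> x'" "x' \<le> 4/3 * real k'" using assms(2) by (auto simp: approx_def)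
  {
    assume le: "real k' \<le> \<gamma> * real k"
    then have "0 \<le> \<gamma> * real k" by (rule order_trans[rotated]) simp
    then have "\<gamma> \<ge> 0" using assms(3) by (simp add: zero_le_mult_iff)
    have "x' \<le> 4/3 * (\<gamma> * real k)" using x' le by simp
    also have "\<dots> = 2 * \<gamma> * (2/3 * real k)" by simp
    also have "\<dots> \<le> 2 * \<gamma> * x" using x \<open>\<gamma> \<ge> 0\<close> by (intro mult_left_mono) auto
    finally show "x' / x \<le> 2 * \<gamma>" using x by (simp add: field_simps)
  }
  {
    assume "x' / x \<le> 2 * \<gamma>"
    then have le: "x' \<le> 2 * \<gamma> * x" using x by (simp add: field_simps)
    have "0 \<le> x'" by (rule order_trans[OF _ x'(1)]) simp
    then have "0 \<le> 2 * \<gamma> * x" using le by linarith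
    then have "\<gamma> \<ge> 0" using x by (simp add: zero_le_mult_iff)
    have "2/3 * real k' \<le> 2 * \<gamma> * x" using x' le by linarith
    also have "\<dots> \<le> 2 * \<gamma> * (4/3 * real k)" using x \<open>\<gamma> \<ge> 0\<close> by (intro mult_left_mono) auto
    finally show "real k' \<le> 4 * \<gamma> * real k" by simp
  }
qed

lemma sketch_time_mono: "s \<le> s' \<Longrightarrow> sketch_time L s \<le> sketch_time L s'"
  by (simp add: sketch_time_def)

text \<open>Two calls of \<open>estimates\<close>, each failing with probability at most
  \<open>2 * card V * (11/16) ^ L\<close>. A vertex whose true ratios lie between \<gamma> and
  \<open>4 * \<gamma>\<close> may be kept or removed; either outcome is consistent with the claim,
  as kept vertices need only be fresh and removed ones only shrunk.\<close>

lemma whp_prune: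
  fixes V :: "'a set"
  assumes V: "finite V" "E \<subseteq> V \<times> V" "acyclic E" and \<gamma>: "\<gamma> \<ge> 0" and L: "L \<ge> 1" and K: "\<And>j. K j \<subseteq> V"
  shows "whp (4 * real (card V) * (11/16) ^ L) (prune L \<gamma> V E (B, K, \<tau>))
    (\<lambda>(B', K', \<tau>'). B' = B \<and> (\<forall>j. K' j \<subseteq> K j) \<and> (\<forall>j. \<forall>v\<in>K' j. fresh \<gamma> E (set B) v) \<and>
       (\<forall>j. \<forall>v\<in>K j - K' j. shrunk \<gamma> E (set B) v) \<and>
       \<tau>' \<le> \<tau> + 2 * sketch_time L (card V + card E) + card V + card E)"
proof -
  define A where "A = ancs E (set B)"
  define V' where "V' = V - A"
  define E' where "E' = induced E V'"
  have finE: "finite E" using V finite_subset[OF V(2)] by simp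
  have V': "finite V'" "E' \<subseteq> V' \<times> V'" "acyclic E'" "card V' \<le> card V" "card E' \<le> card E"
    using V finE by (auto simp: V'_def E'_def induced_def intro: acyclic_subset card_mono)
  define q where "q = 2 * real (card V) * (11/16 :: real) ^ L"
  have 1: "whp q (estimates L V E) (good_estimates V E)"
    unfolding q_def by (rule whp_estimates[OF V L])
  have 2: "whp q (estimates L V' E') (good_estimates V' E')"
    by (rule whp_mono[OF whp_estimates[OF V'(1-3) L]]) (use V'(4) in \<open>auto simp: q_def\<close>)
  let ?R = "\<lambda>(B', K', \<tau>'). B' = B \<and> (\<forall>j. K' j \<subseteq> K j) \<and> (\<forall>j. \<forall>v\<in>K' j. fresh \<gamma> E (set B) v) \<and>
       (\<forall>j. \<forall>v\<in>K j - K' j. shrunk \<gamma> E (set B) v) \<and>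
       \<tau>' \<le> \<tau> + 2 * sketch_time L (card V + card E) + card V + card E"
  have "whp (q + (q + 0)) (prune L \<gamma> V E (B, K, \<tau>)) ?R"
    unfolding prune_def prod.case Let_def A_def[symmetric] V'_def[symmetric] E'_def[symmetric]
  proof (rule whp_bind[OF 1])
    fix ae assume g: "good_estimates V E ae"
    obtain a e where ae: "ae = (a, e)" by (cases ae)
    show "whp (q + 0) (case ae of (a, e) \<Rightarrow> do {
            (a', e') \<leftarrow> estimates L V' E';
            return_spmf (B, \<lambda>i. {v \<in> K i. \<not> (a' v / a v \<le> 2 * \<gamma> \<or> e v \<noteq> 0 \<and> e' v / e v \<le> 2 * \<gamma>)},
              \<tau> + sketch_time L (card V + card E) + sketch_time L (card V' + card E') + card V + card E)}) ?R"
      unfolding ae prod.case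
    proof (rule whp_bind[OF 2])
      fix ae' assume g': "good_estimates V' E' ae'"
      obtain a' e' where ae': "ae' = (a', e')" by (cases ae')
      let ?out = "\<lambda>v. a' v / a v \<le> 2 * \<gamma> \<or> e v \<noteq> 0 \<and> e' v / e v \<le> 2 * \<gamma>"
      have main: "(\<not> ?out v \<longrightarrow> fresh \<gamma> E (set B) v) \<and> (?out v \<longrightarrow> shrunk \<gamma> E (set B) v)" if v: "v \<in> V" for v
      proof -
        have a: "approx (a v) (card (anc E v))" "approx (e v) (card (anc_edges E v))"
          using g[unfolded good_estimates_def, rule_format, of v] v by (simp_all add: ae)
        have cpos: "card (anc E v) > 0" using finE self_in_anc[of v E] by (auto simp: card_gt_0_iff simp del: self_in_anc)
        show ?thesis
        proof (cases "v \<in> A")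
          case True
          then obtain w where w: "w \<in> set B" "v \<in> anc E w" by (auto simp: A_def ancs_def)
          then have "anc E v - A = {}" using anc_trans[of _ E v w] by (auto simp: A_def ancs_def)
          then have "card (anc E v - A) = 0" by (simp only: card.empty)
          then have sh: "shrunk \<gamma> E (set B) v" using \<gamma> by (simp add: shrunk_def A_def[symmetric])
          \<comment> \<open>An accurate estimate outside the remaining graph is 0, so covered
            vertices are always removed.\<close>
          have "approx (a' v) 0"
            using g'[unfolded good_estimates_def, rule_format, of v] True by (simp add: ae' V'_def)
          then have "a' v = 0" by (simp add: approx_def)
          then show ?thesis using sh \<gamma> by simp
        next
          case False
          then have vV': "v \<in> V'" using v by (simp add: V'_def)
          have closed: "x \<in> A" if "(x, y) \<in> E" "y \<in> A" for x y
            using ancs_closed[OF that(1)] that(2) by (simp add: A_def)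
          have eqs: "anc E' v = anc E v - A" "anc_edges E' v = induced E (anc E v - A)"
            using anc_remove[OF V(2) closed, where v=v] vV' unfolding E'_def V'_def by auto
          have a': "approx (a' v) (card (anc E v - A))" "approx (e' v) (card (induced E (anc E v - A)))"
            using g'[unfolded good_estimates_def, rule_format, of v] vV' by (simp_all add: ae' eqs)
          have e0: "e v \<noteq> 0 \<longleftrightarrow> anc_edges E v \<noteq> {}"
            using a(2) finE by (auto simp: approx_def)
          have ecpos: "card (anc_edges E v) > 0" if "anc_edges E v \<noteq> {}"
            using that finE by (simp add: card_gt_0_iff)
          have "shrunk \<gamma> E (set B) v" if "?out v"
            using that approx_ratio(2)[OF a(1) a'(1) cpos, of \<gamma>] approx_ratio(2)[OF a(2) a'(2) ecpos, of \<gamma>] e0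
            by (auto simp: shrunk_def A_def)
          moreover have "fresh \<gamma> E (set B) v" if "\<not> ?out v"
          proof -
            have "card (induced E (anc E v - A)) \<le> card (anc_edges E v - ancs_edges E (set B))"
              unfolding A_def by (intro card_mono induced_Diff_subset finite_Diff finite_anc_edges finE)
            then show ?thesis
              using that approx_ratio(1)[OF a(1) a'(1) cpos, of \<gamma>] approx_ratio(1)[OF a(2) a'(2) ecpos, of \<gamma>] e0
              by (fastforce simp: fresh_def A_def)
          qed
          ultimately show ?thesis by blast
        qed
      qed
      have t: "sketch_time L (card V' + card E') \<le> sketch_time L (card V + card E)"
        using V'(4,5) by (intro sketch_time_mono) simp
      show "whp 0 (case ae' of (a', e') \<Rightarrow> return_spmf (B, \<lambda>i. {v \<in> K i. \<not> (a' v / a v \<le> 2 * \<gamma> \<or> e v \<noteq> 0 \<and> e' v / e v \<le> 2 * \<gamma>)},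
              \<tau> + sketch_time L (card V + card E) + sketch_time L (card V' + card E') + card V + card E)) ?R"
        unfolding ae' prod.case
      proof (rule whp_return, unfold prod.case, intro conjI allI ballI)
        fix j v assume "v \<in> {v \<in> K j. \<not> ?out v}"
        then show "fresh \<gamma> E (set B) v" using main[of v] K[of j] by blast
      next
        fix j v assume "v \<in> K j - {v \<in> K j. \<not> ?out v}"
        then show "shrunk \<gamma> E (set B) v" using main[of v] K[of j] by blast
      qed (use t in auto)
    qed simp
  qed (simp add: q_def)
  then show ?thesis by (simp add: q_def algebra_simps)
qed

section \<open>Sizes of cones in a bucket, and the loop of FindBatch\<close>

lemma bucket_ge_1: "bucket x \<ge> 1"
proof (cases "x < 2")
  case False
  then have "1 \<le> log 2 x" by (simp add: le_log_iff)
  then have "1 \<le> \<lfloor>log 2 x\<rfloor>" by (simp add: le_floor_iff)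
  then have "1 \<le> nat \<lfloor>log 2 x\<rfloor>" by linarith
  then show ?thesis using False by (simp only: bucket_def if_False)
qed (simp add: bucket_def)

lemma bucket_bounds:
  assumes "bucket x = i"
  shows "x < 2 * 2 ^ i" "2 ^ i \<le> x \<or> i = 1 \<and> x < 2"
proof -
  have "x < 2 * 2 ^ i \<and> (2 ^ i \<le> x \<or> i = 1 \<and> x < 2)"
  proof (cases "x < 2")
    case True
    then show ?thesis using assms by (auto simp: bucket_def)
  next
    case False
    then have x: "x \<ge> 2" by simp
    then have l: "1 \<le> log 2 x" by (simp add: le_log_iff)
    have "real i = of_int \<lfloor>log 2 x\<rfloor>" using assms False l by (auto simp: bucket_def)
    then have i: "real i \<le> log 2 x" "log 2 x < real i + 1" by linarith+
    have "2 powr real i \<le> x" using i(1) x by (simp add: le_log_iff)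
    moreover have "x < 2 powr (real i + 1)" using i(2) x by (simp add: log_less_iff)
    ultimately show ?thesis by (simp add: powr_realpow powr_add)
  qed
  then show "x < 2 * 2 ^ i" "2 ^ i \<le> x \<or> i = 1 \<and> x < 2" by auto
qed

text \<open>In bucket i the number of ancestor edges is at most 3/2 times the estimate, hence below
  3 * 2^i, and ancestors exceed edges by at most one. So 1 plus the size of the cone is at most 2 +
  6 * 2^i \<le> 7 * 2^i, as i \<ge> 1. Conversely 2^i is at most 4/3 times the number of edges,
  except in the smallest bucket, where 2 \<le> 2 * \<open>cone_size E v\<close> holds because a cone
  is never empty.\<close>

lemma bucket_sized_if_approx:
  assumes E: "finite E" and "\<And>v. v \<in> X \<Longrightarrow> bucket (e v) = i \<and> approx (e v) (card (anc_edges E v))"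
  shows "bucket_sized E i X"
  unfolding bucket_sized_def
proof (intro ballI conjI)
  fix v assume "v \<in> X"
  then have b: "bucket (e v) = i" and a: "approx (e v) (card (anc_edges E v))" using assms(2) by auto
  have i: "i \<ge> 1" using b bucket_ge_1[of "e v"] by simp
  then have i2: "(2::real) ^ 1 \<le> 2 ^ i" by (intro power_increasing) auto
  have "real (1 + cone_size E v) \<le> 2 + 2 * real (card (anc_edges E v))"
    using card_anc_le[OF E, of v] by (simp add: cone_size_def)
  also have "\<dots> \<le> 7 * 2 ^ i"
    using a bucket_bounds(1)[OF b] i2 by (simp add: approx_def)
  finally have "real (1 + cone_size E v) \<le> real (7 * 2 ^ i)" by simp
  then show "1 + cone_size E v \<le> 7 * 2 ^ i" by (simp only: of_nat_le_iff)
  show "2 ^ i \<le> 2 * cone_size E v"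
  proof (cases "2 ^ i \<le> e v")
    case True
    then have "real (2 ^ i) \<le> real (2 * cone_size E v)"
      using a by (simp add: approx_def cone_size_def)
    then show ?thesis by (simp only: of_nat_le_iff)
  next
    case False
    then have "i = 1" using bucket_bounds(2)[OF b] by auto
    then show ?thesis using cone_size_pos[OF E, of v] by simp
  qed
qed

definition batch_ok :: "nat \<Rightarrow> nat \<Rightarrow> real \<Rightarrow> 'a set \<Rightarrow> ('a \<times> 'a) set \<Rightarrow> 'a list \<times> nat \<Rightarrow> bool" where
  "batch_ok N L \<gamma> V E R \<longleftrightarrow> (case R of (B, \<tau>) \<Rightarrow>
     fresh_seq V \<gamma> E B \<and> (\<forall>v\<in>V. shrunk \<gamma> E (set B) v) \<and>
     real \<tau> \<le> (1 + log 2 (card V)) * (11000 * (real L + real N) * (real (card V) + real (card E)))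
        + real (fresh_charge N E B))"

text \<open>A vertex leaves its bucket by being added, by failing the exact test or by being pruned,
  and in each case it has shrunk. Therefore empty buckets mean that all vertices have shrunk. The
  bound \<eta> stands for both kinds of failure, bad luck in sampling and inaccurate
  estimates.\<close>

lemma whp_find_batch:
  fixes V :: "'a set"
  assumes V: "finite V" "E \<subseteq> V \<times> V" "acyclic E" "V \<noteq> {}" and \<gamma>: "\<gamma> \<ge> 0" and L: "L \<ge> 1"
    and n: "card V \<le> n" and \<eta>: "(1/2) ^ N \<le> \<eta>" "(11/16) ^ L \<le> \<eta>"
  shows "whp (14 * real n ^ 4 * \<eta>) (find_batch N L \<gamma> V E) (batch_ok N L \<gamma> V E)"
proof -
  have finE: "finite E" using V finite_subset[OF V(2)] by simp
  have cV: "card V \<ge> 1" using V by (simp add: Suc_le_eq card_gt_0_iff)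
  then have n1: "real n \<ge> 1" using n by simp
  have \<eta>0: "\<eta> \<ge> 0" using \<eta>(1) by (rule order_trans[rotated]) simp
  have cE: "real (card E) \<le> real n ^ 2"
  proof -
    have "card E \<le> card V * card V" using card_mono[OF _ V(2)] V(1) by (simp add: card_cartesian_product)
    also have "\<dots> \<le> n * n" using n by (intro mult_mono) auto
    finally have "real (card E) \<le> real (n * n)" by (simp only: of_nat_le_iff)
    then show ?thesis by (simp add: power2_eq_square)
  qed
  \<comment> \<open>After \<open>j\<close> rounds a nonempty bucket gives 1 \<le>
    \<open>card (K i)\<close> and \<open>2 ^ j * card (K i) \<le> card V\<close>, hence
    \<open>2 ^ j \<le> card V\<close>; \<open>J\<close> exceeds all such \<open>j\<close>.\<close>
  define J where "J = Suc (nat \<lfloor>log 2 (card V)\<rfloor>)"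
  have Jlog: "real J \<le> 1 + log 2 (card V)" using cV by (simp add: J_def)
  have Jlt: "j < J" if "2 ^ j \<le> card V" for j
  proof -
    have "real j \<le> log 2 (card V)" using le_log2_of_power[OF that] .
    then show ?thesis by (simp add: J_def less_Suc_eq_le le_nat_floor)
  qed
  have Jn: "J \<le> n"
  proof -
    have "2 ^ (J - 1) \<le> card V"
    proof -
      have "(2::real) ^ (J - 1) = 2 powr real (J - 1)" by (simp add: powr_realpow)
      also have "\<dots> \<le> 2 powr (log 2 (card V))" using Jlog by (intro powr_mono) (auto simp: J_def)
      also have "\<dots> = card V" using cV by simp
      finally have "real (2 ^ (J - 1)) \<le> real (card V)" by simp
      then show ?thesis by (simp only: of_nat_le_iff)
    qed
    moreover have "J - 1 < 2 ^ (J - 1)" by (rule less_exp)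
    ultimately have "J - 1 < n" using n by (metis order_less_le_trans)
    then show ?thesis by simp
  qed
  define sz where "sz = card V + card E"
  have sz1: "sz \<ge> 1" using cV by (simp add: sz_def)
  define sk where "sk = sketch_time L sz"
  have "find_batch N L \<gamma> V E = estimates L V E \<bind> (\<lambda>(a, e). (let k = Max ((\<lambda>v. bucket (e v)) ` V) in
      while_spmf (\<lambda>(B, K, \<tau>). \<exists>i \<in> {1..k}. K i \<noteq> {})
       (\<lambda>st. bind_spmf (sweep_buckets N \<gamma> E k st) (prune L \<gamma> V E))
       ([], \<lambda>i. {v \<in> V. bucket (e v) = i}, sk + card V) \<bind> (\<lambda>(B, K, \<tau>). return_spmf (B, \<tau>))))"
    by (simp add: find_batch_def sk_def sz_def Let_def)
  also have "whp (2 * real n * \<eta> + (real n * ((2 + 2 * real n ^ 2) * ((real n + 1) * \<eta>) + 4 * real n * \<eta>) + 0))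
      \<dots> (batch_ok N L \<gamma> V E)"
  proof (rule whp_bind)
    show "whp (2 * real n * \<eta>) (estimates L V E) (good_estimates V E)"
      by (rule whp_mono[OF whp_estimates[OF V(1-3) L]]) (use n \<eta> in \<open>auto intro!: mult_mono\<close>)
    fix ae assume g: "good_estimates V E ae"
    obtain a e where ae: "ae = (a, e)" by (cases ae)
    define k where "k = Max ((\<lambda>v. bucket (e v)) ` V)"
    have e: "approx (e v) (card (anc_edges E v))" if "v \<in> V" for v
      using g[unfolded good_estimates_def, rule_format, of v] that by (simp add: ae)
    have bk: "bucket (e v) \<in> {1..k}" if "v \<in> V" for v
      using that V(1) bucket_ge_1 by (auto simp: k_def intro!: Max_ge)
    \<comment> \<open>The top bucket is occupied, so \<open>2 ^ k\<close> is bounded by an actual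
      number of edges up to a constant. This makes the uncharged cost \<open>14 * N * 2 ^ k\<close>
      of a sweep linear in the graph.\<close>
    have k2: "2 ^ k \<le> 2 * sz"
    proof -
      have "k \<in> (\<lambda>v. bucket (e v)) ` V" unfolding k_def using V by (intro Max_in) auto
      then obtain v where v: "v \<in> V" "bucket (e v) = k" by auto
      show ?thesis
      proof (cases "2 ^ k \<le> e v")
        case True
        have "card (anc_edges E v) \<le> card E" using finE by (intro card_mono) (auto simp: anc_edges_def induced_def)
        then have "real (2 ^ k) \<le> real (2 * sz)" using e[OF v(1)] True by (simp add: approx_def sz_def)
        then show ?thesis by (simp only: of_nat_le_iff)
      next
        case False
        then have "k = 1" using bucket_bounds(2)[OF v(2)] by auto
        then show ?thesis using sz1 by simp
      qed
    qed
    \<comment> \<open>A crude bound on the number of buckets, for the failure probability.\<close>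
    have kr: "real k \<le> 2 + 2 * real n ^ 2"
    proof -
      have "2 ^ k \<le> 2 + 2 * real (card E)"
      proof -
        have "k \<in> (\<lambda>v. bucket (e v)) ` V" unfolding k_def using V by (intro Max_in) auto
        then obtain v where v: "v \<in> V" "bucket (e v) = k" by auto
        have "card (anc_edges E v) \<le> card E" using finE by (intro card_mono) (auto simp: anc_edges_def induced_def)
        then have "real (card (anc_edges E v)) \<le> real (card E)" by simp
        then show ?thesis using e[OF v(1)] bucket_bounds(2)[OF v(2)] by (auto simp: approx_def)
      qed
      moreover have "real k < 2 ^ k" by (metis less_exp of_nat_less_iff of_nat_numeral of_nat_power)
      ultimately show ?thesis using cE by linarith
    qed
    define c where "c = k + 14 * N * 2 ^ k + (2 * sk + sz)"
    \<comment> \<open>The third clause is the correctness argument: a vertex is still in its bucket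
      or has already shrunk. The fourth is the halving, the last the time, with a cost
      \<open>c\<close> per round.\<close>
    define Inv where "Inv = (\<lambda>j. \<lambda>(B, K, \<tau>). fresh_seq V \<gamma> E B \<and>
      (\<forall>i. K i \<subseteq> {v \<in> V. bucket (e v) = i}) \<and>
      (\<forall>v\<in>V. v \<in> K (bucket (e v)) \<or> shrunk \<gamma> E (set B) v) \<and>
      (\<forall>i. 2 ^ j * card (K i) \<le> card V) \<and> \<tau> \<le> sk + card V + j * c + fresh_charge N E B)"
    define \<delta> where "\<delta> = (2 + 2 * real n ^ 2) * ((real n + 1) * \<eta>) + 4 * real n * \<eta>"
    have \<delta>0: "\<delta> \<ge> 0" using \<eta>0 by (simp add: \<delta>_def)
    have body: "whp \<delta> (sweep_buckets N \<gamma> E k st \<bind> prune L \<gamma> V E) (Inv (Suc j))"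
      if inv: "Inv j st" for j st
    proof -
      obtain B K \<tau> where st: "st = (B, K, \<tau>)" by (cases st)
      have K: "K i \<subseteq> {v \<in> V. bucket (e v) = i}" for i using inv by (auto simp: Inv_def st)
      have KV: "K i \<subseteq> V" for i using K[of i] by auto
      have sized: "bucket_sized E i (K i)" for i
        using K[of i] e by (intro bucket_sized_if_approx[OF finE]) auto
      have "whp ((2 + 2 * real n ^ 2) * ((real n + 1) * \<eta>)) (sweep_buckets N \<gamma> E k st) (swept V N \<gamma> E {1..k} (k + 14 * N * 2 ^ k) st)"
        unfolding st
        by (rule whp_mono[OF whp_sweep_buckets[OF finE \<gamma> V(1) KV sized]])
          (use inv kr n \<eta> in \<open>auto simp: Inv_def st intro!: mult_mono\<close>)
      then show ?thesis
        unfolding \<delta>_def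
      proof (rule whp_bind)
        fix st1 assume s1: "swept V N \<gamma> E {1..k} (k + 14 * N * 2 ^ k) st st1"
        obtain B1 K1 \<tau>1 where st1: "st1 = (B1, K1, \<tau>1)" by (cases st1)
        note sw = s1[unfolded st st1]
        have K1: "K1 i \<subseteq> V" for i using sweptD(3)[OF sw, of i] KV[of i] by simp
        show "whp (4 * real n * \<eta>) (prune L \<gamma> V E st1) (Inv (Suc j))"
          unfolding st1
        proof (rule whp_mono[OF whp_prune[OF V(1-3) \<gamma> L K1]], goal_cases)
          case 1
          show ?case using n \<eta> by (intro mult_mono) auto
        next
          case (2 st2)
          obtain B2 K2 \<tau>2 where st2: "st2 = (B2, K2, \<tau>2)" by (cases st2)
          have p: "B2 = B1" "\<And>j. K2 j \<subseteq> K1 j" "\<And>j v. v \<in> K2 j \<Longrightarrow> fresh \<gamma> E (set B1) v"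
            "\<And>j v. v \<in> K1 j \<Longrightarrow> v \<notin> K2 j \<Longrightarrow> shrunk \<gamma> E (set B1) v" "\<tau>2 \<le> \<tau>1 + 2 * sk + sz"
            using 2(2) by (auto simp: st2 sk_def sz_def)
          have K2: "K2 i \<subseteq> K i" for i using p(2)[of i] sweptD(3)[OF sw, of i] by simp
          have "v \<in> K2 (bucket (e v)) \<or> shrunk \<gamma> E (set B1) v" if v: "v \<in> V" for v
          proof -
            consider "v \<in> K (bucket (e v))" | "shrunk \<gamma> E (set B) v" using inv v by (auto simp: Inv_def st)
            then show ?thesis
            proof cases
              case 1
              then show ?thesis using sweptD(4)[OF sw, of v "bucket (e v)"] p(4)[of v "bucket (e v)"] by blast
            next
              case 2
              then show ?thesis using shrunk_mono[OF finE sweptD(2)[OF sw]] by blast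
            qed
          qed
          moreover have "2 ^ Suc j * card (K2 i) \<le> card V" for i
          proof (cases "i \<in> {1..k}")
            case True
            have "K2 i \<subseteq> {v \<in> K1 i. fresh \<gamma> E (set B1) v}" using p(3)[of _ i] p(2)[of i] by auto
            then have "card (K2 i) \<le> card {v \<in> K1 i. fresh \<gamma> E (set B1) v}"
              using finite_subset[OF K1 V(1)] by (intro card_mono) auto
            then have "2 * card (K2 i) \<le> card (K i)" using sweptD(5)[OF sw True] by linarith
            then have "2 ^ j * (2 * card (K2 i)) \<le> 2 ^ j * card (K i)" by (rule mult_left_mono) simp
            also have "\<dots> \<le> card V" using inv by (auto simp: Inv_def st)
            finally show ?thesis by (simp add: mult_ac)
          next
            case False
            then have "K2 i = {}" using K2[of i] K[of i] bk by force
            then show ?thesis by simp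
          qed
          moreover have "\<tau>2 \<le> sk + card V + Suc j * c + fresh_charge N E B1"
            using p(5) sweptD(6)[OF sw] inv by (simp add: Inv_def st c_def)
          ultimately show ?case
            using p(1) sweptD(1)[OF sw] order_trans[OF K2 K] by (simp add: st2 Inv_def)
        qed
      qed (use \<eta>0 in simp)
    qed
    have W: "whp (real J * \<delta>) (while_spmf (\<lambda>(B, K, \<tau>). \<exists>i \<in> {1..k}. K i \<noteq> {})
       (\<lambda>st. bind_spmf (sweep_buckets N \<gamma> E k st) (prune L \<gamma> V E))
       ([], \<lambda>i. {v \<in> V. bucket (e v) = i}, sk + card V))
       (\<lambda>st. \<exists>j\<le>J. Inv j st \<and> \<not> (case st of (B, K, \<tau>) \<Rightarrow> \<exists>i \<in> {1..k}. K i \<noteq> {}))"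
    proof (rule whp_while_count[OF _ _ \<delta>0])
      show "Inv 0 ([], \<lambda>i. {v \<in> V. bucket (e v) = i}, sk + card V)"
        using V(1) by (auto simp: Inv_def intro: fresh_seq.Nil card_mono)
      fix j st assume i: "Inv j st" and gd: "case st of (B, K, \<tau>) \<Rightarrow> \<exists>i \<in> {1..k}. K i \<noteq> {}"
      obtain B K \<tau> where st: "st = (B, K, \<tau>)" by (cases st)
      obtain i where ne: "K i \<noteq> {}" using gd by (auto simp: st)
      have "finite (K i)" using i V(1) finite_subset[of "K i" V] by (auto simp: Inv_def st)
      then have "1 \<le> card (K i)" using ne by (simp add: Suc_le_eq card_gt_0_iff)
      then have "2 ^ j * 1 \<le> 2 ^ j * card (K i)" by (intro mult_left_mono) auto
      also have "\<dots> \<le> card V" using i by (auto simp: Inv_def st)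
      finally show "j < J \<and> whp \<delta> (sweep_buckets N \<gamma> E k st \<bind> prune L \<gamma> V E) (Inv (Suc j))"
        using body[OF i] Jlt by simp
    qed
    have W': "whp (real n * \<delta>) (while_spmf (\<lambda>(B, K, \<tau>). \<exists>i \<in> {1..k}. K i \<noteq> {})
       (\<lambda>st. bind_spmf (sweep_buckets N \<gamma> E k st) (prune L \<gamma> V E))
       ([], \<lambda>i. {v \<in> V. bucket (e v) = i}, sk + card V))
       (\<lambda>st. \<exists>j\<le>J. Inv j st \<and> \<not> (case st of (B, K, \<tau>) \<Rightarrow> \<exists>i \<in> {1..k}. K i \<noteq> {}))"
      by (rule whp_mono[OF W]) (use Jn \<delta>0 in \<open>auto intro!: mult_right_mono\<close>)
    show "whp (real n * ((2 + 2 * real n ^ 2) * ((real n + 1) * \<eta>) + 4 * real n * \<eta>) + 0)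
      (case ae of (a, e) \<Rightarrow> let k = Max ((\<lambda>v. bucket (e v)) ` V) in
      while_spmf (\<lambda>(B, K, \<tau>). \<exists>i \<in> {1..k}. K i \<noteq> {})
       (\<lambda>st. bind_spmf (sweep_buckets N \<gamma> E k st) (prune L \<gamma> V E))
       ([], \<lambda>i. {v \<in> V. bucket (e v) = i}, sk + card V) \<bind> (\<lambda>(B, K, \<tau>). return_spmf (B, \<tau>))) (batch_ok N L \<gamma> V E)"
      unfolding ae prod.case Let_def k_def[symmetric] \<delta>_def[symmetric]
    proof (rule whp_bind[OF W'])
      fix st assume "\<exists>j\<le>J. Inv j st \<and> \<not> (case st of (B, K, \<tau>) \<Rightarrow> \<exists>i \<in> {1..k}. K i \<noteq> {})"
      then obtain j where j: "j \<le> J" "Inv j st" "\<not> (case st of (B, K, \<tau>) \<Rightarrow> \<exists>i \<in> {1..k}. K i \<noteq> {})" by blast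
      obtain B K \<tau> where st: "st = (B, K, \<tau>)" by (cases st)
      have emp: "K (bucket (e v)) = {}" if "v \<in> V" for v using j(3) bk[OF that] by (auto simp: st)
      have sh: "\<forall>v\<in>V. shrunk \<gamma> E (set B) v" using j(2) emp by (auto simp: Inv_def st)
      have "\<tau> \<le> sk + card V + j * c + fresh_charge N E B" using j(2) by (simp add: Inv_def st)
      also have "\<dots> \<le> J * (sk + sz + c) + fresh_charge N E B"
      proof -
        have "sk + sz \<le> J * (sk + sz)" by (simp add: J_def)
        moreover have "j * c \<le> J * c" using j(1) by (rule mult_right_mono) simp
        moreover have "card V \<le> sz" by (simp add: sz_def)
        ultimately show ?thesis unfolding distrib_left by linarith
      qed
      finally have t: "real \<tau> \<le> real J * real (sk + sz + c) + real (fresh_charge N E B)"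
        by (simp flip: of_nat_mult of_nat_add)
      \<comment> \<open>Three sketch passes, one at the start and two per round, cost 3 * 3456 * L *
        sz = 10368 * L * sz; 11000 leaves room for the other terms.\<close>
      have "sk + sz + c \<le> 11000 * (L + N) * sz"
      proof -
        have "k \<le> 2 * sz" using k2 less_exp[of k] by linarith
        moreover have "14 * N * 2 ^ k \<le> 14 * N * (2 * sz)" using k2 by (intro mult_left_mono) auto
        moreover have "sz \<le> L * sz" using L by simp
        moreover have "sk = 3456 * (L * sz)" by (simp add: sk_def sketch_time_def sketch_size_def)
        moreover have "14 * N * (2 * sz) = 28 * (N * sz)" "11000 * (L + N) * sz = 11000 * (L * sz) + 11000 * (N * sz)"
          by (simp_all add: algebra_simps)
        ultimately show ?thesis unfolding c_def by linarith
      qed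
      then have "real (sk + sz + c) \<le> real (11000 * (L + N) * sz)" by (simp only: of_nat_le_iff)
      then have "real J * real (sk + sz + c) \<le> (1 + log 2 (card V)) * (11000 * (real L + real N) * (real (card V) + real (card E)))"
        using Jlog cV by (intro mult_mono) (auto simp: sz_def)
      then show "whp 0 (case st of (B, K, \<tau>) \<Rightarrow> return_spmf (B, \<tau>)) (batch_ok N L \<gamma> V E)"
        unfolding st prod.case using j(2) sh t by (intro whp_return) (auto simp: batch_ok_def Inv_def st)
    qed simp
  qed (use \<eta>0 in auto)
  finally show ?thesis
  proof (rule whp_mono)
    define x where "x = real n"
    have x: "x \<ge> 1" using n1 by (simp add: x_def)
    have p: "x \<le> x ^ 4" "x ^ 2 \<le> x ^ 4" "x ^ 3 \<le> x ^ 4"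
      using x power_increasing[of 1 4 x] power_increasing[of 2 4 x] power_increasing[of 3 4 x] by auto
    \<comment> \<open>The coefficients of the polynomial sum to 4 + 6 + 2 + 2 = 14, and every power
      of x is at most x^4.\<close>
    have "2 * x * \<eta> + (x * ((2 + 2 * x ^ 2) * ((x + 1) * \<eta>) + 4 * x * \<eta>) + 0)
       = (4 * x + 6 * x ^ 2 + 2 * x ^ 3 + 2 * x ^ 4) * \<eta>"
      by (simp add: algebra_simps power2_eq_square power3_eq_cube power4_eq_xxxx)
    also have "\<dots> \<le> (14 * x ^ 4) * \<eta>" using p \<eta>0 by (intro mult_right_mono) auto
    finally show "2 * real n * \<eta> + (real n * ((2 + 2 * real n ^ 2) * ((real n + 1) * \<eta>) + 4 * real n * \<eta>) + 0)
       \<le> 14 * real n ^ 4 * \<eta>" by (simp only: x_def)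
  qed
qed

section \<open>ScheduleSmallSubgraph\<close>

text \<open>\<open>D\<close> is the set of jobs done so far. The idle delay is already contained in
  \<open>T\<close>, so from time \<open>T\<close> on the results of all copies in \<open>S\<close>
  are available on every machine.\<close>

definition partial_schedule ::
  "('a \<times> 'a) set \<Rightarrow> nat \<Rightarrow> nat \<Rightarrow> 'a set \<Rightarrow> nat \<Rightarrow> 'a schedule \<Rightarrow> bool" where
  "partial_schedule E M \<rho> D T S \<longleftrightarrow>
     feasible D (induced E D) M \<rho> S \<and> (\<forall>(\<mu>, v, t) \<in> S. t + 1 + \<rho> \<le> T)"

text \<open>New copies find their predecessors within \<open>F\<close> on their own machine;
  predecessors outside \<open>F\<close> are left to the schedule before time \<open>T\<close>. The
  inequality with \<open>M * load \<mu>\<close> is Graham's bound, average load plus one job of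
  length at most \<open>c\<close>, multiplied by \<open>M\<close> to stay in the natural
  numbers.\<close>

definition placed ::
  "nat \<Rightarrow> nat \<Rightarrow> ('a \<times> 'a) set \<Rightarrow> 'a schedule \<Rightarrow> nat \<Rightarrow> 'a list \<Rightarrow> (nat \<Rightarrow> nat) \<times> 'a schedule \<times> nat \<Rightarrow> bool" where
  "placed M T F S c B st \<longleftrightarrow> (case st of (load, S', \<tau>) \<Rightarrow>
     finite S' \<and> S \<subseteq> S' \<and>
     (\<forall>(\<mu>, v, t) \<in> S' - S. \<mu> < M \<and> v \<in> ancs F (set B) \<and> T \<le> t \<and> t < T + load \<mu> \<and>
        (\<forall>u. (u, v) \<in> F \<longrightarrow> (\<exists>t'. (\<mu>, u, t') \<in> S' \<and> t' + 1 \<le> t))) \<and>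
     (\<forall>\<mu> v w t. (\<mu>, v, t) \<in> S' \<longrightarrow> (\<mu>, w, t) \<in> S' \<longrightarrow> v = w) \<and>
     (\<forall>v \<in> ancs F (set B). \<exists>\<mu> t. (\<mu>, v, t) \<in> S') \<and>
     (\<Sum>\<mu><M. load \<mu>) = (\<Sum>v\<leftarrow>B. card (anc F v)) \<and>
     (\<forall>\<mu><M. M * load \<mu> \<le> (\<Sum>v\<leftarrow>B. card (anc F v)) + M * c) \<and>
     \<tau> = (\<Sum>v\<leftarrow>B. 1 + nat \<lceil>log 2 (real M)\<rceil> + cone_size F v))"

lemma placed_place_job:
  assumes pl: "placed M T F S c B st" and F: "finite F" "acyclic F" and M: "M \<ge> 1"
    and old: "\<And>\<mu> v t. (\<mu>, v, t) \<in> S \<Longrightarrow> t < T" and c: "card (anc F v) \<le> c"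
  shows "placed M T F S c (B @ [v]) (place_job M T F v st)"
proof -
  obtain load S' \<tau> where st: "st = (load, S', \<tau>)" by (cases st)
  define \<mu>0 where "\<mu>0 = arg_min_on load {..<M}"
  define xs where "xs = topo_order (anc F v) (anc_edges F v)"
  define New where "New = {(\<mu>0, xs ! j, T + load \<mu>0 + j) | j. j < length xs}"
  define load' where "load' = load(\<mu>0 := load \<mu>0 + length xs)"
  have Mne: "{..<M} \<noteq> {}" using M by (auto simp: lessThan_empty_iff)
  have \<mu>0: "\<mu>0 < M" using arg_min_if_finite(1)[OF finite_lessThan Mne, of load] by (simp add: \<mu>0_def)
  have least: "load \<mu>0 \<le> load \<mu>" if "\<mu> < M" for \<mu>
    using arg_min_least[OF finite_lessThan Mne, of \<mu> load] that by (simp add: \<mu>0_def)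
  have "acyclic (anc_edges F v)" unfolding anc_edges_def by (rule acyclic_induced[OF F(2)])
  note t = topo_order[of "anc F v" "anc_edges F v", OF finite_anc[OF F(1)] this finite_anc_edges[OF F(1)], folded xs_def]
  have len: "length xs = card (anc F v)" using distinct_card[OF t(1)] t(2) by simp
  note p = pl[unfolded placed_def st prod.case]
  have p_new: "\<mu> < M \<and> v \<in> ancs F (set B) \<and> T \<le> t \<and> t < T + load \<mu> \<and>
        (\<forall>u. (u, v) \<in> F \<longrightarrow> (\<exists>t'. (\<mu>, u, t') \<in> S' \<and> t' + 1 \<le> t))"
    if "(\<mu>, v, t) \<in> S'" "(\<mu>, v, t) \<notin> S" for \<mu> v t
    using p[THEN conjunct2, THEN conjunct2, THEN conjunct1, THEN bspec, of "(\<mu>, v, t)"] that by auto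
  have S'old: "t < T + load \<mu>" if "(\<mu>, w, t) \<in> S'" for \<mu> w t
  proof (cases "(\<mu>, w, t) \<in> S")
    case True
    then show ?thesis using old[OF True] by simp
  next
    case False
    then show ?thesis using p_new[of \<mu> w t] that by blast
  qed
  have anc_new: "ancs F (set (B @ [v])) = ancs F (set B) \<union> anc F v" by (auto simp: ancs_def)
  have finNew: "finite New" unfolding New_def by (simp add: setcompr_eq_image)
  have job: "place_job M T F v st = (load', S' \<union> New, \<tau> + 1 + nat \<lceil>log 2 (real M)\<rceil> + card (anc F v) + card (anc_edges F v))"
    by (simp add: place_job_def st Let_def load'_def New_def flip: \<mu>0_def xs_def)
  have load_le: "load \<mu> \<le> load' \<mu>" for \<mu> by (simp add: load'_def)
  have n1: "\<mu> < M \<and> w \<in> ancs F (set (B @ [v])) \<and> T \<le> t \<and> t < T + load' \<mu> \<and>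
        (\<forall>u. (u, w) \<in> F \<longrightarrow> (\<exists>t'. (\<mu>, u, t') \<in> S' \<union> New \<and> t' + 1 \<le> t))"
    if m: "(\<mu>, w, t) \<in> S' \<union> New - S" for \<mu> w t
  proof (cases "(\<mu>, w, t) \<in> S'")
    case True
    then have "\<mu> < M \<and> w \<in> ancs F (set B) \<and> T \<le> t \<and> t < T + load \<mu> \<and>
        (\<forall>u. (u, w) \<in> F \<longrightarrow> (\<exists>t'. (\<mu>, u, t') \<in> S' \<and> t' + 1 \<le> t))"
      using m p_new by auto
    then show ?thesis using load_le[of \<mu>] unfolding anc_new by (auto intro: order_less_le_trans)
  next
    case False
    then obtain j where j: "\<mu> = \<mu>0" "w = xs ! j" "t = T + load \<mu>0 + j" "j < length xs"
      using m by (auto simp: New_def)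
    have w: "w \<in> anc F v" using j t(2) nth_mem by blast
    have "\<exists>t'. (\<mu>, u, t') \<in> S' \<union> New \<and> t' + 1 \<le> t" if u: "(u, w) \<in> F" for u
    proof -
      have ua: "u \<in> anc F v" using u w by (auto simp: anc_def intro: converse_rtrancl_into_rtrancl)
      then obtain i where i: "i < length xs" "xs ! i = u" using t(2) by (metis in_set_conv_nth)
      have "(u, w) \<in> anc_edges F v" using u ua w by (auto simp: anc_edges_def induced_def)
      then have "i < j" using t(3)[OF i(1) j(4)] i j by simp
      moreover have "(\<mu>, u, T + load \<mu>0 + i) \<in> New" using i j by (auto simp: New_def)
      ultimately show ?thesis using j by (intro exI[of _ "T + load \<mu>0 + i"]) auto
    qed
    moreover have "w \<in> ancs F (set (B @ [v]))" using w unfolding anc_new by simp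
    ultimately show ?thesis using j \<mu>0 by (simp add: load'_def)
  qed
  \<comment> \<open>The new job starts at \<open>T + load \<mu>0\<close>, and every slot used before
    on that machine ends by then, so old and new copies cannot clash.\<close>
  have n2: "w = w'" if m: "(\<mu>, w, t) \<in> S' \<union> New" "(\<mu>, w', t) \<in> S' \<union> New" for \<mu> w w' t
  proof -
    consider "(\<mu>, w, t) \<in> S'" "(\<mu>, w', t) \<in> S'" | "(\<mu>, w, t) \<in> New" "(\<mu>, w', t) \<in> New"
      | "(\<mu>, w, t) \<in> S'" "(\<mu>, w', t) \<in> New" | "(\<mu>, w, t) \<in> New" "(\<mu>, w', t) \<in> S'"
      using m by blast
    then show ?thesis
    proof cases
      case 1
      then show ?thesis using p by blast
    next
      case 2
      then show ?thesis by (auto simp: New_def)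
    next
      case 3
      then show ?thesis using S'old[OF 3(1)] by (auto simp: New_def)
    next
      case 4
      then show ?thesis using S'old[OF 4(2)] by (auto simp: New_def)
    qed
  qed
  have n3: "\<exists>\<mu> t. (\<mu>, w, t) \<in> S' \<union> New" if "w \<in> ancs F (set (B @ [v]))" for w
  proof (cases "w \<in> ancs F (set B)")
    case True
    then show ?thesis using p by blast
  next
    case False
    then have "w \<in> anc F v" using that unfolding anc_new by simp
    then have "w \<in> set xs" by (simp only: t(2))
    then obtain i where "i < length xs" "xs ! i = w" by (metis in_set_conv_nth)
    then have "(\<mu>0, w, T + load \<mu>0 + i) \<in> New" by (auto simp: New_def)
    then show ?thesis by blast
  qed
  have n4: "(\<Sum>\<mu><M. load' \<mu>) = (\<Sum>w\<leftarrow>B @ [v]. card (anc F w))"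
  proof -
    have "(\<Sum>\<mu><M. load' \<mu>) = load' \<mu>0 + (\<Sum>\<mu>\<in>{..<M} - {\<mu>0}. load' \<mu>)"
      using \<mu>0 by (subst sum.remove[of _ \<mu>0]) auto
    also have "(\<Sum>\<mu>\<in>{..<M} - {\<mu>0}. load' \<mu>) = (\<Sum>\<mu>\<in>{..<M} - {\<mu>0}. load \<mu>)"
      by (intro sum.cong) (auto simp: load'_def)
    also have "load' \<mu>0 + \<dots> = (\<Sum>\<mu><M. load \<mu>) + length xs"
      using \<mu>0 by (subst sum.remove[of "{..<M}" \<mu>0]) (auto simp: load'_def)
    finally show ?thesis using p len by simp
  qed
  \<comment> \<open>Graham's argument: the least load is at most the average, so after receiving a
    job of length at most \<open>c\<close> the chosen machine exceeds the average by at most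
    \<open>c\<close>.\<close>
  have n5: "M * load' \<mu> \<le> (\<Sum>w\<leftarrow>B @ [v]. card (anc F w)) + M * c" if "\<mu> < M" for \<mu>
  proof (cases "\<mu> = \<mu>0")
    case True
    have "M * load \<mu>0 \<le> (\<Sum>\<mu><M. load \<mu>)"
      using sum_bounded_below[of "{..<M}" "load \<mu>0" load] least by simp
    moreover have "M * length xs \<le> M * c" using c len by simp
    moreover have "M * load' \<mu> = M * load \<mu>0 + M * length xs" using True by (simp add: load'_def distrib_left)
    moreover have "(\<Sum>\<mu><M. load \<mu>) = (\<Sum>w\<leftarrow>B. card (anc F w))" using p by blast
    ultimately show ?thesis by (simp only: map_append sum_list_append)
  next
    case False
    then have "M * load' \<mu> \<le> (\<Sum>w\<leftarrow>B. card (anc F w)) + M * c" using p that by (simp add: load'_def)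
    then show ?thesis by simp
  qed
  show ?thesis
    unfolding job placed_def prod.case
  proof (intro conjI)
    show "finite (S' \<union> New)" "S \<subseteq> S' \<union> New" using p finNew by auto
    show "\<forall>(\<mu>, w, t)\<in>S' \<union> New - S. \<mu> < M \<and> w \<in> ancs F (set (B @ [v])) \<and> T \<le> t \<and> t < T + load' \<mu> \<and>
        (\<forall>u. (u, w) \<in> F \<longrightarrow> (\<exists>t'. (\<mu>, u, t') \<in> S' \<union> New \<and> t' + 1 \<le> t))"
      using n1 by blast
    show "\<forall>\<mu> v w t. (\<mu>, v, t) \<in> S' \<union> New \<longrightarrow> (\<mu>, w, t) \<in> S' \<union> New \<longrightarrow> v = w"
      using n2 by blast
    show "\<forall>w\<in>ancs F (set (B @ [v])). \<exists>\<mu> t. (\<mu>, w, t) \<in> S' \<union> New" using n3 by blast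
    show "(\<Sum>\<mu><M. load' \<mu>) = (\<Sum>w\<leftarrow>B @ [v]. card (anc F w))" by (rule n4)
    show "\<forall>\<mu><M. M * load' \<mu> \<le> (\<Sum>w\<leftarrow>B @ [v]. card (anc F w)) + M * c" using n5 by blast
    show "\<tau> + 1 + nat \<lceil>log 2 (real M)\<rceil> + card (anc F v) + card (anc_edges F v)
      = (\<Sum>w\<leftarrow>B @ [v]. 1 + nat \<lceil>log 2 (real M)\<rceil> + cone_size F w)"
      using p by (simp add: cone_size_def)
  qed
qed

lemma placed_fold:
  assumes F: "finite F" "acyclic F" and M: "M \<ge> 1" and S: "finite S"
    and uniq: "\<And>\<mu> v w t. (\<mu>, v, t) \<in> S \<Longrightarrow> (\<mu>, w, t) \<in> S \<Longrightarrow> v = w"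
    and old: "\<And>\<mu> v t. (\<mu>, v, t) \<in> S \<Longrightarrow> t < T"
  shows "(\<And>v. v \<in> set B \<Longrightarrow> card (anc F v) \<le> c) \<Longrightarrow>
    placed M T F S c B (fold (place_job M T F) B (\<lambda>_. 0, S, 0))"
proof (induction B rule: rev_induct)
  case Nil
  then show ?case using S uniq by (auto simp: placed_def ancs_def)
next
  case (snoc v B)
  then show ?case using placed_place_job[OF snoc.IH F M old] by simp
qed

text \<open>A predecessor of a new copy either lies in \<open>X\<close>, and then it belongs to the
  same cone and runs earlier on the same machine, or it lies in \<open>D\<close>, and then its
  result has reached every machine by time \<open>T\<close>. Copies of different cones never need
  each other.\<close>

lemma place_batch:
  assumes F: "F = induced E X" "finite F" "acyclic F" and M: "M \<ge> 1"
    and part: "partial_schedule E M \<rho> D T S"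
    and closed: "\<And>u v. (u, v) \<in> E \<Longrightarrow> v \<in> D \<Longrightarrow> u \<in> D"
    and B: "set B \<subseteq> X" "\<And>v. v \<in> set B \<Longrightarrow> card (anc F v) \<le> c"
    and res: "place_batch M T F B S = (S', T', \<tau>)"
  shows "partial_schedule E M \<rho> (D \<union> ancs F (set B)) (T' + \<rho>) S'"
    and "M * T' \<le> M * T + (\<Sum>v\<leftarrow>B. card (anc F v)) + M * c"
    and "\<tau> = (\<Sum>v\<leftarrow>B. 1 + nat \<lceil>log 2 (real M)\<rceil> + cone_size F v)"
proof -
  note fe = part[unfolded partial_schedule_def feasible_def]
  have fe_mem: "\<mu> < M \<and> v \<in> D" if "(\<mu>, v, t) \<in> S" for \<mu> v t using fe that by blast
  have fe_all: "\<exists>\<mu> t. (\<mu>, v, t) \<in> S" if "v \<in> D" for v using fe that by blast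
  have fe_prec: "(\<exists>t'. (\<mu>, u, t') \<in> S \<and> t' + 1 \<le> t) \<or>
        (\<exists>\<mu>' t'. \<mu>' \<noteq> \<mu> \<and> (\<mu>', u, t') \<in> S \<and> t' + 1 + \<rho> \<le> t)"
    if "(\<mu>, v, t) \<in> S" "(u, v) \<in> induced E D" for \<mu> v t u
    using fe that by (elim conjE) (drule (1) bspec, simp)
  have tS: "t + 1 + \<rho> \<le> T" if "(\<mu>, v, t) \<in> S" for \<mu> v t using fe that by blast
  have pl: "placed M T F S c B (fold (place_job M T F) B (\<lambda>_. 0, S, 0))"
  proof (rule placed_fold[OF F(2,3) M])
    show "finite S" using fe by blast
    show "t < T" if "(\<mu>, v, t) \<in> S" for \<mu> v t using tS[OF that] by simp
    show "v = w" if "(\<mu>, v, t) \<in> S" "(\<mu>, w, t) \<in> S" for \<mu> v w t using fe that by blast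
    show "card (anc F v) \<le> c" if "v \<in> set B" for v by (rule B(2)[OF that])
  qed
  obtain load S1 \<tau>1 where st: "fold (place_job M T F) B (\<lambda>_. 0, S, 0) = (load, S1, \<tau>1)"
    by (metis prod_cases3)
  have eqs: "S' = S1" "T' = T + Max (load ` {..<M})" "\<tau> = \<tau>1"
    using res by (simp_all add: place_batch_def st)
  note p = pl[unfolded st placed_def prod.case, folded eqs(1,3)]
  have p_fin: "finite S'" and p_sub: "S \<subseteq> S'"
    and p_uniq: "\<forall>\<mu> v w t. (\<mu>, v, t) \<in> S' \<longrightarrow> (\<mu>, w, t) \<in> S' \<longrightarrow> v = w"
    and p_all: "\<forall>v \<in> ancs F (set B). \<exists>\<mu> t. (\<mu>, v, t) \<in> S'"
    and p_load: "\<And>\<mu>. \<mu> < M \<Longrightarrow> M * load \<mu> \<le> (\<Sum>v\<leftarrow>B. card (anc F v)) + M * c"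
    using p by simp_all
  show "\<tau> = (\<Sum>v\<leftarrow>B. 1 + nat \<lceil>log 2 (real M)\<rceil> + cone_size F v)" using p by simp
  have Mne: "load ` {..<M} \<noteq> {}" using M by (auto simp: lessThan_empty_iff)
  then have "Max (load ` {..<M}) \<in> load ` {..<M}" by (intro Max_in) auto
  then obtain \<mu>0 where "\<mu>0 < M" "Max (load ` {..<M}) = load \<mu>0" by auto
  then have "M * Max (load ` {..<M}) \<le> (\<Sum>v\<leftarrow>B. card (anc F v)) + M * c" using p_load by simp
  then show "M * T' \<le> M * T + (\<Sum>v\<leftarrow>B. card (anc F v)) + M * c"
    by (simp add: eqs(2) distrib_left)
  have load_le: "T + load \<mu> \<le> T'" if "\<mu> < M" for \<mu>
    unfolding eqs(2) using that by simp
  have TT': "T \<le> T'" by (simp add: eqs(2))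
  let ?A = "ancs F (set B)"
  have AX: "?A \<subseteq> X" using F(1) B(1) by (intro ancs_subset) (auto simp: induced_def)
  have new: "\<mu> < M" "v \<in> ?A" "T \<le> t" "t < T + load \<mu>"
    "\<And>u. (u, v) \<in> F \<Longrightarrow> \<exists>t'. (\<mu>, u, t') \<in> S' \<and> t' + 1 \<le> t"
    if "(\<mu>, v, t) \<in> S'" "(\<mu>, v, t) \<notin> S" for \<mu> v t
    using p[THEN conjunct2, THEN conjunct2, THEN conjunct1, THEN bspec, of "(\<mu>, v, t)"] that by auto
  have prec: "(\<exists>t'. (\<mu>, u, t') \<in> S' \<and> t' + 1 \<le> t) \<or>
        (\<exists>\<mu>' t'. \<mu>' \<noteq> \<mu> \<and> (\<mu>', u, t') \<in> S' \<and> t' + 1 + \<rho> \<le> t)"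
    if v: "(\<mu>, v, t) \<in> S'" and u: "(u, v) \<in> induced E (D \<union> ?A)" for \<mu> v t u
  proof (cases "(\<mu>, v, t) \<in> S")
    case True
    then have "v \<in> D" using fe_mem by blast
    then have uv: "(u, v) \<in> induced E D" using u closed[of u v] by (simp add: induced_def)
    note fe_prec[OF True uv]
    moreover note p_sub
    ultimately show ?thesis by blast
  next
    case False
    show ?thesis
    proof (cases "u \<in> X")
      case True
      then have "(u, v) \<in> F" using u new(2)[OF v False] AX by (auto simp: F(1) induced_def)
      then show ?thesis using new(5)[OF v False] by blast
    next
      case uX: False
      then have "u \<in> D" using u AX by (auto simp: induced_def)
      then obtain \<mu>' t' where ut: "(\<mu>', u, t') \<in> S" using fe_all by blast
      have "t' + 1 + \<rho> \<le> t" using tS[OF ut] new(3)[OF v False] by simp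
      moreover have "(\<mu>', u, t') \<in> S'" using ut p_sub by blast
      ultimately show ?thesis by (cases "\<mu>' = \<mu>") (auto intro: exI[of _ t'])
    qed
  qed
  have "feasible (D \<union> ?A) (induced E (D \<union> ?A)) M \<rho> S'"
    unfolding feasible_def
  proof (intro conjI)
    show "finite S'" by (rule p_fin)
    show "\<forall>(\<mu>, v, t)\<in>S'. \<mu> < M \<and> v \<in> D \<union> ?A" using new(1,2) fe_mem by blast
    show "\<forall>\<mu> v w t. (\<mu>, v, t) \<in> S' \<longrightarrow> (\<mu>, w, t) \<in> S' \<longrightarrow> v = w" by (rule p_uniq)
    show "\<forall>v\<in>D \<union> ?A. \<exists>\<mu> t. (\<mu>, v, t) \<in> S'"
    proof
      fix v assume "v \<in> D \<union> ?A"
      then show "\<exists>\<mu> t. (\<mu>, v, t) \<in> S'"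
      proof
        assume "v \<in> D"
        then obtain \<mu> t where "(\<mu>, v, t) \<in> S" using fe_all by blast
        then show ?thesis using p_sub by blast
      qed (use p_all in blast)
    qed
    show "\<forall>(\<mu>, v, t)\<in>S'. \<forall>u. (u, v) \<in> induced E (D \<union> ?A) \<longrightarrow>
        (\<exists>t'. (\<mu>, u, t') \<in> S' \<and> t' + 1 \<le> t) \<or>
        (\<exists>\<mu>' t'. \<mu>' \<noteq> \<mu> \<and> (\<mu>', u, t') \<in> S' \<and> t' + 1 + \<rho> \<le> t)"
      using prec by blast
  qed
  moreover have "t + 1 + \<rho> \<le> T' + \<rho>" if "(\<mu>, v, t) \<in> S'" for \<mu> v t
  proof (cases "(\<mu>, v, t) \<in> S")
    case True
    then show ?thesis using tS[OF True] TT' by simp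
  next
    case False
    then show ?thesis using new(1,4)[OF that False] load_le[of \<mu>] by simp
  qed
  ultimately show "partial_schedule E M \<rho> (D \<union> ?A) (T' + \<rho>) S'"
    unfolding partial_schedule_def by blast
qed

lemma anc_mono: "E \<subseteq> E' \<Longrightarrow> anc E v \<subseteq> anc E' v"
  unfolding anc_def by (auto dest: rtrancl_mono[THEN subsetD, rotated])

lemma induced_induced: "Y \<subseteq> X \<Longrightarrow> induced (induced E X) Y = induced E Y"
  by (auto simp: induced_def)

definition heap_time :: "nat \<Rightarrow> nat" where
  "heap_time M = nat \<lceil>log 2 (real M)\<rceil>"

text \<open>
  Invariant of the loop over the batches, \<open>j\<close> counting the batches. Every batch divides the number
  of remaining ancestors or ancestor edges of each remaining vertex by \<open>g = 1 / (4 * \<gamma>)\<close>; the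
  exponents \<open>a\<close> and \<open>b\<close> count how often each of the two happened.
\<close>

definition batch_inv where
  "batch_inv E M \<rho> \<gamma> D X W P T0 \<tau>0 j = (\<lambda>((V, F), T, S, \<tau>).
     V \<subseteq> X \<and> F = induced E V \<and> card V + j \<le> card X \<and>
     (\<forall>u v. (u, v) \<in> E \<longrightarrow> v \<in> D \<union> (X - V) \<longrightarrow> u \<in> D \<union> (X - V)) \<and>
     partial_schedule E M \<rho> (D \<union> (X - V)) T S \<and>
     (\<forall>v\<in>V. \<exists>a b. a + b = j \<and> real (card (anc F v)) * (1 / (4 * \<gamma>)) ^ a \<le> 2 * real \<rho> \<and>
        real (card (anc_edges F v)) * (1 / (4 * \<gamma>)) ^ b \<le> 4 * real \<rho> ^ 2 \<and>
        (1 / (4 * \<gamma>)) ^ b \<le> 4 * real \<rho> ^ 2 * (1 / (4 * \<gamma>))) \<and>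
     (1 / (4 * \<gamma>)) ^ j \<le> 8 * real \<rho> ^ 3 * (1 / (4 * \<gamma>)) ^ 2 \<and>
     real T \<le> real T0 + real (card (X - V)) / (\<gamma> * real M) + 3 * real \<rho> * real j \<and>
     real \<tau> \<le> real \<tau>0 + real j * W
        + (real (card (X - V)) + (real (card (induced E X)) - real (card F))) * P
        + real (heap_time M) * real (card (X - V)))"

text \<open>Two bounds on the number of batches are in use. For the failure probability
  \<open>card X\<close> is enough, since every batch removes a vertex. For length and time it is
  \<beta>, any bound on the solutions \<open>j\<close> of the inequality that the invariant
  provides.\<close>

lemma whp_schedule_small_subgraph:
  fixes X :: "'a set"
  assumes X: "finite X" "acyclic E" "finite E" and F: "F = induced E X"
    and D: "\<And>u v. (u, v) \<in> E \<Longrightarrow> v \<in> D \<Longrightarrow> u \<in> D" "\<And>u v. (u, v) \<in> E \<Longrightarrow> v \<in> X \<Longrightarrow> u \<in> D \<union> X" "D \<inter> X = {}"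
    and \<gamma>: "0 < \<gamma>" "4 * \<gamma> < 1" and L: "L \<ge> 1" and M: "M \<ge> 1" and \<rho>: "\<rho> \<ge> 1"
    and n: "card X \<le> n" and \<eta>: "(1/2) ^ N \<le> \<eta>" "(11/16) ^ L \<le> \<eta>"
    and small: "\<And>v. v \<in> X \<Longrightarrow> card (anc F v) \<le> 2 * \<rho>"
    and part: "partial_schedule E M \<rho> D T S"
    and \<beta>: "\<And>j. (1 / (4 * \<gamma>)) ^ j \<le> 8 * real \<rho> ^ 3 * (1 / (4 * \<gamma>)) ^ 2 \<Longrightarrow> real j \<le> \<beta>"
  shows "whp (14 * real n ^ 5 * \<eta>) (schedule_small_subgraph N L \<gamma> M \<rho> (X, F) (T, S, \<tau>))
    (\<lambda>(T', S', \<tau>'). partial_schedule E M \<rho> (D \<union> X) T' S' \<and>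
       real T' \<le> real T + real (card X) / (\<gamma> * real M) + 3 * real \<rho> * \<beta> \<and>
       real \<tau>' \<le> real \<tau> + \<beta> * ((1 + log 2 (real n)) * (11002 * (real L + real N) * (real (card X) + real (card F))))
          + (real (card X) + real (card F)) * ((4 + 28 * real N) / \<gamma>) + real (heap_time M) * real (card X))"
proof -
  define g where "g = 1 / (4 * \<gamma>)"
  have g1: "g \<ge> 1" and g\<gamma>: "4 * \<gamma> * g = 1" using \<gamma> by (auto simp: g_def field_simps)
  define W where "W = (1 + log 2 (real n)) * (11002 * (real L + real N) * (real (card X) + real (card F)))"
  \<comment> \<open>With total cone size \<open>s\<close>, finding and placing a batch costs at most
    \<open>(2 + 14 * N) * (length B + s)\<close> apart from sketches and heap, and
    \<open>length B \<le> s\<close>. As \<gamma> s is at most the number of vertices and edges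
    removed, each of these pays \<open>P\<close>.\<close>
  define P where "P = (4 + 28 * real N) / \<gamma>"
  have P0: "P \<ge> 0" using \<gamma> by (simp add: P_def)
  have \<eta>0: "\<eta> \<ge> 0" using \<eta>(1) by (rule order_trans[rotated]) simp
  define I where "I = batch_inv E M \<rho> \<gamma> D X W P T \<tau>"
  have finF: "finite F" using X F by (simp add: induced_def)
  have \<rho>r: "real \<rho> \<ge> 1" using \<rho> by simp
  let ?guard = "\<lambda>((V, E), T, S, \<tau>). V \<noteq> {}"
  let ?body = "\<lambda>((V, E), T, S, \<tau>). do {
          (B, \<tau>\<^sub>B) \<leftarrow> find_batch N L \<gamma> V E;
          let (S', T', \<tau>\<^sub>P) = place_batch M T E B S;
          let V' = V - ancs E (set B);
          return_spmf
            ((V', induced E V'), T' + \<rho>, S', \<tau> + \<tau>\<^sub>B + \<tau>\<^sub>P + 1 + card V + card E)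
        }"
  have init: "I 0 ((X, F), T, S, \<tau>)"
  proof -
    have "real (card (anc_edges F v)) \<le> 4 * real \<rho> ^ 2" if v: "v \<in> X" for v
    proof -
      have "card (anc_edges F v) \<le> card (anc F v \<times> anc F v)"
        using finF by (intro card_mono) (auto simp: anc_edges_def induced_def)
      also have "\<dots> \<le> (2 * \<rho>) * (2 * \<rho>)"
        unfolding card_cartesian_product using small[OF v] by (intro mult_mono) auto
      finally have "real (card (anc_edges F v)) \<le> real ((2 * \<rho>) * (2 * \<rho>))" by (simp only: of_nat_le_iff)
      then show ?thesis by (simp add: power2_eq_square)
    qed
    moreover have "1 \<le> 4 * real \<rho> ^ 2 * g"
    proof -
      have "1 * 1 \<le> (4 * real \<rho> ^ 2) * g" using g1 one_le_power[OF \<rho>r, of 2] by (intro mult_mono) auto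
      then show ?thesis by simp
    qed
    moreover have "1 \<le> 8 * real \<rho> ^ 3 * g ^ 2"
    proof -
      have "1 * 1 \<le> (8 * real \<rho> ^ 3) * g ^ 2"
        using one_le_power[OF g1, of 2] one_le_power[OF \<rho>r, of 3] by (intro mult_mono) auto
      then show ?thesis by simp
    qed
    moreover have "real (card (anc F v)) \<le> 2 * real \<rho>" if "v \<in> X" for v
    proof -
      have "real (card (anc F v)) \<le> real (2 * \<rho>)" using small[OF that] by (simp only: of_nat_le_iff)
      then show ?thesis by simp
    qed
    ultimately show ?thesis
      using part D(1) by (simp add: I_def batch_inv_def F flip: g_def)
  qed
  have step: "j < card X \<and> whp (14 * real n ^ 4 * \<eta>) (?body st) (I (Suc j))"
    if inv: "I j st" and gd: "?guard st" for j st
  proof -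
    obtain V1 F1 T1 S1 \<tau>1 where st: "st = ((V1, F1), T1, S1, \<tau>1)" by (metis prod_cases4 surj_pair)
    note i = inv[unfolded I_def batch_inv_def st prod.case, folded g_def]
    have V1: "V1 \<subseteq> X" "V1 \<noteq> {}" and F1: "F1 = induced E V1" and cV1: "card V1 + j \<le> card X"
      and cl: "\<And>u v. (u, v) \<in> E \<Longrightarrow> v \<in> D \<union> (X - V1) \<Longrightarrow> u \<in> D \<union> (X - V1)"
      and part1: "partial_schedule E M \<rho> (D \<union> (X - V1)) T1 S1"
      and ab: "\<And>v. v \<in> V1 \<Longrightarrow> \<exists>a b. a + b = j \<and> real (card (anc F1 v)) * g ^ a \<le> 2 * real \<rho> \<and>
        real (card (anc_edges F1 v)) * g ^ b \<le> 4 * real \<rho> ^ 2 \<and> g ^ b \<le> 4 * real \<rho> ^ 2 * g"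
      and T1: "real T1 \<le> real T + real (card (X - V1)) / (\<gamma> * real M) + 3 * real \<rho> * real j"
      and \<tau>1: "real \<tau>1 \<le> real \<tau> + real j * W
        + (real (card (X - V1)) + (real (card (induced E X)) - real (card F1))) * P
        + real (heap_time M) * real (card (X - V1))"
      using i gd by (auto simp: st)
    have finV1: "finite V1" by (rule finite_subset[OF V1(1) X(1)])
    have F1V: "F1 \<subseteq> V1 \<times> V1" "acyclic F1" "finite F1" using X by (auto simp: F1 induced_def intro: acyclic_subset)
    have cV1p: "card V1 > 0" using finV1 V1 by (simp add: card_gt_0_iff)
    have F1F: "F1 \<subseteq> F" using V1 by (auto simp: F1 F induced_def)
    have cardanc1: "card (anc F1 v) \<ge> 1" for v
      using F1V(3) self_in_anc[of v F1] by (auto simp: Suc_le_eq card_gt_0_iff simp del: self_in_anc)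
    have "whp (14 * real n ^ 4 * \<eta> + 0) (?body st) (I (Suc j))"
      unfolding st prod.case
    proof (rule whp_bind[OF whp_find_batch[OF finV1 F1V(1,2) V1(2) _ L _ \<eta>]])
      show "0 \<le> \<gamma>" using \<gamma> by simp
      show "card V1 \<le> n" using cV1 n by simp
      fix R assume ok: "batch_ok N L \<gamma> V1 F1 R"
      obtain B \<tau>B where R: "R = (B, \<tau>B)" by (cases R)
      have fr: "fresh_seq V1 \<gamma> F1 B" and sh: "\<And>v. v \<in> V1 \<Longrightarrow> shrunk \<gamma> F1 (set B) v"
        and \<tau>B: "real \<tau>B \<le> (1 + log 2 (card V1)) * (11000 * (real L + real N) * (real (card V1) + real (card F1)))
           + real (fresh_charge N F1 B)"
        using ok by (auto simp: batch_ok_def R)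
      obtain S2 T2 \<tau>P where pb: "place_batch M T1 F1 B S1 = (S2, T2, \<tau>P)" by (metis prod_cases3)
      define A where "A = ancs F1 (set B)"
      define V2 where "V2 = V1 - A"
      define F2 where "F2 = induced F1 V2"
      have BV: "set B \<subseteq> V1" by (rule fresh_seq_subset[OF fr])
      have AV: "A \<subseteq> V1" unfolding A_def by (rule ancs_subset[OF F1V(1) BV])
      have BA: "set B \<subseteq> A" by (auto simp: A_def ancs_def)
      have finA: "finite A" by (rule finite_subset[OF AV finV1])
      have small1: "card (anc F1 v) \<le> 2 * \<rho>" if "v \<in> set B" for v
      proof -
        have "card (anc F1 v) \<le> card (anc F v)" using finF by (intro card_mono anc_mono F1F) auto
        also have "\<dots> \<le> 2 * \<rho>" using that BV V1 by (intro small) auto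
        finally show ?thesis .
      qed
      note pbs = place_batch[OF F1 F1V(3,2) M part1 cl BV small1 pb]
      have eqD: "D \<union> (X - V1) \<union> A = D \<union> (X - V2)" using AV V1 by (auto simp: V2_def)
      have part2: "partial_schedule E M \<rho> (D \<union> (X - V2)) (T2 + \<rho>) S2"
        using pbs(1) unfolding A_def[symmetric] eqD .
      have F2: "F2 = induced E V2" unfolding F2_def F1 by (rule induced_induced) (auto simp: V2_def)
      have cXV2: "card (X - V2) = card (X - V1) + card A"
      proof -
        have "X - V2 = (X - V1) \<union> A" using AV V1 by (auto simp: V2_def)
        moreover have "(X - V1) \<inter> A = {}" using AV by blast
        ultimately show ?thesis using X finA by (simp add: card_Un_disjoint)
      qed
      have cV2: "card V2 + card A = card V1"
        unfolding V2_def using finV1 AV finA by (simp add: card_Diff_subset card_mono)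
      \<comment> \<open>Progress: if the batch covered nothing, a remaining vertex could not satisfy
        \<open>shrunk\<close>, since \<open>4 * \<gamma> < 1\<close> and the sets concerned are
        nonempty.\<close>
      have "V1 - A \<noteq> V1"
      proof
        assume "V1 - A = V1"
        then have "A = {}" using AV by blast
        obtain v where v: "v \<in> V1" using V1 by blast
        have e0: "ancs F1 (set B) = {}" using \<open>A = {}\<close> by (simp add: A_def)
        have lt: "\<not> real k \<le> 4 * \<gamma> * real k" if "k > 0" for k using \<gamma> that by simp
        have "card (anc F1 v) > 0" using cardanc1[of v] by simp
        moreover have "card (anc_edges F1 v) > 0" if "anc_edges F1 v \<noteq> {}"
          using that F1V(3) by (simp add: card_gt_0_iff)
        moreover have "real (card (anc F1 v)) \<le> 4 * \<gamma> * real (card (anc F1 v)) \<or>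
            anc_edges F1 v \<noteq> {} \<and> real (card (anc_edges F1 v)) \<le> 4 * \<gamma> * real (card (anc_edges F1 v))"
          using sh[OF v] unfolding shrunk_def e0 Diff_empty anc_edges_def[symmetric] .
        ultimately show False using lt by blast
      qed
      then have "V2 \<subset> V1" by (auto simp: V2_def)
      then have cV2lt: "card V2 < card V1" using finV1 by (rule psubset_card_mono[rotated])
      have cl2: "u \<in> D \<union> (X - V2)" if uv: "(u, v) \<in> E" "v \<in> D \<union> (X - V2)" for u v
      proof (cases "v \<in> D \<union> (X - V1)")
        case True
        then show ?thesis using cl[OF uv(1)] by (auto simp: V2_def)
      next
        case False
        then have v: "v \<in> A" using uv eqD by blast
        show ?thesis
        proof (cases "u \<in> V1")
          case True
          then have "(u, v) \<in> F1" using uv v AV by (auto simp: F1 induced_def)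
          then have "u \<in> A" using v unfolding A_def by (rule ancs_closed)
          then show ?thesis using eqD by blast
        next
          case False
          have "u \<in> D \<union> X" using D(2)[OF uv(1)] v AV V1 by blast
          then show ?thesis using False eqD by blast
        qed
      qed
      have sums: "\<gamma> * real (\<Sum>v\<leftarrow>B. card (anc F1 v)) \<le> real (card A)"
        "\<gamma> * real (\<Sum>v\<leftarrow>B. card (anc_edges F1 v)) \<le> real (card (ancs_edges F1 (set B)))"
        using fresh_seq_cone_sizes[OF F1V(3) fr] by (auto simp: A_def)
      have T2: "real (T2 + \<rho>) \<le> real T + real (card (X - V2)) / (\<gamma> * real M) + 3 * real \<rho> * real (Suc j)"
      proof -
        have Mp: "real M > 0" using M by simp
        have "real (M * T2) \<le> real (M * T1 + (\<Sum>v\<leftarrow>B. card (anc F1 v)) + M * (2 * \<rho>))"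
          using pbs(2) by (simp only: of_nat_le_iff)
        then have "real M * real T2 \<le> real M * real T1 + real (\<Sum>v\<leftarrow>B. card (anc F1 v)) + real M * (2 * real \<rho>)"
          by (simp only: of_nat_mult of_nat_add of_nat_numeral)
        also have "real (\<Sum>v\<leftarrow>B. card (anc F1 v)) \<le> real (card A) / \<gamma>"
          using sums(1) \<gamma> by (simp add: pos_le_divide_eq mult.commute)
        finally have "real T2 \<le> real T1 + real (card A) / (\<gamma> * real M) + 2 * real \<rho>"
          using Mp \<gamma> by (simp add: field_simps)
        then show ?thesis using T1 by (simp add: cXV2 add_divide_distrib algebra_simps)
      qed
      have cF2: "card F2 + card (ancs_edges F1 (set B)) \<le> card F1"
      proof -
        have "F2 \<inter> ancs_edges F1 (set B) = {}" by (auto simp: F2_def V2_def A_def ancs_edges_def induced_def)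
        moreover have sub: "F2 \<subseteq> F1" "ancs_edges F1 (set B) \<subseteq> F1"
          by (auto simp: F2_def ancs_edges_def induced_def)
        ultimately have "card F2 + card (ancs_edges F1 (set B)) = card (F2 \<union> ancs_edges F1 (set B))"
          using F1V(3) finite_subset by (metis card_Un_disjoint)
        also have "\<dots> \<le> card F1" using sub F1V(3) by (intro card_mono) auto
        finally show ?thesis .
      qed
      define s where "s = (\<Sum>v\<leftarrow>B. cone_size F1 v)"
      have s: "\<gamma> * real s \<le> real (card A) + (real (card F1) - real (card F2))"
      proof -
        have "s = (\<Sum>v\<leftarrow>B. card (anc F1 v)) + (\<Sum>v\<leftarrow>B. card (anc_edges F1 v))"
          by (simp add: s_def cone_size_def sum_list_addf)
        then have "\<gamma> * real s \<le> real (card A) + real (card (ancs_edges F1 (set B)))"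
          using sums by (simp add: distrib_left)
        then show ?thesis using cF2 by linarith
      qed
      have Bs: "length B \<le> s"
      proof -
        have "(\<Sum>v\<leftarrow>B. 1) \<le> s" unfolding s_def using cone_size_pos[OF F1V(3)] by (intro sum_list_mono) auto
        then show ?thesis by (simp add: sum_list_triv)
      qed
      have BA': "length B \<le> card A"
        using distinct_card[OF fresh_seq_distinct[OF _ fr]] \<gamma> card_mono[OF finA BA] by simp
      have fc: "fresh_charge N F1 B = (1 + 14 * N) * (length B + s)"
      proof -
        have "(\<Sum>v\<leftarrow>B. (1 + 14 * N) * (1 + cone_size F1 v)) = (1 + 14 * N) * (\<Sum>v\<leftarrow>B. 1 + cone_size F1 v)"
          by (rule sum_list_const_mult)
        also have "(\<Sum>v\<leftarrow>B. 1 + cone_size F1 v) = length B + s"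
          by (simp only: sum_list_addf s_def sum_list_triv) simp
        finally show ?thesis by (simp only: fresh_charge_def)
      qed
      have \<tau>Peq: "\<tau>P = length B * heap_time M + (length B + s)"
      proof -
        have "\<tau>P = (\<Sum>v\<leftarrow>B. 1 + heap_time M + cone_size F1 v)" using pbs(3) by (simp add: heap_time_def)
        then show ?thesis by (simp only: sum_list_addf sum_list_triv s_def) (simp add: algebra_simps)
      qed
      have \<tau>2: "real (\<tau>1 + \<tau>B + \<tau>P + 1 + card V1 + card F1) \<le> real \<tau> + real (Suc j) * W
        + (real (card (X - V2)) + (real (card (induced E X)) - real (card F2))) * P
        + real (heap_time M) * real (card (X - V2))"
      proof -
        define z where "z = real (card X) + real (card F)"
        have cX: "card V1 \<le> card X" "card F1 \<le> card F" using V1 X F1F finF by (auto intro: card_mono)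
        have n1: "1 \<le> real n" using cV1p cX n by linarith
        have z1: "real (card V1) + real (card F1) \<le> z" "1 \<le> z" using cX cV1p by (auto simp: z_def)
        have lg: "0 \<le> log 2 (real n)" "log 2 (card V1) \<le> log 2 (real n)" "0 \<le> log 2 (card V1)"
          using n1 cV1p cX n by auto
        have LN: "1 \<le> real L + real N" using L by simp
        have "(1 + log 2 (card V1)) * (11000 * (real L + real N) * (real (card V1) + real (card F1)))
           \<le> (1 + log 2 (real n)) * (11000 * (real L + real N) * z)"
          using lg z1 LN by (intro mult_mono) auto
        \<comment> \<open>The bookkeeping of one iteration; it turns the constant 11000 into
          11002.\<close>
        moreover have "1 + real (card V1) + real (card F1) \<le> (1 + log 2 (real n)) * (2 * (real L + real N) * z)"
        proof -
          have "1 * (2 * 1 * z) \<le> (1 + log 2 (real n)) * (2 * (real L + real N) * z)"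
            using lg z1 LN by (intro mult_mono) auto
          moreover have "1 + real (card V1) + real (card F1) \<le> 1 * (2 * 1 * z)" using z1 by simp
          ultimately show ?thesis by (rule order_trans[rotated])
        qed
        moreover have "W = (1 + log 2 (real n)) * (11000 * (real L + real N) * z) + (1 + log 2 (real n)) * (2 * (real L + real N) * z)"
          by (simp add: W_def z_def algebra_simps)
        ultimately have 1: "real \<tau>B + 1 + real (card V1) + real (card F1) \<le> W + real (fresh_charge N F1 B)"
          using \<tau>B by linarith
        have "real (fresh_charge N F1 B) + real (length B + s) \<le> (4 + 28 * real N) * real s"
        proof -
          have "fresh_charge N F1 B + (length B + s) = (2 + 14 * N) * (length B + s)" by (simp add: fc algebra_simps)
          also have "\<dots> \<le> (2 + 14 * N) * (2 * s)" using Bs by (intro mult_left_mono) auto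
          finally have "real (fresh_charge N F1 B + (length B + s)) \<le> real ((2 + 14 * N) * (2 * s))" by (simp only: of_nat_le_iff)
          then show ?thesis by (simp add: algebra_simps)
        qed
        also have "(4 + 28 * real N) * real s = P * (\<gamma> * real s)" using \<gamma> by (simp add: P_def)
        also have "\<dots> \<le> P * (real (card A) + (real (card F1) - real (card F2)))" using s P0 by (rule mult_left_mono)
        finally have 2: "real (fresh_charge N F1 B) + real (length B + s) \<le> (real (card A) + (real (card F1) - real (card F2))) * P"
          by (simp add: mult.commute)
        have 3: "real (length B * heap_time M) \<le> real (heap_time M) * real (card A)"
          using BA' by (simp add: mult.commute[of "real (length B)"] mult_left_mono)
        show ?thesis using \<tau>1 1 2 3 unfolding \<tau>Peq cXV2 by (simp add: algebra_simps)
      qed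
      \<comment> \<open>A vertex present before the batch is its own ancestor, so
        \<open>g ^ a \<le> 2 * \<rho>\<close>, and the invariant bounds \<open>g ^ b\<close> by
        \<open>4 * \<rho> ^ 2 * g\<close>. The second factor \<open>g\<close> pays for the present
        batch, after which there may be no vertex left to argue with.\<close>
      have gj: "g ^ Suc j \<le> 8 * real \<rho> ^ 3 * g ^ 2"
      proof -
        obtain v where v: "v \<in> V1" using V1 by blast
        then obtain a b where h: "a + b = j" "real (card (anc F1 v)) * g ^ a \<le> 2 * real \<rho>" "g ^ b \<le> 4 * real \<rho> ^ 2 * g"
          using ab by blast
        have "1 * g ^ a \<le> real (card (anc F1 v)) * g ^ a" using cardanc1[of v] g1 by (intro mult_right_mono) auto
        then have "g ^ a \<le> 2 * real \<rho>" using h(2) by simp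
        then have "g ^ a * g ^ b \<le> (2 * real \<rho>) * (4 * real \<rho> ^ 2 * g)" using h(3) g1 by (intro mult_mono) auto
        then have "g ^ j \<le> 8 * real \<rho> ^ 3 * g"
          using h(1) by (simp add: power_add[symmetric] power2_eq_square power3_eq_cube mult_ac)
        then have "g ^ j * g \<le> (8 * real \<rho> ^ 3 * g) * g" using g1 by (intro mult_right_mono) auto
        then show ?thesis by (simp add: power2_eq_square mult_ac)
      qed
      have closedA: "x \<in> A" if "(x, y) \<in> F1" "y \<in> A" for x y
        using ancs_closed[OF that(1)] that(2) by (simp add: A_def)
      have ab2: "\<exists>a b. a + b = Suc j \<and> real (card (anc F2 v)) * g ^ a \<le> 2 * real \<rho> \<and>
        real (card (anc_edges F2 v)) * g ^ b \<le> 4 * real \<rho> ^ 2 \<and> g ^ b \<le> 4 * real \<rho> ^ 2 * g" if v: "v \<in> V2" for v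
      proof -
        have vV1: "v \<in> V1" using v by (simp add: V2_def)
        have eqs: "anc F2 v = anc F1 v - A" "anc_edges F2 v = induced F1 (anc F1 v - A)"
          using anc_remove[OF F1V(1) closedA, where v=v] v unfolding F2_def V2_def by auto
        obtain a b where h: "a + b = j" "real (card (anc F1 v)) * g ^ a \<le> 2 * real \<rho>"
          "real (card (anc_edges F1 v)) * g ^ b \<le> 4 * real \<rho> ^ 2" "g ^ b \<le> 4 * real \<rho> ^ 2 * g"
          using ab[OF vV1] by blast
        have gp: "g ^ a \<ge> 0" "g ^ b \<ge> 0" using g1 by auto
        have "card (anc F2 v) \<le> card (anc F1 v)" unfolding eqs using F1V(3) by (intro card_mono) auto
        then have A1: "real (card (anc F2 v)) * g ^ a \<le> 2 * real \<rho>"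
          using gp h(2) by (meson mult_right_mono of_nat_le_iff order_trans)
        have "card (anc_edges F2 v) \<le> card (anc_edges F1 v)"
          unfolding eqs using F1V(3) by (intro card_mono) (auto simp: anc_edges_def induced_def)
        then have E1: "real (card (anc_edges F2 v)) * g ^ b \<le> 4 * real \<rho> ^ 2"
          using gp h(3) by (meson mult_right_mono of_nat_le_iff order_trans)
        have shrink: "x * g ^ Suc k \<le> y * g ^ k" if "x \<le> 4 * \<gamma> * y" for x y :: real and k
        proof -
          have "x * g ^ Suc k \<le> (4 * \<gamma> * y) * g ^ Suc k" using that g1 by (intro mult_right_mono) auto
          also have "\<dots> = (4 * \<gamma> * g) * (y * g ^ k)" by simp
          finally show ?thesis by (simp add: g\<gamma>)
        qed
        from sh[OF vV1] show ?thesis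
          unfolding shrunk_def A_def[symmetric] eqs(1)[symmetric] eqs(2)[folded eqs(1), symmetric]
        proof
          assume le: "real (card (anc F2 v)) \<le> 4 * \<gamma> * real (card (anc F1 v))"
          have "real (card (anc F2 v)) * g ^ Suc a \<le> 2 * real \<rho>"
            using order_trans[OF shrink[OF le, of a] h(2)] .
          then show ?thesis using h(1,4) E1 by (intro exI[of _ "Suc a"] exI[of _ b]) simp
        next
          assume c: "anc_edges F1 v \<noteq> {} \<and> real (card (anc_edges F2 v)) \<le> 4 * \<gamma> * real (card (anc_edges F1 v))"
          then have e: "real (card (anc_edges F2 v)) * g ^ Suc b \<le> 4 * real \<rho> ^ 2"
            using order_trans[OF shrink[of "real (card (anc_edges F2 v))" "real (card (anc_edges F1 v))" b] h(3)] by blast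
          \<comment> \<open>Before an edge step there is at least one ancestor edge, so
            \<open>g ^ b \<le> 4 * \<rho> ^ 2\<close> at that time. The step may remove all edges,
            hence the extra factor \<open>g\<close> in the invariant; without ancestor edges the
            second disjunct of \<open>shrunk\<close> is false and \<open>b\<close> no longer
            grows.\<close>
          have "1 \<le> card (anc_edges F1 v)" using c F1V(3) by (simp add: Suc_le_eq card_gt_0_iff)
          then have "1 * g ^ b \<le> real (card (anc_edges F1 v)) * g ^ b" using gp by (intro mult_right_mono) auto
          then have "g ^ b \<le> 4 * real \<rho> ^ 2" using h(3) by simp
          then have "g ^ b * g \<le> 4 * real \<rho> ^ 2 * g" using g1 by (intro mult_right_mono) auto
          then show ?thesis using h(1) A1 e by (intro exI[of _ a] exI[of _ "Suc b"]) (simp add: mult.commute)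
        qed
      qed
      have "I (Suc j) ((V2, F2), T2 + \<rho>, S2, \<tau>1 + \<tau>B + \<tau>P + 1 + card V1 + card F1)"
        unfolding I_def batch_inv_def prod.case g_def[symmetric]
        using F2 cl2 part2 ab2 gj T2 \<tau>2 cV2lt cV1 V1 by (intro conjI allI impI ballI) (auto simp: V2_def)
      then show "whp 0 (case R of (B, \<tau>\<^sub>B) \<Rightarrow>
          let (S', T', \<tau>\<^sub>P) = place_batch M T1 F1 B S1; V' = V1 - ancs F1 (set B) in
          return_spmf ((V', induced F1 V'), T' + \<rho>, S', \<tau>1 + \<tau>\<^sub>B + \<tau>\<^sub>P + 1 + card V1 + card F1)) (I (Suc j))"
        by (simp add: R pb Let_def whp_return F2_def V2_def A_def)
    qed simp
    then show ?thesis using cV1p cV1 by simp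
  qed
  have "whp (real (card X) * (14 * real n ^ 4 * \<eta>)) (while_spmf ?guard ?body ((X, F), T, S, \<tau>))
    (\<lambda>s. \<exists>j\<le>card X. I j s \<and> \<not> ?guard s)"
    by (rule whp_while_count[where I=I, OF init step]) (use \<eta>0 in auto)
  then have "whp (14 * real n ^ 5 * \<eta>) (while_spmf ?guard ?body ((X, F), T, S, \<tau>))
    (\<lambda>s. \<exists>j\<le>card X. I j s \<and> \<not> ?guard s)"
  proof (rule whp_mono)
    have "real (card X) * (14 * real n ^ 4 * \<eta>) \<le> real n * (14 * real n ^ 4 * \<eta>)"
      using n \<eta>0 by (intro mult_right_mono) auto
    also have "\<dots> = 14 * real n ^ 5 * \<eta>" by (simp add: eval_nat_numeral)
    finally show "real (card X) * (14 * real n ^ 4 * \<eta>) \<le> 14 * real n ^ 5 * \<eta>" .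
  qed
  then show ?thesis
    unfolding schedule_small_subgraph_def
  proof (intro whp_map, elim whp_mono, goal_cases)
    case (2 s)
    then obtain j where j: "I j s" "\<not> ?guard s" by blast
    obtain V1 F1 T1 S1 \<tau>1 where s: "s = ((V1, F1), T1, S1, \<tau>1)" by (metis prod_cases4 surj_pair)
    have V1: "V1 = {}" using j(2) by (simp add: s)
    note i = j(1)[unfolded I_def batch_inv_def s prod.case V1]
    have F1: "F1 = {}" using i by (simp add: induced_def)
    have jb: "real j \<le> \<beta>" using i by (intro \<beta>) blast
    have W0: "W \<ge> 0"
    proof (cases "n = 0")
      case True
      then have "X = {}" using n X by simp
      then show ?thesis by (simp add: W_def F induced_def)
    qed (auto simp: W_def)
    have "real j * W \<le> \<beta> * W" "3 * real \<rho> * real j \<le> 3 * real \<rho> * \<beta>"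
      using jb W0 by (auto intro: mult_right_mono mult_left_mono)
    then show ?case using i unfolding s F1 by (auto simp: P_def W_def F)
  qed simp
qed

section \<open>Partition into small subgraphs\<close>

text \<open>\<open>T u ! j\<close> is the value of the \<open>j\<close>-th hash function at
  \<open>u\<close>. The estimate depends only on the rows of \<open>T\<close> for ancestors of
  \<open>v\<close>, so it is determined before the rest of the table is drawn.\<close>

definition anc_estimate :: "nat \<Rightarrow> nat \<Rightarrow> ('a \<times> 'a) set \<Rightarrow> ('a \<Rightarrow> nat list) \<Rightarrow> 'a \<Rightarrow> real" where
  "anc_estimate L R E T v = median (map (\<lambda>j. sketch_value R (truncate ((\<lambda>u. T u ! j) ` anc E v))) [0..<L])"

definition good_table :: "nat \<Rightarrow> nat \<Rightarrow> 'a set \<Rightarrow> ('a \<times> 'a) set \<Rightarrow> ('a \<Rightarrow> nat list) \<Rightarrow> bool" where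
  "good_table L R V E T \<longleftrightarrow> (\<forall>v\<in>V. approx (anc_estimate L R E T v) (card (anc E v)))"

text \<open>Transposing the table gives \<open>L\<close> independent copies of
  \<open>hash_table V\<close>, for which the bound on medians and a union bound over
  \<open>V\<close> are available.\<close>

lemma prob_good_table:
  assumes V: "finite V" "E \<subseteq> V \<times> V"
  defines "R \<equiv> hash_range (card V)"
  shows "measure_pmf.prob (Pi_pmf V d (\<lambda>_. replicate_pmf L (pmf_of_set {1..R}))) {T. good_table L R V E T}
    \<ge> 1 - real (card V) * (11/16) ^ L"
proof -
  let ?p = "Pi_pmf V d (\<lambda>_. replicate_pmf L (pmf_of_set {1..R}))"
  have bad: "measure_pmf.prob ?p {T. \<not> approx (anc_estimate L R E T v) (card (anc E v))} \<le> (11/16) ^ L"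
    if v: "v \<in> V" for v
  proof -
    let ?H = "\<lambda>T. map (\<lambda>j v. if v \<in> V then T v ! j else 0) [0..<L]"
    let ?B = "{hs. \<not> approx (median (map (\<lambda>h. sketch_value R (truncate (h ` anc E v))) hs)) (card (anc E v))}"
    have AV: "anc E v \<subseteq> V" using V(2) v by (rule anc_subset)
    have "(\<lambda>u. if u \<in> V then T u ! j else 0) ` anc E v = (\<lambda>u. T u ! j) ` anc E v" for T :: "'a \<Rightarrow> nat list" and j
      using AV by (intro image_cong) auto
    then have eq: "{T. \<not> approx (anc_estimate L R E T v) (card (anc E v))} = ?H -` ?B"
      by (auto simp: anc_estimate_def comp_def)
    have "measure_pmf.prob ?p (?H -` ?B) = measure_pmf.prob (replicate_pmf L (hash_table V)) ?B"
      unfolding hash_table_def R_def[symmetric]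
      by (subst Pi_pmf_replicate[OF V(1), where d'=d, symmetric]) simp
    also have "\<dots> \<le> (11/16) ^ L"
      unfolding R_def by (rule prob_bad_median[OF V(1) AV])
    finally show ?thesis by (simp only: eq)
  qed
  have "measure_pmf.prob ?p {T. \<exists>v\<in>V. \<not> approx (anc_estimate L R E T v) (card (anc E v))} \<le> real (card V) * (11/16) ^ L"
    by (rule prob_UN_le[OF V(1) bad])
  moreover have "measure_pmf.prob ?p {T. good_table L R V E T}
      = 1 - measure_pmf.prob ?p {T. \<exists>v\<in>V. \<not> approx (anc_estimate L R E T v) (card (anc E v))}"
  proof (subst measure_pmf.prob_compl[symmetric])
    show "measure_pmf.prob ?p {T. good_table L R V E T} = measure_pmf.prob ?p
        (space (measure_pmf ?p) - {T. \<exists>v\<in>V. \<not> approx (anc_estimate L R E T v) (card (anc E v))})"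
      by (rule arg_cong[where f="measure_pmf.prob ?p"]) (auto simp: good_table_def)
  qed simp
  ultimately show ?thesis by simp
qed

section \<open>Growing one subgraph\<close>

lemma list_of:
  assumes "finite S"
  shows "distinct (list_of S) \<and> set (list_of S) = S"
proof -
  obtain xs where "distinct xs \<and> set xs = S" using finite_distinct_list[OF assms] by auto
  then show ?thesis unfolding list_of_def by (rule someI)
qed

text \<open>\<open>D\<close> (dequeued vertices) and \<open>T\<close> (hash values drawn for them)
  are ghost variables that the program does not store. The queue consists exactly of the vertices
  outside \<open>D\<close> whose predecessors are all marked; this shows on exit that nothing
  eligible was left out.\<close>

definition grow_inv where
  "grow_inv L \<rho> V E D T = (\<lambda>(Q, X, \<sigma>, \<tau>).
     X \<subseteq> D \<and> D \<subseteq> V \<and> (\<forall>v\<in>D. preds E v \<subseteq> X) \<and> distinct Q \<and> set Q = {w \<in> V. preds E w \<subseteq> X} - D \<and>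
     (\<forall>v\<in>D. \<sigma> v = map (\<lambda>j. truncate ((\<lambda>u. T u ! j) ` anc E v)) [0..<L]) \<and>
     (\<forall>v\<in>X. card (anc E v) \<le> 2 * \<rho>) \<and> (\<forall>v\<in>D - X. card (anc E v) > \<rho>) \<and>
     \<tau> = (\<Sum>v\<in>D. 1 + sketch_time L (1 + card (preds E v))) + (\<Sum>v\<in>X. card (succs E v)))"

text \<open>The loop body as a function of the hash values, separated from the drawing, so that the
  values can be taken from a table instead.\<close>

definition grow_step where
  "grow_step L \<rho> R E = (\<lambda>(Q, X, \<sigma>, \<tau>) hs.
     let v = hd Q;
         ss = map (\<lambda>j. truncate (insert (hs ! j) (\<Union>u\<in>preds E v. \<sigma> u ! j))) [0..<L];
         \<tau>' = \<tau> + 1 + sketch_time L (1 + card (preds E v))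
     in (if median (map (sketch_value R) ss) \<le> 4 / 3 * real \<rho>
         then (tl Q @ list_of {w \<in> succs E v. preds E w \<subseteq> insert v X},
               insert v X, \<sigma>(v := ss), \<tau>' + card (succs E v))
         else (tl Q, X, \<sigma>(v := ss), \<tau>')))"

text \<open>With relative error 1/3 an estimate at most 4/3 \<rho> implies at most 3/2 * 4/3 \<rho>
  = 2 \<rho> ancestors, and a larger estimate implies more than \<rho>. Accuracy is required only
  for the vertex being dequeued.\<close>

lemma grow_inv_step:
  fixes V :: "'a set" and Q :: "'a list" and T :: "'a \<Rightarrow> nat list"
  assumes V: "finite V" "E \<subseteq> V \<times> V" "acyclic E"
    and inv: "grow_inv L \<rho> V E D T (v # Q, X, \<sigma>, \<tau>)"
    and ap: "approx (anc_estimate L R E (T(v := hs)) v) (card (anc E v))"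
  shows "grow_inv L \<rho> V E (insert v D) (T(v := hs)) (grow_step L \<rho> R E (v # Q, X, \<sigma>, \<tau>) hs)"
proof -
  have finE: "finite E" using V finite_subset[OF V(2)] by simp
  define T' where "T' = T(v := hs)"
  define ss where "ss = map (\<lambda>j. truncate (insert (hs ! j) (\<Union>u\<in>preds E v. \<sigma> u ! j))) [0..<L]"
  have i: "X \<subseteq> D" "D \<subseteq> V" "\<And>w. w \<in> D \<Longrightarrow> preds E w \<subseteq> X" "distinct (v # Q)"
    and Q: "set (v # Q) = {w \<in> V. preds E w \<subseteq> X} - D"
    and \<sigma>: "\<And>w. w \<in> D \<Longrightarrow> \<sigma> w = map (\<lambda>j. truncate ((\<lambda>u. T u ! j) ` anc E w)) [0..<L]"
    and lo: "\<And>w. w \<in> X \<Longrightarrow> card (anc E w) \<le> 2 * \<rho>" and hi: "\<And>w. w \<in> D - X \<Longrightarrow> card (anc E w) > \<rho>"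
    and \<tau>: "\<tau> = (\<Sum>v\<in>D. 1 + sketch_time L (1 + card (preds E v))) + (\<Sum>v\<in>X. card (succs E v))"
    using inv by (simp_all add: grow_inv_def)
  have v: "v \<in> V" "preds E v \<subseteq> X" "v \<notin> D" using Q by auto
  have finD: "finite D" by (rule finite_subset[OF i(2) V(1)])
  have finX: "finite X" by (rule finite_subset[OF i(1) finD])
  have ancD: "anc E w \<subseteq> D" if "w \<in> D" for w
    using i(1,3) that by (intro anc_closed(1)) (auto simp: preds_def)
  have same: "(\<lambda>u. T' u ! j) ` anc E w = (\<lambda>u. T u ! j) ` anc E w" if "w \<in> D" for w j
    using ancD[OF that] v(3) by (intro image_cong) (auto simp: T'_def)
  have ss: "ss = map (\<lambda>j. truncate ((\<lambda>u. T' u ! j) ` anc E v)) [0..<L]"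
    unfolding ss_def
  proof (rule map_cong[OF refl])
    fix j assume j: "j \<in> set [0..<L]"
    have "(\<Union>u\<in>preds E v. \<sigma> u ! j) = (\<Union>u\<in>preds E v. truncate ((\<lambda>u. T' u ! j) ` anc E u))"
    proof (rule SUP_cong[OF refl])
      fix u assume "u \<in> preds E v"
      then have "u \<in> D" using v(2) i(1) by blast
      then show "\<sigma> u ! j = truncate ((\<lambda>u. T' u ! j) ` anc E u)" using \<sigma> same j by simp
    qed
    then show "truncate (insert (hs ! j) (\<Union>u\<in>preds E v. \<sigma> u ! j)) = truncate ((\<lambda>u. T' u ! j) ` anc E v)"
      using truncate_anc[OF finE, of "\<lambda>u. T' u ! j" v] by (simp add: T'_def)
  qed
  have est: "median (map (sketch_value R) ss) = anc_estimate L R E T' v"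
    by (simp add: ss anc_estimate_def comp_def)
  have ap': "approx (median (map (sketch_value R) ss)) (card (anc E v))" using ap by (simp add: est T'_def)
  have \<sigma>': "(\<sigma>(v := ss)) w = map (\<lambda>j. truncate ((\<lambda>u. T' u ! j) ` anc E w)) [0..<L]" if "w \<in> insert v D" for w
    using that \<sigma> same ss by (cases "w = v") auto
  let ?\<tau> = "\<tau> + 1 + sketch_time L (1 + card (preds E v))"
  show ?thesis
  proof (cases "median (map (sketch_value R) ss) \<le> 4 / 3 * real \<rho>")
    case True
    define N where "N = {w \<in> succs E v. preds E w \<subseteq> insert v X}"
    have "finite N" using V finite_subset[of N V] by (auto simp: N_def succs_def)
    then have lN: "distinct (list_of N)" "set (list_of N) = N" using list_of by auto
    have small: "card (anc E v) \<le> 2 * \<rho>" using True ap' by (simp add: approx_def)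
    have "v \<notin> X" using v i(1) by blast
    have ND: "w \<notin> D \<and> w \<noteq> v \<and> w \<in> V" if "w \<in> N" for w
    proof -
      have "v \<in> preds E w" using that by (auto simp: N_def succs_def preds_def)
      then have "w \<notin> D" using i(3)[of w] \<open>v \<notin> X\<close> by blast
      moreover have "(v, v) \<notin> E" using V(3) by (auto simp: acyclic_def)
      ultimately show ?thesis using that V(2) by (auto simp: N_def succs_def)
    qed
    have QN: "w \<notin> N" if "w \<in> set Q" for w
    proof -
      have "preds E w \<subseteq> X" using that Q by auto
      then show ?thesis using \<open>v \<notin> X\<close> by (auto simp: N_def succs_def preds_def)
    qed
    have Q': "set Q \<union> N = {w \<in> V. preds E w \<subseteq> insert v X} - insert v D"
    proof (intro equalityI subsetI)
      fix w assume "w \<in> set Q \<union> N"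
      then show "w \<in> {w \<in> V. preds E w \<subseteq> insert v X} - insert v D"
        using Q i(4) ND by (auto simp: N_def)
    next
      fix w assume w: "w \<in> {w \<in> V. preds E w \<subseteq> insert v X} - insert v D"
      then show "w \<in> set Q \<union> N"
        using Q by (cases "v \<in> preds E w") (auto simp: N_def succs_def preds_def)
    qed
    have eq: "grow_step L \<rho> R E (v # Q, X, \<sigma>, \<tau>) hs
        = (Q @ list_of N, insert v X, \<sigma>(v := ss), ?\<tau> + card (succs E v))"
      by (simp only: grow_step_def prod.case Let_def list.sel ss_def[symmetric] N_def[symmetric] True if_True)
    show ?thesis
      unfolding eq grow_inv_def prod.case T'_def[symmetric]
    proof (intro conjI)
      show "insert v X \<subseteq> insert v D" "insert v D \<subseteq> V" using i v by auto
      show "\<forall>w\<in>insert v D. preds E w \<subseteq> insert v X" using i(3) v(2) by auto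
      show "distinct (Q @ list_of N)" using i(4) lN QN by auto
      show "set (Q @ list_of N) = {w \<in> V. preds E w \<subseteq> insert v X} - insert v D"
        unfolding set_append lN(2) by (rule Q')
      show "\<forall>w\<in>insert v D. (\<sigma>(v := ss)) w = map (\<lambda>j. truncate ((\<lambda>u. T' u ! j) ` anc E w)) [0..<L]"
        using \<sigma>' by blast
      show "\<forall>w\<in>insert v X. card (anc E w) \<le> 2 * \<rho>" using lo small by simp
      show "\<forall>w\<in>insert v D - insert v X. card (anc E w) > \<rho>" using hi by simp
      show "?\<tau> + card (succs E v) = (\<Sum>v\<in>insert v D. 1 + sketch_time L (1 + card (preds E v)))
          + (\<Sum>v\<in>insert v X. card (succs E v))"
        using v(3) \<open>v \<notin> X\<close> finD finX \<tau> by simp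
    qed
  next
    case False
    then have large: "card (anc E v) > \<rho>" using ap' by (simp add: approx_def)
    have Q': "set Q = {w \<in> V. preds E w \<subseteq> X} - insert v D" using Q i(4) by auto
    have eq: "grow_step L \<rho> R E (v # Q, X, \<sigma>, \<tau>) hs = (Q, X, \<sigma>(v := ss), ?\<tau>)"
      by (simp only: grow_step_def prod.case Let_def list.sel ss_def[symmetric] False if_False)
    show ?thesis
      unfolding eq grow_inv_def prod.case T'_def[symmetric]
    proof (intro conjI)
      show "X \<subseteq> insert v D" "insert v D \<subseteq> V" using i v by auto
      show "\<forall>w\<in>insert v D. preds E w \<subseteq> X" using i(3) v(2) by auto
      show "distinct Q" using i(4) by simp
      show "set Q = {w \<in> V. preds E w \<subseteq> X} - insert v D" by (rule Q')
      show "\<forall>w\<in>insert v D. (\<sigma>(v := ss)) w = map (\<lambda>j. truncate ((\<lambda>u. T' u ! j) ` anc E w)) [0..<L]"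
        using \<sigma>' by blast
      show "\<forall>w\<in>X. card (anc E w) \<le> 2 * \<rho>" using lo by blast
      show "\<forall>w\<in>insert v D - X. card (anc E w) > \<rho>" using hi large by blast
      show "?\<tau> = (\<Sum>v\<in>insert v D. 1 + sketch_time L (1 + card (preds E v))) + (\<Sum>v\<in>X. card (succs E v))"
        using v(3) finD \<tau> by simp
    qed
  qed
qed

text \<open>
  The hash values of a vertex may as well be drawn before the loop starts: the probability that a
  complete table of hash values, of which the values for \<open>D\<close> have been revealed, turns out good is a
  lower bound for the probability of success.
\<close>

lemma grow_loop:
  fixes V :: "'a set" and T :: "'a \<Rightarrow> nat list"
  assumes V: "finite V" "E \<subseteq> V \<times> V" "acyclic E"
    and inv: "grow_inv L \<rho> V E D T st"
  shows "measure_pmf.prob (Pi_pmf (V - D) d (\<lambda>_. replicate_pmf L (pmf_of_set {1..R})))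
      {T'. good_table L R V E (\<lambda>u. if u \<in> D then T u else T' u)}
    \<le> measure (measure_spmf (while_spmf (\<lambda>(Q, X, \<sigma>, \<tau>). Q \<noteq> [])
        (\<lambda>st. map_spmf (grow_step L \<rho> R E st) (spmf_of_pmf (replicate_pmf L (pmf_of_set {1..R})))) st))
      {(Q, X, \<sigma>, \<tau>). Q = [] \<and> (\<exists>D T. grow_inv L \<rho> V E D T (Q, X, \<sigma>, \<tau>))}"
  using inv
proof (induction "card (V - D)" arbitrary: D T st rule: less_induct)
  case less
  let ?W = "while_spmf (\<lambda>(Q, X, \<sigma>, \<tau>). Q \<noteq> [])
        (\<lambda>st. map_spmf (grow_step L \<rho> R E st) (spmf_of_pmf (replicate_pmf L (pmf_of_set {1..R}))))"
  let ?R = "{(Q, X, \<sigma>, \<tau>). Q = [] \<and> (\<exists>D T. grow_inv L \<rho> V E D T (Q, X, \<sigma>, \<tau>))}"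
  let ?q = "replicate_pmf L (pmf_of_set {1..R})"
  obtain Q X \<sigma> \<tau> where st: "st = (Q, X, \<sigma>, \<tau>)" by (cases st)
  show ?case
  proof (cases Q)
    case Nil
    have "?W st = return_spmf st" by (subst while_spmf.simps) (simp add: st Nil)
    moreover have "st \<in> ?R" using less.prems by (auto simp: st Nil)
    ultimately show ?thesis by (simp add: measure_spmf_return_spmf measure_return)
  next
    case (Cons v Q')
    have v: "v \<in> V - D" and vX: "preds E v \<subseteq> X" and XD: "X \<subseteq> D" and cl: "\<And>w. w \<in> D \<Longrightarrow> preds E w \<subseteq> X"
      using less.prems by (auto simp: st Cons grow_inv_def)
    have "X \<subseteq> insert v D" "preds E w \<subseteq> insert v D" if "w \<in> insert v D" for w
      using that XD cl vX by auto
    then have ancv: "anc E v \<subseteq> insert v D"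
      by (intro anc_closed(1)) (auto simp: preds_def)
    define U where "U = V - insert v D"
    have U: "V - D = insert v U" "v \<notin> U" "finite U" using v V(1) by (auto simp: U_def)
    define G where "G = (\<lambda>hs. {T'. good_table L R V E (\<lambda>u. if u \<in> insert v D then (T(v := hs)) u else T' u)})"
    \<comment> \<open>The row of \<open>v\<close> is drawn first, as the loop does it, and the
      remaining rows afterwards.\<close>
    have Pi_eq: "Pi_pmf (V - D) d (\<lambda>_. ?q) = bind_pmf ?q (\<lambda>hs. map_pmf (\<lambda>T'. T'(v := hs)) (Pi_pmf U d (\<lambda>_. ?q)))"
      unfolding U(1) using U by (subst Pi_pmf_insert') (auto simp: map_pmf_def)
    have "measure_pmf.prob (Pi_pmf (V - D) d (\<lambda>_. ?q)) {T'. good_table L R V E (\<lambda>u. if u \<in> D then T u else T' u)}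
       = measure (measure_spmf (spmf_of_pmf (Pi_pmf (V - D) d (\<lambda>_. ?q)))) {T'. good_table L R V E (\<lambda>u. if u \<in> D then T u else T' u)}"
      by simp
    also have "\<dots> = measure (measure_spmf (spmf_of_pmf ?q \<bind> (\<lambda>hs. spmf_of_pmf (map_pmf (\<lambda>T'. T'(v := hs)) (Pi_pmf U d (\<lambda>_. ?q))))))
        {T'. good_table L R V E (\<lambda>u. if u \<in> D then T u else T' u)}"
      unfolding Pi_eq spmf_of_pmf_bind by simp
    also have "\<dots>
       = (\<integral>hs. measure_pmf.prob (Pi_pmf U d (\<lambda>_. ?q)) (G hs) \<partial>measure_spmf (spmf_of_pmf ?q))"
    proof (subst measure_bind_spmf, intro Bochner_Integration.integral_cong refl)
      fix hs
      have "(\<lambda>u. if u \<in> D then T u else (T'(v := hs)) u) = (\<lambda>u. if u \<in> insert v D then (T(v := hs)) u else T' u)" for T'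
        using v by auto
      then show "measure (measure_spmf (spmf_of_pmf (map_pmf (\<lambda>T'. T'(v := hs)) (Pi_pmf U d (\<lambda>_. ?q)))))
          {T'. good_table L R V E (\<lambda>u. if u \<in> D then T u else T' u)} = measure_pmf.prob (Pi_pmf U d (\<lambda>_. ?q)) (G hs)"
        by (simp add: vimage_def G_def)
    qed
    also have "\<dots> \<le> (\<integral>hs. measure (measure_spmf (?W (grow_step L \<rho> R E st hs))) ?R \<partial>measure_spmf (spmf_of_pmf ?q))"
    proof (rule integral_mono_AE)
      show "integrable (measure_spmf (spmf_of_pmf ?q)) (\<lambda>hs. measure_pmf.prob (Pi_pmf U d (\<lambda>_. ?q)) (G hs))"
        by (intro measure_spmf.integrable_const_bound[where B=1]) auto
      show "AE hs in measure_spmf (spmf_of_pmf ?q). measure_pmf.prob (Pi_pmf U d (\<lambda>_. ?q)) (G hs)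
          \<le> measure (measure_spmf (?W (grow_step L \<rho> R E st hs))) ?R"
      proof (rule AE_I2)
        fix hs
        show "measure_pmf.prob (Pi_pmf U d (\<lambda>_. ?q)) (G hs) \<le> measure (measure_spmf (?W (grow_step L \<rho> R E st hs))) ?R"
        proof (cases "approx (anc_estimate L R E (T(v := hs)) v) (card (anc E v))")
          case True
          have "grow_inv L \<rho> V E (insert v D) (T(v := hs)) (grow_step L \<rho> R E st hs)"
            unfolding st Cons by (rule grow_inv_step[OF V less.prems[unfolded st Cons] True])
          then show ?thesis
            unfolding G_def U_def
          proof (intro less.hyps)
            show "card (V - insert v D) < card (V - D)"
              by (rule psubset_card_mono) (use v V(1) in auto)
          qed
        next
          \<comment> \<open>All ancestors of \<open>v\<close> have been revealed by now. If the
            estimate for \<open>v\<close> is inaccurate, no completion of the table is good and the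
            left-hand side is 0.\<close>
          case False
          have "anc_estimate L R E (\<lambda>u. if u \<in> insert v D then (T(v := hs)) u else T' u) v = anc_estimate L R E (T(v := hs)) v" for T'
          proof -
            have "(\<lambda>u. (if u \<in> insert v D then (T(v := hs)) u else T' u) ! j) ` anc E v = (\<lambda>u. (T(v := hs)) u ! j) ` anc E v" for j
              using ancv by (intro image_cong) auto
            then show ?thesis unfolding anc_estimate_def by simp
          qed
          then have "G hs = {}" using False v unfolding G_def good_table_def by (metis (no_types, lifting) Diff_iff empty_Collect_eq)
          then show ?thesis by simp
        qed
      qed
    qed (rule integrable_measure_spmf_le_1)
    also have "\<dots> = measure (measure_spmf (?W st)) ?R"
    proof -
      have "?W st = spmf_of_pmf ?q \<bind> (\<lambda>hs. ?W (grow_step L \<rho> R E st hs))"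
        by (subst while_spmf.simps) (simp only: st Cons prod.case bind_map_spmf comp_def list.distinct simp_thms if_True)
      then show ?thesis by (simp only: measure_bind_spmf)
    qed
    finally show ?thesis .
  qed
qed

lemma grow_small_subgraph_altdef:
  "grow_small_subgraph L \<rho> V E = map_spmf (\<lambda>(Q, X, \<sigma>, \<tau>). (X, \<tau>))
     (while_spmf (\<lambda>(Q, X, \<sigma>, \<tau>). Q \<noteq> [])
        (\<lambda>st. map_spmf (grow_step L \<rho> (hash_range (card V)) E st)
           (spmf_of_pmf (replicate_pmf L (pmf_of_set {1..hash_range (card V)}))))
        (list_of {v \<in> V. preds E v = {}}, {}, (\<lambda>_. []), 0))"
  unfolding grow_small_subgraph_def grow_step_def map_spmf_conv_bind_spmf Let_def
  by (simp add: case_prod_unfold)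

lemma card_in_edges:
  assumes "finite E" "finite D"
  shows "(\<Sum>v\<in>D. card (preds E v)) = card {(u, v) \<in> E. v \<in> D}"
proof -
  have "card {(u, v) \<in> E. v \<in> D} = card ((\<lambda>(v, u). (u, v)) ` (SIGMA v:D. preds E v))"
    by (rule arg_cong[where f=card]) (auto simp: preds_def image_iff)
  also have "\<dots> = card (SIGMA v:D. preds E v)" by (rule card_image) (auto simp: inj_on_def)
  also have "\<dots> = (\<Sum>v\<in>D. card (preds E v))" using assms by (intro card_SigmaI) auto
  finally show ?thesis ..
qed

lemma card_out_edges:
  assumes "finite E" "finite D"
  shows "(\<Sum>v\<in>D. card (succs E v)) = card {(u, v) \<in> E. u \<in> D}"
proof -
  have fin: "finite (succs E v)" for v
    by (rule finite_subset[of _ "snd ` E"]) (use assms in \<open>auto simp: succs_def intro: rev_image_eqI\<close>)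
  have "{(u, v) \<in> E. u \<in> D} = (SIGMA v:D. succs E v)" by (auto simp: succs_def)
  then show ?thesis using assms fin by (subst card_SigmaI[symmetric]) auto
qed

definition incident :: "('a \<times> 'a) set \<Rightarrow> 'a set \<Rightarrow> ('a \<times> 'a) set" where
  "incident E X = {(u, v) \<in> E. u \<in> X \<or> v \<in> X}"

text \<open>The clause on \<open>V - X\<close> is the reason for the lower bound on start times:
  each vertex left over depends on one with more than \<rho> ancestors, possibly itself.\<close>

definition part_ok :: "nat \<Rightarrow> nat \<Rightarrow> 'a set \<Rightarrow> ('a \<times> 'a) set \<Rightarrow> 'a set \<times> nat \<Rightarrow> bool" where
  "part_ok L \<rho> V E = (\<lambda>(X, \<tau>). X \<subseteq> V \<and> X \<noteq> {} \<and> (\<forall>v\<in>X. preds E v \<subseteq> X) \<and>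
     (\<forall>v\<in>X. card (anc E v) \<le> 2 * \<rho>) \<and> (\<forall>v\<in>V - X. \<exists>w\<in>anc E v. card (anc E w) > \<rho>) \<and>
     \<tau> \<le> 6914 * L * (card X + card (incident E X)))"

text \<open>A minimal unmarked ancestor of an unmarked vertex has only marked predecessors, so with
  an empty queue it has been dequeued and rejected; hence its cone is large. Sources have a single
  ancestor and are never rejected as \<rho> \<ge> 1, which makes \<open>X\<close> nonempty.\<close>

lemma grow_inv_part_ok:
  fixes V :: "'a set"
  assumes V: "finite V" "E \<subseteq> V \<times> V" "acyclic E" "V \<noteq> {}" and L: "L \<ge> 1" and \<rho>: "\<rho> \<ge> 1"
    and inv: "grow_inv L \<rho> V E D T ([], X, \<sigma>, \<tau>)"
  shows "part_ok L \<rho> V E (X, \<tau>)"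
proof -
  have finE: "finite E" using V finite_subset[OF V(2)] by simp
  have i: "X \<subseteq> D" "D \<subseteq> V" "\<And>w. w \<in> D \<Longrightarrow> preds E w \<subseteq> X"
    and Q: "{w \<in> V. preds E w \<subseteq> X} \<subseteq> D"
    and lo: "\<And>w. w \<in> X \<Longrightarrow> card (anc E w) \<le> 2 * \<rho>" and hi: "\<And>w. w \<in> D - X \<Longrightarrow> card (anc E w) > \<rho>"
    and \<tau>: "\<tau> = (\<Sum>v\<in>D. 1 + sketch_time L (1 + card (preds E v))) + (\<Sum>v\<in>X. card (succs E v))"
    using inv by (auto simp: grow_inv_def)
  have finD: "finite D" by (rule finite_subset[OF i(2) V(1)])
  have finX: "finite X" by (rule finite_subset[OF i(1) finD])
  have wfE: "wf E" by (rule finite_acyclic_wf[OF finE V(3)])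
  have source: "w \<in> X" if "w \<in> D" "preds E w = {}" for w
  proof (rule ccontr)
    assume "w \<notin> X"
    then have "card (anc E w) > \<rho>" using hi that by blast
    moreover have "anc E w = {w}" using anc_rec[of E w] that(2) by simp
    ultimately show False using \<rho> by simp
  qed
  have min: "\<exists>w\<in>anc E v. w \<in> D - X" if v: "v \<in> V - X" for v
  proof -
    have "v \<in> anc E v - X" using v by simp
    then obtain w where w: "w \<in> anc E v - X" "\<And>y. (y, w) \<in> E \<Longrightarrow> y \<notin> anc E v - X"
      using wfE_min[OF wfE] by metis
    have "preds E w \<subseteq> X"
    proof
      fix y assume "y \<in> preds E w"
      then have e: "(y, w) \<in> E" by (simp add: preds_def)
      then have "y \<in> anc E v" using w(1) by (auto simp: anc_def)
      then show "y \<in> X" using w(2)[OF e] by blast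
    qed
    moreover have "w \<in> V" using w(1) anc_subset[OF V(2), of v] v by blast
    ultimately have "w \<in> D" using Q by blast
    then show ?thesis using w(1) by blast
  qed
  have "X \<noteq> {}"
  proof
    assume e: "X = {}"
    obtain v where "v \<in> V - X" using V(4) e by blast
    then obtain w where w: "w \<in> D - X" using min by blast
    then have "preds E w = {}" using i(3)[of w] e by blast
    then show False using source w by blast
  qed
  moreover have "\<exists>w\<in>anc E v. card (anc E w) > \<rho>" if "v \<in> V - X" for v using min[OF that] hi by blast
  moreover have "\<tau> \<le> 6914 * L * (card X + card (incident E X))"
  proof -
    let ?I = "card (incident E X)"
    have finI: "finite (incident E X)" by (rule finite_subset[OF _ finE]) (auto simp: incident_def)
    have in_le: "(\<Sum>v\<in>D. card (preds E v)) \<le> ?I"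
      unfolding card_in_edges[OF finE finD]
      using i(3) by (intro card_mono finI) (auto simp: incident_def preds_def)
    have out_le: "(\<Sum>v\<in>X. card (succs E v)) \<le> ?I"
      unfolding card_out_edges[OF finE finX] by (intro card_mono finI) (auto simp: incident_def)
    \<comment> \<open>A rejected vertex is not a source, so it can be charged to an edge that enters
      it from \<open>X\<close>.\<close>
    have "card (D - X) = (\<Sum>v\<in>D - X. 1)" by simp
    also have "\<dots> \<le> (\<Sum>v\<in>D - X. card (preds E v))"
    proof (rule sum_mono)
      fix v assume "v \<in> D - X"
      then have "preds E v \<noteq> {}" using source by blast
      then show "1 \<le> card (preds E v)" using finE by (simp add: Suc_le_eq card_gt_0_iff)
    qed
    also have "\<dots> \<le> (\<Sum>v\<in>D. card (preds E v))" using finD by (intro sum_mono2) auto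
    finally have "card (D - X) \<le> ?I" using in_le by simp
    moreover have "card D = card X + card (D - X)"
      using i(1) finD finX by (simp add: card_Diff_subset card_mono)
    ultimately have cD: "card D \<le> card X + ?I" by simp
    have "(\<Sum>v\<in>D. 1 + sketch_time L (1 + card (preds E v)))
        = (\<Sum>v\<in>D. (1 + 3456 * L) + 3456 * L * card (preds E v))"
      by (rule sum.cong) (auto simp: sketch_time_def sketch_size_def algebra_simps)
    also have "\<dots> = card D * (1 + 3456 * L) + 3456 * L * (\<Sum>v\<in>D. card (preds E v))"
      by (simp only: sum.distrib sum_constant sum_distrib_left) (simp add: algebra_simps)
    also have "\<dots> \<le> (card X + ?I) * (1 + 3456 * L) + 3456 * L * ?I"
      using cD in_le by (intro add_mono mult_mono) auto
    finally have "\<tau> \<le> (card X + ?I) * (1 + 3456 * L) + 3456 * L * ?I + ?I" using \<tau> out_le by linarith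
    also have "\<dots> \<le> (card X + ?I) * (1 + 3456 * L) + (card X + ?I) * (3456 * L + 1)" by (simp add: algebra_simps)
    also have "\<dots> = (card X + ?I) * (2 + 6912 * L)" by (simp add: algebra_simps)
    \<comment> \<open>6912 is twice the 3456 = 4 * 864 of \<open>sketch_time\<close>, once for
      dequeued vertices and once for their incoming edges; the remaining 2 is absorbed by
      \<open>L \<ge> 1\<close>.\<close>
    also have "\<dots> \<le> (card X + ?I) * (6914 * L)" using L by (intro mult_left_mono) auto
    finally show ?thesis by (simp only: mult.commute)
  qed
  moreover have "\<forall>v\<in>X. preds E v \<subseteq> X" using i(1,3) by blast
  ultimately show ?thesis using i(1,2) lo by (simp add: part_ok_def)
qed

lemma whp_grow_small_subgraph:
  fixes V :: "'a set"
  assumes V: "finite V" "E \<subseteq> V \<times> V" "acyclic E" "V \<noteq> {}" and L: "L \<ge> 1" and \<rho>: "\<rho> \<ge> 1"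
  shows "whp (real (card V) * (11/16) ^ L) (grow_small_subgraph L \<rho> V E) (part_ok L \<rho> V E)"
  unfolding grow_small_subgraph_altdef
proof (rule whp_map)
  define R where "R = hash_range (card V)"
  let ?W = "while_spmf (\<lambda>(Q, X, \<sigma>, \<tau>). Q \<noteq> [])
        (\<lambda>st. map_spmf (grow_step L \<rho> R E st) (spmf_of_pmf (replicate_pmf L (pmf_of_set {1..R}))))
        (list_of {v \<in> V. preds E v = {}}, {}, (\<lambda>_. []), 0)"
  have "finite {v \<in> V. preds E v = {}}" using V(1) by simp
  note lo = list_of[OF this]
  have inv: "grow_inv L \<rho> V E {} (\<lambda>_. []) (list_of {v \<in> V. preds E v = {}}, {}, (\<lambda>_. []), 0)"
    using lo by (auto simp: grow_inv_def)
  have "1 - real (card V) * (11/16) ^ L \<le> measure_pmf.prob (Pi_pmf V [] (\<lambda>_. replicate_pmf L (pmf_of_set {1..R}))) {T. good_table L R V E T}"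
    unfolding R_def by (rule prob_good_table[OF V(1,2)])
  also have "\<dots> \<le> measure (measure_spmf ?W) {(Q, X, \<sigma>, \<tau>). Q = [] \<and> (\<exists>D T. grow_inv L \<rho> V E D T (Q, X, \<sigma>, \<tau>))}"
    using grow_loop[OF V(1-3) inv, of "[]" R] by simp
  finally have "whp (real (card V) * (11/16) ^ L) ?W (\<lambda>(Q, X, \<sigma>, \<tau>). Q = [] \<and> (\<exists>D T. grow_inv L \<rho> V E D T (Q, X, \<sigma>, \<tau>)))"
    by (simp add: whp_def case_prod_unfold)
  then show "whp (real (card V) * (11/16) ^ L)
     (while_spmf (\<lambda>(Q, X, \<sigma>, \<tau>). Q \<noteq> [])
        (\<lambda>st. map_spmf (grow_step L \<rho> (hash_range (card V)) E st)
           (spmf_of_pmf (replicate_pmf L (pmf_of_set {1..hash_range (card V)}))))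
        (list_of {v \<in> V. preds E v = {}}, {}, (\<lambda>_. []), 0))
     (\<lambda>x. part_ok L \<rho> V E (case x of (Q, X, \<sigma>, \<tau>) \<Rightarrow> (X, \<tau>)))"
    unfolding R_def by (rule whp_mono) (auto intro: grow_inv_part_ok[OF V L \<rho>])
qed

section \<open>Lower bounds on start times in an arbitrary feasible schedule\<close>

lemma feasible_pred:
  assumes "feasible V E M \<rho> S" "(\<mu>, v, t) \<in> S" "(u, v) \<in> E"
  shows "(\<exists>t'. (\<mu>, u, t') \<in> S \<and> t' + 1 \<le> t) \<or>
        (\<exists>\<mu>' t'. \<mu>' \<noteq> \<mu> \<and> (\<mu>', u, t') \<in> S \<and> t' + 1 + \<rho> \<le> t)"
  using assms unfolding feasible_def by (elim conjE) (drule (1) bspec, simp)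

lemma feasible_anc_earlier:
  assumes f: "feasible V E M \<rho> S" and v: "(\<mu>, v, t) \<in> S" and u: "(u, v) \<in> E\<^sup>*"
  shows "\<exists>\<mu>' t'. (\<mu>', u, t') \<in> S \<and> t' \<le> t"
  using u
proof (induction rule: converse_rtrancl_induct)
  case (step y z)
  then obtain \<mu>' t' where z: "(\<mu>', z, t') \<in> S" "t' \<le> t" by blast
  from feasible_pred[OF f z(1) step(1)] z(2) show ?case by force
qed (use v in blast)

lemma large_cone_delay:
  assumes f: "feasible V E M \<rho> S" and early: "\<And>\<mu> v t. (\<mu>, v, t) \<in> S \<Longrightarrow> v \<in> G \<Longrightarrow> s \<le> t"
    and w: "w \<in> G" "card (anc (induced E G) w) > \<rho>" and t: "(\<mu>, w, t) \<in> S"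
  shows "s + \<rho> \<le> t"
proof (rule ccontr)
  assume neg: "\<not> s + \<rho> \<le> t"
  have path: "\<exists>t'. (\<mu>, u, t') \<in> S \<and> s \<le> t' \<and> t' \<le> t" if "(u, w) \<in> (induced E G)\<^sup>*" for u
    using that
  proof (induction rule: converse_rtrancl_induct)
    case base
    show ?case using t early[OF t w(1)] by blast
  next
    case (step y z)
    then obtain t' where z: "(\<mu>, z, t') \<in> S" "t' \<le> t" by blast
    have yz: "(y, z) \<in> E" "y \<in> G" using step(1) by (auto simp: induced_def)
    from feasible_pred[OF f z(1) yz(1)] show ?case
    proof
      assume "\<exists>t''. (\<mu>, y, t'') \<in> S \<and> t'' + 1 \<le> t'"
      then obtain t'' where "(\<mu>, y, t'') \<in> S" "t'' + 1 \<le> t'" by blast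
      then show ?thesis using early[of \<mu> y t''] yz(2) z(2) by (intro exI[of _ t'']) simp
    next
      assume "\<exists>\<mu>' t''. \<mu>' \<noteq> \<mu> \<and> (\<mu>', y, t'') \<in> S \<and> t'' + 1 + \<rho> \<le> t'"
      then obtain \<mu>' t'' where y: "(\<mu>', y, t'') \<in> S" "t'' + 1 + \<rho> \<le> t'" by blast
      then show ?thesis using early[OF y(1) yz(2)] z(2) neg by simp
    qed
  qed
  then have "\<forall>u\<in>anc (induced E G) w. \<exists>t'. (\<mu>, u, t') \<in> S \<and> s \<le> t' \<and> t' \<le> t"
    by (auto simp: anc_def)
  then obtain h where h: "\<And>u. u \<in> anc (induced E G) w \<Longrightarrow> (\<mu>, u, h u) \<in> S \<and> s \<le> h u \<and> h u \<le> t"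
    by metis
  \<comment> \<open>Distinct jobs on one machine occupy distinct slots, and \<open>{s..t}\<close>
    has at most \<rho> of them if t < s + \<rho>: too few for the cone.\<close>
  have "inj_on h (anc (induced E G) w)"
  proof (rule inj_onI)
    fix u u' assume "u \<in> anc (induced E G) w" "u' \<in> anc (induced E G) w" "h u = h u'"
    then have "(\<mu>, u, h u) \<in> S" "(\<mu>, u', h u) \<in> S" using h[of u] h[of u'] by auto
    then show "u = u'" using f unfolding feasible_def by blast
  qed
  moreover have "h ` anc (induced E G) w \<subseteq> {s..t}" using h by auto
  ultimately have "card (anc (induced E G) w) \<le> card {s..t}" by (rule card_inj_on_le) simp
  then show False using w(2) neg by simp
qed

definition part_fits :: "nat \<Rightarrow> ('a \<times> 'a) set \<Rightarrow> 'a set \<Rightarrow> 'a set \<times> ('a \<times> 'a) set \<Rightarrow> bool" where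
  "part_fits \<rho> E D = (\<lambda>(X, F). F = induced E X \<and> D \<inter> X = {} \<and>
     (\<forall>u v. (u, v) \<in> E \<longrightarrow> v \<in> X \<longrightarrow> u \<in> D \<union> X) \<and> (\<forall>v\<in>X. card (anc F v) \<le> 2 * \<rho>))"

primrec parts_fit :: "nat \<Rightarrow> ('a \<times> 'a) set \<Rightarrow> 'a set \<Rightarrow> ('a set \<times> ('a \<times> 'a) set) list \<Rightarrow> bool" where
  "parts_fit \<rho> E D [] \<longleftrightarrow> True"
| "parts_fit \<rho> E D (H # Hs) \<longleftrightarrow> part_fits \<rho> E D H \<and> parts_fit \<rho> E (D \<union> fst H) Hs"

lemma parts_fit_snoc:
  "parts_fit \<rho> E D (Hs @ [H]) \<longleftrightarrow> parts_fit \<rho> E D Hs \<and> part_fits \<rho> E (D \<union> \<Union> (fst ` set Hs)) H"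
  by (induction Hs arbitrary: D) (auto simp: Un_assoc)

text \<open>The start times are bounded for all feasible schedules at once, so no schedule has to
  exist at this point. The clause for \<open>j - 1\<close> keeps a witness in \<open>V\<close>,
  because the bound for \<open>V1\<close> becomes vacuous when \<open>V1\<close> is empty; losing
  one round this way gives the additive \<rho> in the bound on the number of parts.\<close>

definition partition_inv where
  "partition_inv L M \<rho> V E j = (\<lambda>((V1, E1), Hs, \<tau>).
     V1 \<subseteq> V \<and> E1 = induced E V1 \<and> card V1 + j \<le> card V \<and> length Hs = j \<and>
     (\<forall>u v. (u, v) \<in> E \<longrightarrow> v \<notin> V1 \<longrightarrow> u \<notin> V1) \<and>
     parts_fit \<rho> E {} Hs \<and> \<Union> (fst ` set Hs) = V - V1 \<and>
     (\<Sum>H\<leftarrow>Hs. card (fst H)) + card V1 = card V \<and> (\<Sum>H\<leftarrow>Hs. card (snd H)) + card E1 \<le> card E \<and>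
     (\<forall>S \<mu> v t. feasible V E M \<rho> S \<longrightarrow> (\<mu>, v, t) \<in> S \<longrightarrow> v \<in> V1 \<longrightarrow> \<rho> * j \<le> t) \<and>
     (j > 0 \<longrightarrow> (\<exists>v\<in>V. \<forall>S \<mu> t. feasible V E M \<rho> S \<longrightarrow> (\<mu>, v, t) \<in> S \<longrightarrow> \<rho> * (j - 1) \<le> t)) \<and>
     \<tau> + 6916 * L * (card V1 + card E1) \<le> card V + card E + 6916 * L * (card V + card E))"

lemma whp_partition_graph:
  fixes V :: "'a set"
  assumes V: "finite V" "E \<subseteq> V \<times> V" "acyclic E" and L: "L \<ge> 1" and \<rho>: "\<rho> \<ge> 1" and M: "M \<ge> 1"
    and \<eta>: "(11/16) ^ L \<le> \<eta>"
  shows "whp (real (card V) ^ 2 * \<eta>) (partition_graph L \<rho> V E) (\<lambda>(Hs, \<tau>).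
     parts_fit \<rho> E {} Hs \<and> \<Union> (fst ` set Hs) = V \<and> length Hs \<le> card V \<and>
     (\<Sum>H\<leftarrow>Hs. card (fst H)) = card V \<and> (\<Sum>H\<leftarrow>Hs. card (snd H)) \<le> card E \<and>
     (\<forall>S. feasible V E M \<rho> S \<longrightarrow> length Hs * \<rho> \<le> makespan S + \<rho>) \<and>
     \<tau> \<le> 6917 * L * (card V + card E))"
proof -
  have finE: "finite E" using V finite_subset[OF V(2)] by simp
  have \<eta>0: "\<eta> \<ge> 0" using \<eta> by (rule order_trans[rotated]) simp
  define I where "I = partition_inv L M \<rho> V E"
  define \<delta> where "\<delta> = real (card V) * \<eta>"
  have \<delta>0: "\<delta> \<ge> 0" using \<eta>0 by (simp add: \<delta>_def)
  let ?guard = "\<lambda>((V, E), Hs, \<tau>). V \<noteq> {}"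
  let ?body = "\<lambda>((V, E), Hs, \<tau>). do {
        (X, \<tau>\<^sub>X) \<leftarrow> grow_small_subgraph L \<rho> V E;
        return_spmf
          ((V - X, induced E (V - X)), Hs @ [(X, induced E X)],
           \<tau> + \<tau>\<^sub>X + 1 + card X + card {(u, v) \<in> E. u \<in> X \<or> v \<in> X})
      }"
  have init: "I 0 ((V, E), [], card V + card E)"
    using V(2) by (auto simp: I_def partition_inv_def induced_def)
  have step: "j < card V \<and> whp \<delta> (?body st) (I (Suc j))" if inv: "I j st" and gd: "?guard st" for j st
  proof -
    obtain V1 E1 Hs \<tau>1 where st: "st = ((V1, E1), Hs, \<tau>1)" by (metis prod_cases3 surj_pair)
    have V1: "V1 \<subseteq> V" "V1 \<noteq> {}" and E1: "E1 = induced E V1" and cV1: "card V1 + j \<le> card V" and len: "length Hs = j"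
      and cl: "\<And>u v. (u, v) \<in> E \<Longrightarrow> v \<notin> V1 \<Longrightarrow> u \<notin> V1"
      and fit: "parts_fit \<rho> E {} Hs" and un: "\<Union> (fst ` set Hs) = V - V1"
      and sV: "(\<Sum>H\<leftarrow>Hs. card (fst H)) + card V1 = card V" and sE: "(\<Sum>H\<leftarrow>Hs. card (snd H)) + card E1 \<le> card E"
      and late: "\<And>S \<mu> v t. feasible V E M \<rho> S \<Longrightarrow> (\<mu>, v, t) \<in> S \<Longrightarrow> v \<in> V1 \<Longrightarrow> \<rho> * j \<le> t"
      and \<tau>1: "\<tau>1 + 6916 * L * (card V1 + card E1) \<le> card V + card E + 6916 * L * (card V + card E)"
      using inv[unfolded I_def partition_inv_def st prod.case] gd by (auto simp: st)
    have finV1: "finite V1" by (rule finite_subset[OF V1(1) V(1)])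
    have E1V: "E1 \<subseteq> V1 \<times> V1" "acyclic E1" "finite E1"
      using V(3) finE by (auto simp: E1 induced_def intro: acyclic_subset)
    have cV1p: "card V1 > 0" using finV1 V1 by (simp add: card_gt_0_iff)
    have grow: "whp \<delta> (grow_small_subgraph L \<rho> V1 E1) (part_ok L \<rho> V1 E1)"
      by (rule whp_mono[OF whp_grow_small_subgraph[OF finV1 E1V(1,2) V1(2) L \<rho>]])
        (use cV1 \<eta> in \<open>auto simp: \<delta>_def intro!: mult_mono\<close>)
    have "whp (\<delta> + 0) (?body st) (I (Suc j))"
      unfolding st prod.case
    proof (rule whp_bind[OF grow])
      fix R assume ok: "part_ok L \<rho> V1 E1 R"
      obtain X \<tau>X where R: "R = (X, \<tau>X)" by (cases R)
      have X: "X \<subseteq> V1" "X \<noteq> {}" and Xcl: "\<And>v. v \<in> X \<Longrightarrow> preds E1 v \<subseteq> X"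
        and lo: "\<And>v. v \<in> X \<Longrightarrow> card (anc E1 v) \<le> 2 * \<rho>"
        and hi: "\<And>v. v \<in> V1 - X \<Longrightarrow> \<exists>w\<in>anc E1 v. card (anc E1 w) > \<rho>"
        and \<tau>X: "\<tau>X \<le> 6914 * L * (card X + card (incident E1 X))"
        using ok by (auto simp: part_ok_def R)
      define V2 where "V2 = V1 - X"
      define E2 where "E2 = induced E1 V2"
      define F where "F = induced E1 X"
      have finX: "finite X" by (rule finite_subset[OF X(1) finV1])
      have cXp: "card X > 0" using finX X by (simp add: card_gt_0_iff)
      have cV2: "card V2 + card X = card V1" using finX X finV1 by (simp add: V2_def card_Diff_subset card_mono)
      have E2: "E2 = induced E V2" "F = induced E X"
        using X by (auto simp: E2_def F_def E1 V2_def induced_def)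
      have finI: "finite (incident E1 X)" by (rule finite_subset[OF _ E1V(3)]) (auto simp: incident_def)
      have cE2: "card E2 + card (incident E1 X) = card E1"
      proof -
        have "E1 = E2 \<union> incident E1 X" using E1V(1) by (auto simp: E2_def V2_def induced_def incident_def)
        moreover have "E2 \<inter> incident E1 X = {}" by (auto simp: E2_def V2_def induced_def incident_def)
        moreover have "finite E2" using E1V(3) by (simp add: E2_def induced_def)
        ultimately show ?thesis using finI by (metis card_Un_disjoint)
      qed
      have cF: "card F \<le> card (incident E1 X)"
        by (rule card_mono[OF finI]) (auto simp: F_def induced_def incident_def)
      have E1cl: "u \<in> X" if "(u, v) \<in> E1" "v \<in> X" for u v
        using Xcl[OF that(2)] that(1) by (auto simp: preds_def)
      have cl2: "u \<notin> V2" if "(u, v) \<in> E" "v \<notin> V2" for u v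
      proof (cases "v \<in> V1")
        case True
        then have "v \<in> X" using that by (simp add: V2_def)
        show ?thesis
        proof
          assume "u \<in> V2"
          then have "(u, v) \<in> E1" using that True by (auto simp: E1 V2_def induced_def)
          then show False using E1cl \<open>v \<in> X\<close> \<open>u \<in> V2\<close> by (auto simp: V2_def)
        qed
      next
        case False
        then show ?thesis using cl[OF that(1)] by (simp add: V2_def)
      qed
      have fits: "part_fits \<rho> E (V - V1) (X, F)"
      proof -
        have "u \<in> (V - V1) \<union> X" if e: "(u, v) \<in> E" "v \<in> X" for u v
        proof (cases "u \<in> V1")
          case True
          then have "(u, v) \<in> E1" using e X by (auto simp: E1 induced_def)
          then show ?thesis using E1cl e(2) by blast
        qed (use e(1) V(2) in auto)
        moreover have "card (anc F v) \<le> 2 * \<rho>" if "v \<in> X" for v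
        proof -
          have "anc F v = anc E1 v" unfolding F_def by (rule anc_closed(2)[OF E1cl that])
          then show ?thesis using lo[OF that] by simp
        qed
        ultimately show ?thesis using E2(2) X by (auto simp: part_fits_def)
      qed
      \<comment> \<open>The large ancestor \<open>w\<close> of \<open>v\<close> is still in
        \<open>V1\<close>, where everything starts at \<rho> j or later; so \<open>w\<close> starts
        at \<rho> (j + 1) or later, and some copy of \<open>w\<close> starts no later than this copy
        of \<open>v\<close>.\<close>
      have late2: "\<rho> * Suc j \<le> t" if f: "feasible V E M \<rho> S" and t: "(\<mu>, v, t) \<in> S" and v: "v \<in> V2" for S \<mu> v t
      proof -
        obtain w where w: "w \<in> anc E1 v" "card (anc E1 w) > \<rho>" using hi v by (auto simp: V2_def)
        have "(w, v) \<in> E\<^sup>*" using w(1) anc_mono[of E1 E v] by (auto simp: E1 induced_def anc_def)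
        from feasible_anc_earlier[OF f t this] obtain \<mu>' t' where wt: "(\<mu>', w, t') \<in> S" "t' \<le> t" by blast
        have "w \<in> V1" using w(1) anc_subset[OF E1V(1), of v] v by (auto simp: V2_def)
        have "\<rho> * j + \<rho> \<le> t'"
          by (rule large_cone_delay[OF f late[OF f] \<open>w \<in> V1\<close> w(2)[unfolded E1] wt(1)])
        then show ?thesis using wt(2) by simp
      qed
      have wit: "\<exists>v\<in>V. \<forall>S \<mu> t. feasible V E M \<rho> S \<longrightarrow> (\<mu>, v, t) \<in> S \<longrightarrow> \<rho> * (Suc j - 1) \<le> t"
      proof -
        obtain v where "v \<in> V1" using V1 by blast
        then show ?thesis using late V1 by (intro bexI[of _ v]) auto
      qed
      have \<tau>2: "(\<tau>1 + \<tau>X + 1 + card X + card (incident E1 X)) + 6916 * L * (card V2 + card E2)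
          \<le> card V + card E + 6916 * L * (card V + card E)"
      proof -
        have "1 + card X + card (incident E1 X) \<le> 2 * (card X + card (incident E1 X))" using cXp by simp
        also have "\<dots> \<le> 2 * L * (card X + card (incident E1 X))" using L by (intro mult_right_mono) auto
        finally have "\<tau>X + 1 + card X + card (incident E1 X) \<le> 6916 * L * (card X + card (incident E1 X))"
          using \<tau>X by (simp add: algebra_simps)
        moreover have "6916 * L * (card V1 + card E1) = 6916 * L * (card V2 + card E2) + 6916 * L * (card X + card (incident E1 X))"
          unfolding cV2[symmetric] cE2[symmetric] by (simp add: algebra_simps)
        ultimately show ?thesis using \<tau>1 by linarith
      qed
      have "I (Suc j) ((V2, E2), Hs @ [(X, F)], \<tau>1 + \<tau>X + 1 + card X + card (incident E1 X))"
        unfolding I_def partition_inv_def prod.case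
      proof (intro conjI)
        show "V2 \<subseteq> V" "E2 = induced E V2" "card V2 + Suc j \<le> card V" "length (Hs @ [(X, F)]) = Suc j"
          using V1 E2 cV2 cXp cV1 len by (auto simp: V2_def)
        show "\<forall>u v. (u, v) \<in> E \<longrightarrow> v \<notin> V2 \<longrightarrow> u \<notin> V2" using cl2 by blast
        show "parts_fit \<rho> E {} (Hs @ [(X, F)])" unfolding parts_fit_snoc using fit fits un by simp
        show "\<Union> (fst ` set (Hs @ [(X, F)])) = V - V2" using un X V1 by (auto simp: V2_def)
        show "(\<Sum>H\<leftarrow>Hs @ [(X, F)]. card (fst H)) + card V2 = card V" using sV cV2 by simp
        show "(\<Sum>H\<leftarrow>Hs @ [(X, F)]. card (snd H)) + card E2 \<le> card E" using sE cE2 cF by simp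
        show "\<forall>S \<mu> v t. feasible V E M \<rho> S \<longrightarrow> (\<mu>, v, t) \<in> S \<longrightarrow> v \<in> V2 \<longrightarrow> \<rho> * Suc j \<le> t"
          using late2 by blast
        show "0 < Suc j \<longrightarrow> (\<exists>v\<in>V. \<forall>S \<mu> t. feasible V E M \<rho> S \<longrightarrow> (\<mu>, v, t) \<in> S \<longrightarrow> \<rho> * (Suc j - 1) \<le> t)"
          using wit by blast
      qed (rule \<tau>2)
      then show "whp 0 (case R of (X, \<tau>\<^sub>X) \<Rightarrow> return_spmf
          ((V1 - X, induced E1 (V1 - X)), Hs @ [(X, induced E1 X)],
           \<tau>1 + \<tau>\<^sub>X + 1 + card X + card {(u, v) \<in> E1. u \<in> X \<or> v \<in> X})) (I (Suc j))"
        by (simp add: R whp_return V2_def E2_def F_def incident_def)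
    qed simp
    then show ?thesis using cV1p cV1 by simp
  qed
  have "whp (real (card V) * \<delta>) (while_spmf ?guard ?body ((V, E), [], card V + card E))
    (\<lambda>s. \<exists>j\<le>card V. I j s \<and> \<not> ?guard s)"
    by (rule whp_while_count[where I=I, OF init step \<delta>0])
  then have "whp (real (card V) ^ 2 * \<eta>) (while_spmf ?guard ?body ((V, E), [], card V + card E))
    (\<lambda>s. \<exists>j\<le>card V. I j s \<and> \<not> ?guard s)"
    by (simp add: \<delta>_def power2_eq_square mult.assoc)
  then show ?thesis
    unfolding partition_graph_def
  proof (intro whp_map, elim whp_mono, goal_cases)
    case (2 s)
    then obtain j where j: "I j s" "\<not> ?guard s" by blast
    obtain V1 E1 Hs \<tau>1 where s: "s = ((V1, E1), Hs, \<tau>1)" by (metis prod_cases3 surj_pair)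
    have V1: "V1 = {}" using j(2) by (simp add: s)
    note i = j(1)[unfolded I_def partition_inv_def s prod.case V1]
    have E1: "E1 = {}" using i by (simp add: induced_def)
    have ms: "length Hs * \<rho> \<le> makespan S + \<rho>" if f: "feasible V E M \<rho> S" for S
    proof (cases "j = 0")
      case True
      then show ?thesis using i by simp
    next
      case False
      then obtain v where v: "v \<in> V" "\<And>\<mu> t. (\<mu>, v, t) \<in> S \<Longrightarrow> \<rho> * (j - 1) \<le> t" using i f by blast
      obtain \<mu> t where t: "(\<mu>, v, t) \<in> S" using f v(1) unfolding feasible_def by blast
      have "finite S" using f unfolding feasible_def by blast
      then have "t + 1 \<le> makespan S" using t by (auto simp: makespan_def intro!: Max_ge rev_image_eqI)
      then have "\<rho> * (j - 1) \<le> makespan S" using v(2)[OF t] by simp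
      moreover have "\<rho> * j = \<rho> * (j - 1) + \<rho>" using False by (cases j) auto
      ultimately show ?thesis using i by (simp add: mult.commute)
    qed
    have "\<tau>1 \<le> card V + card E + 6916 * L * (card V + card E)" using i by (simp add: E1)
    also have "\<dots> \<le> 1 * (L * (card V + card E)) + 6916 * L * (card V + card E)"
      using mult_right_mono[OF L, of "card V + card E"] by simp
    finally have "\<tau>1 \<le> 6917 * L * (card V + card E)" by (simp add: algebra_simps)
    then show ?case using i ms unfolding s E1 by auto
  qed simp
qed

section \<open>ScheduleGeneralGraph\<close>

lemma partial_schedule_empty: "partial_schedule E M \<rho> {} 0 {}"
  by (simp add: partial_schedule_def feasible_def)

text \<open>Every part has its predecessors in itself or in earlier parts, so the set
  \<open>D\<close> of finished jobs stays closed under predecessors while the parts are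
  appended.\<close>

lemma whp_schedule_all:
  fixes V :: "'a set"
  assumes V: "finite V" "acyclic E" "finite E"
    and \<gamma>: "0 < \<gamma>" "4 * \<gamma> < 1" and L: "L \<ge> 1" and M: "M \<ge> 1" and \<rho>: "\<rho> \<ge> 1"
    and n: "card V \<le> n" and \<eta>: "(1/2) ^ N \<le> \<eta>" "(11/16) ^ L \<le> \<eta>"
    and \<beta>: "\<And>j. (1 / (4 * \<gamma>)) ^ j \<le> 8 * real \<rho> ^ 3 * (1 / (4 * \<gamma>)) ^ 2 \<Longrightarrow> real j \<le> \<beta>"
  defines "W \<equiv> \<beta> * ((1 + log 2 (real n)) * (11002 * (real L + real N))) + (4 + 28 * real N) / \<gamma>"
  shows "parts_fit \<rho> E D Hs \<Longrightarrow> \<Union> (fst ` set Hs) \<subseteq> V \<Longrightarrow> (\<And>u v. (u, v) \<in> E \<Longrightarrow> v \<in> D \<Longrightarrow> u \<in> D) \<Longrightarrow>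
    partial_schedule E M \<rho> D T S \<Longrightarrow>
    whp (real (length Hs) * (14 * real n ^ 5 * \<eta>)) (schedule_all N L \<gamma> M \<rho> Hs (T, S, \<tau>))
    (\<lambda>(T', S', \<tau>'). partial_schedule E M \<rho> (D \<union> \<Union> (fst ` set Hs)) T' S' \<and>
       real T' \<le> real T + real (\<Sum>H\<leftarrow>Hs. card (fst H)) / (\<gamma> * real M) + real (length Hs) * (3 * real \<rho> * \<beta>) \<and>
       real \<tau>' \<le> real \<tau> + W * (real (\<Sum>H\<leftarrow>Hs. card (fst H)) + real (\<Sum>H\<leftarrow>Hs. card (snd H)))
          + real (heap_time M) * real (\<Sum>H\<leftarrow>Hs. card (fst H)))"
proof (induction Hs arbitrary: D T S \<tau>)
  case Nil
  then show ?case by (auto intro!: whp_return)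
next
  case (Cons H Hs)
  obtain X F where H: "H = (X, F)" by (cases H)
  define \<delta> where "\<delta> = 14 * real n ^ 5 * \<eta>"
  have \<delta>0: "\<delta> \<ge> 0" using order_trans[OF _ \<eta>(1), of 0] by (simp add: \<delta>_def)
  have X: "F = induced E X" "D \<inter> X = {}" "\<And>u v. (u, v) \<in> E \<Longrightarrow> v \<in> X \<Longrightarrow> u \<in> D \<union> X"
    "\<And>v. v \<in> X \<Longrightarrow> card (anc F v) \<le> 2 * \<rho>" and rest: "parts_fit \<rho> E (D \<union> X) Hs"
    using Cons.prems(1) by (auto simp: H part_fits_def)
  have XV: "X \<subseteq> V" and HsV: "\<Union> (fst ` set Hs) \<subseteq> V" using Cons.prems(2) by (auto simp: H)
  have cX: "card X \<le> n" using card_mono[OF V(1) XV] n by simp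
  have finX: "finite X" by (rule finite_subset[OF XV V(1)])
  have closed: "u \<in> D \<union> X" if "(u, v) \<in> E" "v \<in> D \<union> X" for u v
    using that X(3) Cons.prems(3) by blast
  have small: "whp \<delta> (schedule_small_subgraph N L \<gamma> M \<rho> (X, F) (T, S, \<tau>))
    (\<lambda>(T', S', \<tau>'). partial_schedule E M \<rho> (D \<union> X) T' S' \<and>
       real T' \<le> real T + real (card X) / (\<gamma> * real M) + 3 * real \<rho> * \<beta> \<and>
       real \<tau>' \<le> real \<tau> + \<beta> * ((1 + log 2 (real n)) * (11002 * (real L + real N) * (real (card X) + real (card F))))
          + (real (card X) + real (card F)) * ((4 + 28 * real N) / \<gamma>) + real (heap_time M) * real (card X))"
    unfolding \<delta>_def
    by (rule whp_schedule_small_subgraph[OF finX V(2,3) X(1) _ _ X(2) \<gamma> L M \<rho> cX \<eta> _ Cons.prems(4)])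
      (fact Cons.prems(3) X(3) X(4) \<beta>)+
  have "whp (\<delta> + real (length Hs) * \<delta>) (schedule_small_subgraph N L \<gamma> M \<rho> (X, F) (T, S, \<tau>) \<bind> schedule_all N L \<gamma> M \<rho> Hs)
    (\<lambda>(T', S', \<tau>'). partial_schedule E M \<rho> (D \<union> \<Union> (fst ` set (H # Hs))) T' S' \<and>
       real T' \<le> real T + real (\<Sum>H\<leftarrow>H # Hs. card (fst H)) / (\<gamma> * real M) + real (length (H # Hs)) * (3 * real \<rho> * \<beta>) \<and>
       real \<tau>' \<le> real \<tau> + W * (real (\<Sum>H\<leftarrow>H # Hs. card (fst H)) + real (\<Sum>H\<leftarrow>H # Hs. card (snd H)))
          + real (heap_time M) * real (\<Sum>H\<leftarrow>H # Hs. card (fst H)))" (is "whp _ _ ?Q")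
  proof (rule whp_bind[OF small])
    fix st1 assume h1: "case st1 of (T', S', \<tau>') \<Rightarrow> partial_schedule E M \<rho> (D \<union> X) T' S' \<and>
       real T' \<le> real T + real (card X) / (\<gamma> * real M) + 3 * real \<rho> * \<beta> \<and>
       real \<tau>' \<le> real \<tau> + \<beta> * ((1 + log 2 (real n)) * (11002 * (real L + real N) * (real (card X) + real (card F))))
          + (real (card X) + real (card F)) * ((4 + 28 * real N) / \<gamma>) + real (heap_time M) * real (card X)"
    obtain T1 S1 \<tau>1 where st1: "st1 = (T1, S1, \<tau>1)" by (cases st1)
    have p: "partial_schedule E M \<rho> (D \<union> X) T1 S1"
      and T1: "real T1 \<le> real T + real (card X) / (\<gamma> * real M) + 3 * real \<rho> * \<beta>"
      and \<tau>1: "real \<tau>1 \<le> real \<tau> + W * (real (card X) + real (card F)) + real (heap_time M) * real (card X)"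
      using h1 by (auto simp: st1 W_def algebra_simps)
    have IH: "whp (real (length Hs) * \<delta>) (schedule_all N L \<gamma> M \<rho> Hs (T1, S1, \<tau>1))
      (\<lambda>(T', S', \<tau>'). partial_schedule E M \<rho> (D \<union> X \<union> \<Union> (fst ` set Hs)) T' S' \<and>
       real T' \<le> real T1 + real (\<Sum>H\<leftarrow>Hs. card (fst H)) / (\<gamma> * real M) + real (length Hs) * (3 * real \<rho> * \<beta>) \<and>
       real \<tau>' \<le> real \<tau>1 + W * (real (\<Sum>H\<leftarrow>Hs. card (fst H)) + real (\<Sum>H\<leftarrow>Hs. card (snd H)))
          + real (heap_time M) * real (\<Sum>H\<leftarrow>Hs. card (fst H)))"
      unfolding \<delta>_def by (rule Cons.IH[OF rest HsV _ p]) (rule closed)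
    show "whp (real (length Hs) * \<delta>) (schedule_all N L \<gamma> M \<rho> Hs st1) ?Q"
      unfolding st1
    proof (rule whp_mono[OF IH])
      fix st2 assume h2: "case st2 of (T', S', \<tau>') \<Rightarrow> partial_schedule E M \<rho> (D \<union> X \<union> \<Union> (fst ` set Hs)) T' S' \<and>
       real T' \<le> real T1 + real (\<Sum>H\<leftarrow>Hs. card (fst H)) / (\<gamma> * real M) + real (length Hs) * (3 * real \<rho> * \<beta>) \<and>
       real \<tau>' \<le> real \<tau>1 + W * (real (\<Sum>H\<leftarrow>Hs. card (fst H)) + real (\<Sum>H\<leftarrow>Hs. card (snd H)))
          + real (heap_time M) * real (\<Sum>H\<leftarrow>Hs. card (fst H))"
      then show "?Q st2" using T1 \<tau>1
        by (auto simp: H Un_assoc add_divide_distrib algebra_simps)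
    qed simp
  qed (use \<delta>0 in auto)
  then show ?case by (simp add: H \<delta>_def algebra_simps)
qed

text \<open>The volume bound: one chosen copy of each job occupies a slot of its own among
  \<open>M * makespan S\<close> slots.\<close>

lemma card_le_machines_makespan:
  assumes "feasible V E M \<rho> S" "finite V"
  shows "card V \<le> M * makespan S"
proof -
  have fin: "finite S" and mach: "\<And>\<mu> v t. (\<mu>, v, t) \<in> S \<Longrightarrow> \<mu> < M"
    and uniq: "\<And>\<mu> v w t. (\<mu>, v, t) \<in> S \<Longrightarrow> (\<mu>, w, t) \<in> S \<Longrightarrow> v = w"
    and all: "\<forall>v\<in>V. \<exists>x. (fst x, v, snd x) \<in> S"
    using assms(1) unfolding feasible_def by auto
  from all obtain h where h: "\<And>v. v \<in> V \<Longrightarrow> (fst (h v), v, snd (h v)) \<in> S" by metis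
  have "inj_on h V"
  proof (rule inj_onI)
    fix v w assume "v \<in> V" "w \<in> V" "h v = h w"
    then show "v = w" using h[of v] h[of w] uniq by metis
  qed
  moreover have "h ` V \<subseteq> {..<M} \<times> {..<makespan S}"
  proof
    fix x assume "x \<in> h ` V"
    then obtain v where v: "(fst x, v, snd x) \<in> S" using h by auto
    then have "snd x + 1 \<le> makespan S"
      using fin by (auto simp: makespan_def intro!: Max_ge rev_image_eqI[OF v])
    then show "x \<in> {..<M} \<times> {..<makespan S}" using mach[OF v] by (cases x) auto
  qed
  ultimately have "card V \<le> card ({..<M} \<times> {..<makespan S})" by (rule card_inj_on_le) simp
  then show ?thesis by (simp add: card_cartesian_product)
qed

text \<open>\<open>OPT\<close> is a \<open>LEAST\<close> and carries information only if some
  feasible schedule exists; the schedule produced by the algorithm serves as this witness.\<close>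

lemma OPT_attained:
  assumes "feasible V E M \<rho> S"
  obtains S0 where "feasible V E M \<rho> S0" "makespan S0 = OPT V E M \<rho>"
proof -
  have "\<exists>S0. feasible V E M \<rho> S0 \<and> makespan S0 = OPT V E M \<rho>"
    unfolding OPT_def by (rule LeastI_ex) (use assms in blast)
  then show ?thesis using that by blast
qed

lemma makespan_partial_schedule:
  assumes "partial_schedule E M \<rho> D T S"
  shows "makespan S \<le> T"
proof (cases "S = {}")
  case False
  have "finite S" "\<And>\<mu> v t. (\<mu>, v, t) \<in> S \<Longrightarrow> t + 1 + \<rho> \<le> T"
    using assms by (auto simp: partial_schedule_def feasible_def)
  then show ?thesis using False by (force simp: makespan_def)
qed (simp add: makespan_def)

section \<open>Numerical estimates for the final bounds\<close>

lemma ln_2_ge_half: "ln (2::real) \<ge> 1/2"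
  using ln2_ge_two_thirds by simp

lemma ln_nat_ge_half:
  assumes "n \<ge> (2::nat)"
  shows "ln (real n) \<ge> 1/2"
proof -
  have "ln 2 \<le> ln (real n)" using assms by (subst ln_le_cancel_iff) auto
  then show ?thesis using ln_2_ge_half by linarith
qed

lemma heap_time_le:
  assumes "M \<ge> 1"
  shows "real (heap_time M) \<le> 4 * ln (real M)"
proof (cases "M = 1")
  case True
  then show ?thesis by (simp add: heap_time_def)
next
  case False
  then have M: "2 \<le> real M" using assms by simp
  have "1 \<le> log 2 (real M)" using M by (simp add: le_log_iff)
  then have "real (heap_time M) \<le> log 2 (real M) + 1" by (simp add: heap_time_def)
  also have "\<dots> \<le> 2 * log 2 (real M)" using \<open>1 \<le> log 2 (real M)\<close> by simp
  also have "\<dots> = 2 * ln (real M) / ln 2" by (simp add: log_def)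
  also have "\<dots> \<le> 2 * ln (real M) / (1/2)"
    using ln_2_ge_half M by (intro divide_left_mono) auto
  finally show ?thesis by simp
qed

lemma power_eleven_sixteenths_le: "(11/16 :: real) ^ k \<le> exp (- real k / 4)"
proof -
  have "exp (1/4 :: real) \<le> 16/11"
  proof (rule ccontr)
    assume "\<not> ?thesis"
    then have "(16/11 :: real) ^ 4 \<le> exp (1/4) ^ 4" by (intro power_mono) auto
    also have "\<dots> = exp 1" by (simp add: exp_of_nat_mult[symmetric])
    finally show False using e_less_272 by (simp add: power_divide)
  qed
  then have "(11/16 :: real) \<le> exp (- (1/4))" by (simp add: exp_minus field_simps)
  then have "(11/16 :: real) ^ k \<le> exp (- (1/4)) ^ k" by (intro power_mono) auto
  also have "\<dots> = exp (- real k / 4)" by (simp add: exp_of_nat_mult[symmetric])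
  finally show ?thesis .
qed

lemma log_many_bounds:
  assumes "\<kappa> \<ge> 0" "n \<ge> 2"
  shows "log_many \<kappa> n \<ge> 1" "\<kappa> * ln (real n) \<le> real (log_many \<kappa> n)" "real (log_many \<kappa> n) \<le> (\<kappa> + 2) * ln (real n)"
proof -
  have l: "ln (real n) \<ge> 1/2" using assms(2) by (rule ln_nat_ge_half)
  have p: "0 \<le> \<kappa> * ln (real n)" using assms(1) l by simp
  show "log_many \<kappa> n \<ge> 1" "\<kappa> * ln (real n) \<le> real (log_many \<kappa> n)"
    unfolding log_many_def by linarith+
  have "real (log_many \<kappa> n) \<le> \<kappa> * ln (real n) + 1"
    unfolding log_many_def using p by linarith
  then show "real (log_many \<kappa> n) \<le> (\<kappa> + 2) * ln (real n)" using l by (simp add: algebra_simps)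
qed

text \<open>The prefactor \<open>16 * n ^ 6\<close> is at most \<open>n ^ 10\<close>, as 16 \<le>
  n^4 for n \<ge> 2, whence \<open>c + 10\<close>; the factor 4 compensates the rate 1/4 in
  \<open>power_eleven_sixteenths_le\<close>.\<close>

lemma failure_le:
  assumes "c \<ge> 1" "n \<ge> 2"
  shows "16 * real n ^ 6 * (11/16) ^ log_many (4 * (c + 10)) n \<le> real n powr (- c)"
proof -
  have n: "real n \<ge> 2" using assms(2) by simp
  have "(11/16 :: real) ^ log_many (4 * (c + 10)) n \<le> exp (- real (log_many (4 * (c + 10)) n) / 4)"
    by (rule power_eleven_sixteenths_le)
  also have "\<dots> \<le> exp (- (c + 10) * ln (real n))"
    using log_many_bounds(2)[of "4 * (c + 10)" n] assms by (simp add: algebra_simps)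
  also have "\<dots> = real n powr (- (c + 10))" using n by (simp add: powr_def)
  also have "\<dots> = real n powr (- c) / real n ^ 10"
  proof -
    have "real n powr (- (c + 10)) = real n powr (- c - 10)" by simp
    also have "\<dots> = real n powr (- c) / real n powr 10" by (rule powr_diff)
    also have "real n powr 10 = real n ^ 10" using n powr_realpow[of "real n" 10] by simp
    finally show ?thesis .
  qed
  finally have "16 * real n ^ 6 * (11/16) ^ log_many (4 * (c + 10)) n \<le> 16 * real n ^ 6 * (real n powr (- c) / real n ^ 10)"
    by (intro mult_left_mono) auto
  also have "\<dots> = 16 / real n ^ 4 * real n powr (- c)" using n by (simp add: field_simps)
  also have "\<dots> \<le> 1 * real n powr (- c)"
  proof (rule mult_right_mono)
    have "(2::real) ^ 4 \<le> real n ^ 4" using n by (intro power_mono) auto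
    then show "16 / real n ^ 4 \<le> 1" using n by (simp add: field_simps)
  qed simp
  finally show ?thesis by simp
qed

text \<open>The threshold exp 256 makes l \<ge> 256 = 4^4, so that g = sqrt l / 4 is at least the
  fourth root of l and ln g \<ge> ln l / 4. Taking logarithms of the inequality for j gives (j - 2)
  ln g \<le> ln 8 + 3 l \<le> 4 l, hence j \<le> 2 + 16 \<Lambda> \<le> 18 \<Lambda>.\<close>

lemma large_delay:
  fixes \<rho> :: nat
  assumes \<rho>: "\<rho> \<ge> nat \<lceil>exp (256::real)\<rceil>"
  defines "l \<equiv> ln (real \<rho>)"
  defines "\<Lambda> \<equiv> l / ln l" and "\<gamma> \<equiv> 1 / sqrt l"
  shows "0 < \<gamma>" "4 * \<gamma> < 1" "1 \<le> \<Lambda>" "sqrt l \<le> 2 * \<Lambda>"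
    and "(1 / (4 * \<gamma>)) ^ j \<le> 8 * real \<rho> ^ 3 * (1 / (4 * \<gamma>)) ^ 2 \<Longrightarrow> real j \<le> 18 * \<Lambda>"
proof -
  have "exp 256 \<le> real \<rho>" using \<rho> by linarith
  then have \<rho>0: "real \<rho> > 0" by (rule less_le_trans[OF exp_gt_zero])
  then have l: "l \<ge> 256" using \<open>exp 256 \<le> real \<rho>\<close> by (simp add: l_def ln_ge_iff)
  have s: "sqrt l \<ge> 16" using l by (intro real_le_rsqrt) auto
  have s0: "sqrt l > 0" using s by linarith
  show "0 < \<gamma>" "4 * \<gamma> < 1" using s s0 l by (simp_all add: \<gamma>_def divide_less_eq)
  have "ln 256 \<le> ln l" using l by simp
  moreover have "ln (256::real) = 4 * ln 4" using ln_realpow[of "4::real" 4] by simp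
  ultimately have ll: "4 * ln 4 \<le> ln l" by simp
  have ln4: "ln (4::real) \<ge> 1" using ln_realpow[of "2::real" 2] ln_2_ge_half by simp
  have ll0: "ln l > 0" using ll ln4 by linarith
  have "ln l \<le> l" using l ln_le_minus_one[of l] by simp
  then show \<Lambda>1: "1 \<le> \<Lambda>" using ll0 by (simp add: \<Lambda>_def field_simps)
  have "ln l = 2 * ln (sqrt l)" using l by (simp add: ln_sqrt)
  also have "\<dots> \<le> 2 * sqrt l" using s0 ln_le_minus_one[of "sqrt l"] by linarith
  finally have "sqrt l * ln l \<le> sqrt l * (2 * sqrt l)" using l by (intro mult_left_mono) auto
  also have "\<dots> = 2 * l" using l by simp
  finally show "sqrt l \<le> 2 * \<Lambda>" using ll0 by (simp add: \<Lambda>_def field_simps)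
  define g where "g = 1 / (4 * \<gamma>)"
  have g: "g = sqrt l / 4" by (simp add: g_def \<gamma>_def)
  have g0: "g > 0" using l by (simp add: g)
  have "ln g = ln l / 2 - ln 4" using s l by (simp add: g ln_div ln_sqrt)
  then have lg: "ln g \<ge> ln l / 4" using ll by simp
  show "real j \<le> 18 * \<Lambda>" if "(1 / (4 * \<gamma>)) ^ j \<le> 8 * real \<rho> ^ 3 * (1 / (4 * \<gamma>)) ^ 2"
  proof -
    have "g ^ j \<le> 8 * real \<rho> ^ 3 * g ^ 2" using that by (simp add: g_def)
    then have "ln (g ^ j) \<le> ln (8 * real \<rho> ^ 3 * g ^ 2)" using g0 \<rho>0 by simp
    also have "\<dots> = ln 8 + 3 * l + 2 * ln g" using g0 \<rho>0 by (simp add: ln_mult ln_realpow l_def)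
    also have "ln (g ^ j) = real j * ln g" using g0 by (simp add: ln_realpow)
    finally have "(real j - 2) * ln g \<le> ln 8 + 3 * l" by (simp add: algebra_simps)
    also have "\<dots> \<le> 4 * l" using l ln_le_minus_one[of "8::real"] by simp
    finally have j: "(real j - 2) * ln g \<le> 4 * l" .
    have "real j - 2 \<le> 16 * \<Lambda>"
    proof (cases "real j \<le> 2")
      case False
      then have "(real j - 2) * (ln l / 4) \<le> (real j - 2) * ln g" using lg by (intro mult_left_mono) auto
      then have "(real j - 2) * (ln l / 4) \<le> 4 * l" using j by linarith
      then show ?thesis using ll0 by (simp add: \<Lambda>_def field_simps)
    qed (use \<Lambda>1 in simp)
    then show ?thesis using \<Lambda>1 by linarith
  qed
qed

text \<open>To be read with b = ln n, lg = log 2 n, r = 1 / \<gamma>, s = n + m and x = max n m. The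
  terms grow at most like b^2, and b \<ge> 1/2 raises them to b^3. The constant is 2 * (27668 +
  3168576 + 288).\<close>

lemma running_time_le:
  fixes b \<Lambda> x K r L :: real
  assumes b: "b \<ge> 1/2" and \<Lambda>: "\<Lambda> \<ge> 1" and K: "K \<ge> 1" and L: "0 \<le> L" "L \<le> K * b" and x: "0 \<le> s" "s \<le> 2 * x"
    and r: "r \<le> 2 * \<Lambda>" and lg: "lg \<le> 2 * b"
  shows "6917 * L * s + (18 * \<Lambda> * ((1 + lg) * (11002 * (L + L))) + (4 + 28 * L) * r) * s
    \<le> 6393064 * K * (x * b ^ 3 * \<Lambda>)"
proof -
  have x0: "x \<ge> 0" using x by linarith
  have b2: "b \<le> 2 * b ^ 2" and b3: "b ^ 2 \<le> 2 * b ^ 3"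
  proof -
    have "b * 1 \<le> b * (2 * b)" "b ^ 2 * 1 \<le> b ^ 2 * (2 * b)" using b by (intro mult_left_mono; simp)+
    then show "b \<le> 2 * b ^ 2" "b ^ 2 \<le> 2 * b ^ 3" by (simp_all add: power2_eq_square power3_eq_cube)
  qed
  have Kb: "0 \<le> K * b" using K b by simp
  have 1: "6917 * L \<le> 27668 * K * (b ^ 3 * \<Lambda>)"
  proof -
    have "b * 1 \<le> (4 * b ^ 3) * \<Lambda>" using b2 b3 b \<Lambda> by (intro mult_mono) auto
    then have "K * b \<le> K * (4 * b ^ 3 * \<Lambda>)" using K by (intro mult_left_mono) auto
    then show ?thesis using L(2) by (simp add: algebra_simps)
  qed
  have 2: "18 * \<Lambda> * ((1 + lg) * (11002 * (L + L))) \<le> 3168576 * K * (b ^ 3 * \<Lambda>)"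
  proof -
    have "(1 + lg) * (11002 * (L + L)) \<le> (4 * b) * (22004 * (K * b))"
    proof (cases "0 \<le> 1 + lg")
      case True
      have "22004 * L \<le> 22004 * (K * b)" using L(2) by (rule mult_left_mono) simp
      then have "11002 * (L + L) \<le> 22004 * (K * b)" by simp
      then show ?thesis using lg b L True by (intro mult_mono[of "1 + lg" "4 * b"]) auto
    next
      case False
      then have "(1 + lg) * (11002 * (L + L)) \<le> 0" using L by (intro mult_nonpos_nonneg) auto
      also have "0 \<le> (4 * b) * (22004 * (K * b))" using b Kb by simp
      finally show ?thesis .
    qed
    also have "\<dots> = 88016 * K * b ^ 2" by (simp add: power2_eq_square)
    also have "\<dots> \<le> 88016 * K * (2 * b ^ 3)" using b3 K by (intro mult_left_mono) auto
    finally have "(18 * \<Lambda>) * ((1 + lg) * (11002 * (L + L))) \<le> (18 * \<Lambda>) * (88016 * K * (2 * b ^ 3))"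
      using \<Lambda> by (intro mult_left_mono) auto
    then show ?thesis by (simp add: algebra_simps)
  qed
  have 3: "(4 + 28 * L) * r \<le> 288 * K * (b ^ 3 * \<Lambda>)"
  proof -
    have "4 \<le> 8 * (K * b)" using mult_mono[OF K b] K by simp
    then have "4 + 28 * L \<le> 36 * (K * b)" using L(2) by linarith
    also have "\<dots> \<le> 36 * (K * (4 * b ^ 3))" using b2 b3 K by (intro mult_left_mono) auto
    finally have a: "4 + 28 * L \<le> 36 * (K * (4 * b ^ 3))" .
    have "(4 + 28 * L) * r \<le> (4 + 28 * L) * (2 * \<Lambda>)" using r L by (intro mult_left_mono) auto
    also have "\<dots> \<le> (36 * (K * (4 * b ^ 3))) * (2 * \<Lambda>)" using a \<Lambda> by (intro mult_right_mono) auto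
    finally show ?thesis by (simp add: algebra_simps)
  qed
  define z where "z = K * (b ^ 3 * \<Lambda>)"
  have z: "z \<ge> 0" using K b \<Lambda> by (simp add: z_def)
  have "6917 * L + (18 * \<Lambda> * ((1 + lg) * (11002 * (L + L))) + (4 + 28 * L) * r) \<le> 3196532 * z"
    using 1 2 3 unfolding z_def by linarith
  then have "(6917 * L + (18 * \<Lambda> * ((1 + lg) * (11002 * (L + L))) + (4 + 28 * L) * r)) * s \<le> (3196532 * z) * s"
    using x(1) by (rule mult_right_mono)
  also have "\<dots> \<le> (3196532 * z) * (2 * x)" using x(2) z by (intro mult_left_mono) auto
  finally show ?thesis by (simp add: z_def algebra_simps)
qed

text \<open>With \<open>N = L\<close> a single number bounds both kinds of failure, since
  \<open>(1/2) ^ L \<le> (11/16) ^ L\<close>. The optimum enters twice: the volume bound turns the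
  work term n / (\<gamma> M) into OPT / \<gamma>, and the bound on the number of parts controls the
  delays.\<close>

lemma whp_schedule_general_graph:
  fixes V :: "'a set" and \<rho> :: nat
  assumes V: "finite V" "E \<subseteq> V \<times> V" "acyclic E" and M: "M \<ge> 1"
    and \<gamma>: "0 < \<gamma>" "4 * \<gamma> < 1" and L: "L \<ge> 1" and \<rho>: "\<rho> \<ge> 1"
    and \<beta>: "\<And>j. (1 / (4 * \<gamma>)) ^ j \<le> 8 * real \<rho> ^ 3 * (1 / (4 * \<gamma>)) ^ 2 \<Longrightarrow> real j \<le> \<beta>" and n: "n = card V" "n \<ge> 1"
  shows "whp (16 * real n ^ 6 * (11/16) ^ L) (schedule_general_graph L L \<gamma> M \<rho> V E)
    (\<lambda>(S, \<tau>). feasible V E M \<rho> S \<and>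
       real (makespan S) \<le> real (OPT V E M \<rho>) / \<gamma> + 3 * \<beta> * (real (OPT V E M \<rho>) + real \<rho>) \<and>
       real \<tau> \<le> 6917 * real L * (real n + real (card E))
         + (\<beta> * ((1 + log 2 (real n)) * (11002 * (real L + real L))) + (4 + 28 * real L) / \<gamma>) * (real n + real (card E))
         + real (heap_time M) * real n)"
proof -
  have finE: "finite E" using V finite_subset[OF V(2)] by simp
  define \<eta> where "\<eta> = (11/16 :: real) ^ L"
  have \<eta>: "(1/2) ^ L \<le> \<eta>" "(11/16) ^ L \<le> \<eta>" "\<eta> \<ge> 0" unfolding \<eta>_def by (auto intro: power_mono)
  define W where "W = \<beta> * ((1 + log 2 (real n)) * (11002 * (real L + real L))) + (4 + 28 * real L) / \<gamma>"
  have \<beta>0: "\<beta> \<ge> 0"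
  proof -
    have "1 / (4 * \<gamma>) \<ge> 1" using \<gamma> by (simp add: field_simps)
    moreover have "1 \<le> real \<rho> ^ 3" using \<rho> by (intro one_le_power) simp
    ultimately have "1 * 1 \<le> (8 * real \<rho> ^ 3) * (1 / (4 * \<gamma>)) ^ 2"
      using one_le_power[of "1 / (4 * \<gamma>)" 2] by (intro mult_mono) linarith+
    then show ?thesis using \<beta>[of 0] by simp
  qed
  have W0: "W \<ge> 0" using \<beta>0 \<gamma> n by (simp add: W_def)
  have "whp (real n ^ 2 * \<eta> + (real n * (14 * real n ^ 5 * \<eta>) + 0)) (schedule_general_graph L L \<gamma> M \<rho> V E)
    (\<lambda>(S, \<tau>). feasible V E M \<rho> S \<and>
       real (makespan S) \<le> real (OPT V E M \<rho>) / \<gamma> + 3 * \<beta> * (real (OPT V E M \<rho>) + real \<rho>) \<and>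
       real \<tau> \<le> 6917 * real L * (real n + real (card E)) + W * (real n + real (card E)) + real (heap_time M) * real n)"
    unfolding schedule_general_graph_def
  proof (rule whp_bind[OF whp_partition_graph[OF V L \<rho> M \<eta>(2), folded n(1)]])
    fix R assume "case R of (Hs, \<tau>) \<Rightarrow>
       parts_fit \<rho> E {} Hs \<and> \<Union> (fst ` set Hs) = V \<and> length Hs \<le> n \<and>
       (\<Sum>H\<leftarrow>Hs. card (fst H)) = n \<and> (\<Sum>H\<leftarrow>Hs. card (snd H)) \<le> card E \<and>
       (\<forall>S. feasible V E M \<rho> S \<longrightarrow> length Hs * \<rho> \<le> makespan S + \<rho>) \<and>
       \<tau> \<le> 6917 * L * (n + card E)"
    moreover obtain Hs \<tau>H where R: "R = (Hs, \<tau>H)" by (cases R)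
    ultimately have fit: "parts_fit \<rho> E {} Hs" and un: "\<Union> (fst ` set Hs) = V" and len: "length Hs \<le> n"
      and sV: "(\<Sum>H\<leftarrow>Hs. card (fst H)) = n" and sE: "(\<Sum>H\<leftarrow>Hs. card (snd H)) \<le> card E"
      and lb: "\<And>S. feasible V E M \<rho> S \<Longrightarrow> length Hs * \<rho> \<le> makespan S + \<rho>"
      and \<tau>H: "\<tau>H \<le> 6917 * L * (n + card E)" by auto
    have "whp (real (length Hs) * (14 * real n ^ 5 * \<eta>)) (schedule_all L L \<gamma> M \<rho> Hs (0, {}, \<tau>H))
      (\<lambda>(T', S', \<tau>'). partial_schedule E M \<rho> ({} \<union> \<Union> (fst ` set Hs)) T' S' \<and>
         real T' \<le> real 0 + real (\<Sum>H\<leftarrow>Hs. card (fst H)) / (\<gamma> * real M) + real (length Hs) * (3 * real \<rho> * \<beta>) \<and>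
         real \<tau>' \<le> real \<tau>H + W * (real (\<Sum>H\<leftarrow>Hs. card (fst H)) + real (\<Sum>H\<leftarrow>Hs. card (snd H)))
            + real (heap_time M) * real (\<Sum>H\<leftarrow>Hs. card (fst H)))"
      unfolding W_def
      by (rule whp_schedule_all[OF V(1,3) finE \<gamma> L M \<rho> _ \<eta>(1,2) \<beta> fit _ _ partial_schedule_empty])
        (use n un in auto)
    then have sched: "whp (real n * (14 * real n ^ 5 * \<eta>)) (schedule_all L L \<gamma> M \<rho> Hs (0, {}, \<tau>H))
      (\<lambda>(T', S', \<tau>'). partial_schedule E M \<rho> V T' S' \<and>
         real T' \<le> real n / (\<gamma> * real M) + real (length Hs) * (3 * real \<rho> * \<beta>) \<and>
         real \<tau>' \<le> real \<tau>H + W * (real n + real (card E)) + real (heap_time M) * real n)"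
    proof (rule whp_mono, goal_cases)
      case 1
      show ?case using len \<eta> by (intro mult_right_mono) auto
    next
      case (2 st)
      have "W * (real n + real (\<Sum>H\<leftarrow>Hs. card (snd H))) \<le> W * (real n + real (card E))"
        using sE W0 by (intro mult_left_mono) auto
      then show ?case using 2(2) unfolding sV un by auto
    qed
    show "whp (real n * (14 * real n ^ 5 * \<eta>) + 0) (case R of (Hs, \<tau>\<^sub>H) \<Rightarrow> do {
        (T, S, \<tau>) \<leftarrow> schedule_all L L \<gamma> M \<rho> Hs (0, {}, \<tau>\<^sub>H);
        return_spmf (S, \<tau>)})
     (\<lambda>(S, \<tau>). feasible V E M \<rho> S \<and>
       real (makespan S) \<le> real (OPT V E M \<rho>) / \<gamma> + 3 * \<beta> * (real (OPT V E M \<rho>) + real \<rho>) \<and>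
       real \<tau> \<le> 6917 * real L * (real n + real (card E)) + W * (real n + real (card E)) + real (heap_time M) * real n)"
      unfolding R prod.case
    proof (rule whp_bind[OF sched])
      fix st assume h: "case st of (T', S', \<tau>') \<Rightarrow> partial_schedule E M \<rho> V T' S' \<and>
         real T' \<le> real n / (\<gamma> * real M) + real (length Hs) * (3 * real \<rho> * \<beta>) \<and>
         real \<tau>' \<le> real \<tau>H + W * (real n + real (card E)) + real (heap_time M) * real n"
      obtain T S \<tau> where st: "st = (T, S, \<tau>)" by (cases st)
      have part: "partial_schedule E M \<rho> V T S"
        and T: "real T \<le> real n / (\<gamma> * real M) + real (length Hs) * (3 * real \<rho> * \<beta>)"
        and \<tau>: "real \<tau> \<le> real \<tau>H + W * (real n + real (card E)) + real (heap_time M) * real n"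
        using h by (auto simp: st)
      have "induced E V = E" using V(2) by (auto simp: induced_def)
      then have f: "feasible V E M \<rho> S" using part by (simp add: partial_schedule_def)
      obtain S0 where S0: "feasible V E M \<rho> S0" "makespan S0 = OPT V E M \<rho>" using OPT_attained[OF f] .
      let ?O = "real (OPT V E M \<rho>)"
      have "real (makespan S) \<le> real T" using makespan_partial_schedule[OF part] by simp
      also note T
      also have "real n / (\<gamma> * real M) \<le> ?O / \<gamma>"
      proof -
        have "real n \<le> real (M * OPT V E M \<rho>)"
          using card_le_machines_makespan[OF S0(1) V(1)] unfolding S0(2) n(1) by (simp only: of_nat_le_iff)
        then have "real n \<le> real M * ?O" by simp
        then have "real n / (\<gamma> * real M) \<le> real M * ?O / (\<gamma> * real M)" using \<gamma> by (intro divide_right_mono) auto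
        also have "\<dots> = ?O / \<gamma>" using M by simp
        finally show ?thesis .
      qed
      also have "real (length Hs) * (3 * real \<rho> * \<beta>) \<le> 3 * \<beta> * (?O + real \<rho>)"
      proof -
        have "real (length Hs * \<rho>) \<le> real (OPT V E M \<rho> + \<rho>)" using lb[OF S0(1)] unfolding S0(2) by (simp only: of_nat_le_iff)
        then have "(3 * \<beta>) * real (length Hs * \<rho>) \<le> (3 * \<beta>) * real (OPT V E M \<rho> + \<rho>)" using \<beta>0 by (intro mult_left_mono) auto
        then show ?thesis by (simp add: algebra_simps)
      qed
      finally have ms: "real (makespan S) \<le> ?O / \<gamma> + 3 * \<beta> * (?O + real \<rho>)" by simp
      have "real \<tau>H \<le> real (6917 * L * (n + card E))" using \<tau>H by (simp only: of_nat_le_iff)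
      then have "real \<tau> \<le> 6917 * real L * (real n + real (card E)) + W * (real n + real (card E)) + real (heap_time M) * real n"
        using \<tau> by simp
      then show "whp 0 (case st of (T, S, \<tau>) \<Rightarrow> return_spmf (S, \<tau>)) (\<lambda>(S, \<tau>). feasible V E M \<rho> S \<and>
         real (makespan S) \<le> ?O / \<gamma> + 3 * \<beta> * (?O + real \<rho>) \<and>
         real \<tau> \<le> 6917 * real L * (real n + real (card E)) + W * (real n + real (card E)) + real (heap_time M) * real n)"
        unfolding st prod.case using f ms by (intro whp_return) auto
    qed simp
  qed (use \<eta> in simp)
  then show ?thesis
    unfolding W_def[symmetric]
  proof (rule whp_mono)
    \<comment> \<open>The partition contributes n^2 and at most n parts contribute 14 n^5 each; 16
      is 1 + 14 rounded up.\<close>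
    have "real n ^ 2 \<le> real n ^ 6" using n by (intro power_increasing) auto
    then have "real n ^ 2 * \<eta> \<le> real n ^ 6 * \<eta>" using \<eta> by (intro mult_right_mono) auto
    moreover have "real n * (14 * real n ^ 5 * \<eta>) = 14 * (real n ^ 6 * \<eta>)" by (simp add: eval_nat_numeral)
    moreover have "real n ^ 6 * \<eta> \<ge> 0" using \<eta> by simp
    ultimately show "real n ^ 2 * \<eta> + (real n * (14 * real n ^ 5 * \<eta>) + 0) \<le> 16 * real n ^ 6 * (11/16) ^ L"
      unfolding \<eta>_def[symmetric] by linarith
  qed
qed

theorem theorem14:
  shows "\<exists>\<rho>\<^sub>0::nat. \<forall>c::real. c \<ge> 1 \<longrightarrow>
    (\<exists>\<kappa>\<^sub>N \<kappa>\<^sub>L C :: real. \<kappa>\<^sub>N > 0 \<and> \<kappa>\<^sub>L > 0 \<and> C > 0 \<and>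
      (\<forall>(V :: 'a set) E M \<rho> n m \<gamma>.
         finite V \<longrightarrow> V \<noteq> {} \<longrightarrow> E \<subseteq> V \<times> V \<longrightarrow> acyclic E \<longrightarrow> n = card V \<longrightarrow> m = card E \<longrightarrow>
         M \<ge> 1 \<longrightarrow> \<rho> > 1 \<longrightarrow> \<rho> \<ge> \<rho>\<^sub>0 \<longrightarrow> \<gamma> = 1 / sqrt (ln (real \<rho>)) \<longrightarrow>
         measure (measure_spmf
             (schedule_general_graph (log_many \<kappa>\<^sub>N n) (log_many \<kappa>\<^sub>L n) \<gamma> M \<rho> V E))
           {(S, \<tau>).
              feasible V E M \<rho> S \<and>
              real (makespan S)
                \<le> C * (ln (real \<rho>) / ln (ln (real \<rho>)) * (real (OPT V E M \<rho>) + real \<rho>)) \<and>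
              real \<tau>
                \<le> C * (real n * ln (real M)
                     + real (max n m) * ln (real n) ^ 3 * ln (real \<rho>) / ln (ln (real \<rho>)))}
         \<ge> 1 - real n powr (- c)))"
proof (intro exI[of _ "nat \<lceil>exp (256::real)\<rceil>"] allI impI, goal_cases)
  case (1 c)
  define \<kappa> where "\<kappa> = 4 * (c + 10)"
  have \<kappa>: "\<kappa> \<ge> 44" using 1 by (simp add: \<kappa>_def)
  \<comment> \<open>\<open>running_time_le\<close> is applied with \<open>K = \<kappa> + 2\<close>,
    because \<open>log_many \<kappa> n \<le> (\<kappa> + 2) * ln n\<close> for n \<ge> 2.\<close>
  define C where "C = 6393064 * (\<kappa> + 2)"
  have C: "C \<ge> 56" using \<kappa> by (simp add: C_def)
  show ?case
  proof (rule exI[of _ \<kappa>], rule exI[of _ \<kappa>], rule exI[of _ C], intro conjI allI impI, goal_cases)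
    case (4 V E M \<rho> n m \<gamma>)
    define l where "l = ln (real \<rho>)"
    define \<Lambda> where "\<Lambda> = l / ln l"
    note ld = large_delay[OF 4(9), folded l_def, folded \<Lambda>_def]
    have \<gamma>: "\<gamma> = 1 / sqrt l" using 4(10) by (simp add: l_def)
    show ?case
    proof (cases "n = 1")
      \<comment> \<open>For n = 1 the required probability 1 - 1 powr (- c) is 0.\<close>
      case True
      then show ?thesis by (simp add: measure_nonneg)
    next
      case False
      have n2: "n \<ge> 2" using False 4(1,2,5) card_gt_0_iff[of V] by simp
      define L where "L = log_many \<kappa> n"
      have L: "L \<ge> 1" "real L \<le> (\<kappa> + 2) * ln (real n)" using log_many_bounds[OF _ n2, of \<kappa>] \<kappa> by (auto simp: L_def)
      have b: "ln (real n) \<ge> 1/2" using n2 by (rule ln_nat_ge_half)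
      have main: "whp (16 * real n ^ 6 * (11/16) ^ L) (schedule_general_graph L L \<gamma> M \<rho> V E)
        (\<lambda>(S, \<tau>). feasible V E M \<rho> S \<and>
           real (makespan S) \<le> real (OPT V E M \<rho>) / \<gamma> + 3 * (18 * \<Lambda>) * (real (OPT V E M \<rho>) + real \<rho>) \<and>
           real \<tau> \<le> 6917 * real L * (real n + real (card E))
             + (18 * \<Lambda> * ((1 + log 2 (real n)) * (11002 * (real L + real L))) + (4 + 28 * real L) / \<gamma>) * (real n + real (card E))
             + real (heap_time M) * real n)"
        by (rule whp_schedule_general_graph) (use 4 n2 L(1) ld in \<open>auto simp: \<gamma>\<close>)
      have "whp (real n powr (- c)) (schedule_general_graph L L \<gamma> M \<rho> V E)
        (\<lambda>(S, \<tau>). feasible V E M \<rho> S \<and> real (makespan S) \<le> C * (\<Lambda> * (real (OPT V E M \<rho>) + real \<rho>)) \<and>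
          real \<tau> \<le> C * (real n * ln (real M) + real (max n m) * ln (real n) ^ 3 * \<Lambda>))"
      proof (rule whp_mono[OF main], goal_cases)
        case 1
        show ?case unfolding L_def \<kappa>_def by (rule failure_le[OF \<open>1 \<le> c\<close> n2])
      next
        case (2 R)
        obtain S \<tau> where R: "R = (S, \<tau>)" by (cases R)
        let ?O = "real (OPT V E M \<rho>)"
        have f: "feasible V E M \<rho> S" and ms: "real (makespan S) \<le> ?O / \<gamma> + 3 * (18 * \<Lambda>) * (?O + real \<rho>)"
          and \<tau>: "real \<tau> \<le> 6917 * real L * (real n + real (card E))
             + (18 * \<Lambda> * ((1 + log 2 (real n)) * (11002 * (real L + real L))) + (4 + 28 * real L) / \<gamma>) * (real n + real (card E))
             + real (heap_time M) * real n"
          using 2(2) by (auto simp: R)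
        have "?O / \<gamma> = sqrt l * ?O" by (simp add: \<gamma>)
        also have "\<dots> \<le> (2 * \<Lambda>) * (?O + real \<rho>)" using ld(3,4) by (intro mult_mono) auto
        \<comment> \<open>56 is 2 from \<open>sqrt l \<le> 2 * \<Lambda>\<close> plus 3 * 18 from
          the delays.\<close>
        finally have "real (makespan S) \<le> 56 * (\<Lambda> * (?O + real \<rho>))" using ms by simp
        also have "\<dots> \<le> C * (\<Lambda> * (?O + real \<rho>))" using C ld(3) by (intro mult_right_mono) auto
        finally have ms': "real (makespan S) \<le> C * (\<Lambda> * (?O + real \<rho>))" .
        have time: "6917 * real L * (real n + real (card E))
             + (18 * \<Lambda> * ((1 + log 2 (real n)) * (11002 * (real L + real L))) + (4 + 28 * real L) * sqrt l) * (real n + real (card E))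
           \<le> C * (real (max n m) * ln (real n) ^ 3 * \<Lambda>)"
          unfolding C_def
        proof (rule running_time_le[OF b ld(3)])
          have "log 2 (real n) = ln (real n) / ln 2" by (simp add: log_def)
          also have "\<dots> \<le> ln (real n) / (1/2)" using b ln_2_ge_half by (intro divide_left_mono) auto
          finally show "log 2 (real n) \<le> 2 * ln (real n)" by simp
        qed (use \<kappa> L ld(4) 4(6) in auto)
        have heap: "real (heap_time M) * real n \<le> C * (real n * ln (real M))"
        proof -
          have lM: "0 \<le> ln (real M)" using 4(7) by simp
          have "real (heap_time M) * real n \<le> (4 * ln (real M)) * real n"
            using heap_time_le[OF 4(7)] by (intro mult_right_mono) auto
          also have "\<dots> = 4 * (real n * ln (real M))" by simp
          also have "\<dots> \<le> C * (real n * ln (real M))" using C lM by (intro mult_right_mono) auto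
          finally show ?thesis .
        qed
        have "real \<tau> \<le> C * (real n * ln (real M) + real (max n m) * ln (real n) ^ 3 * \<Lambda>)"
        proof -
          have eq: "(4 + 28 * real L) / \<gamma> = (4 + 28 * real L) * sqrt l" by (simp add: \<gamma>)
          show ?thesis
            using \<tau>[unfolded eq] time heap unfolding distrib_left[of C] by linarith
        qed
        then show ?case using f ms' by (simp add: R)
      qed
      then show ?thesis
        by (simp add: whp_def L_def \<Lambda>_def l_def case_prod_unfold)
    qed
  qed (use \<kappa> C in auto)
qed

end
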